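(* Let $R$ be a commutative ring with unit, let $n$ be a natural number, let $\varepsilon\in R$ be invertible, and let $\mathcal{R}_n=\mathcal{R}_n(\varepsilon)$ be the rook algebra over $R$. Let $\Sigma_n$ be the symmetric group on $n$ letters, and let $R\Sigma_n$ be its group algebra. Then $$\mathrm{Tor}^{\mathcal{R}_n}_*(\mathbf{1},\mathbf{1})\cong \mathrm{Tor}^{R\Sigma_n}_*(\mathbf{1},\mathbf{1})=: H_*(\Sigma_n;\mathbf{1}).$$
   Context: A rook $n$-diagram is a graph on two columns (left and right) of $n$ nodes each, in which each node is connected to at most one other node by an edge, and every edge joins a left node to a right node. The rook algebra $\mathcal{R}_n(\varepsilon)$ is the free $R$-module on the rook $n$-diagrams, with the bilinear multiplication given on diagrams $x,y$ as follows: identify the right nodes of $x$ with the left nodes of $y$; the product $xy$ is $\varepsilon^b$ times the diagram in which two outer nodes are joined exactly when they are connected by a path in the concatenated graph (an outer node whose path ends at a middle node becomes a node with no edge), where $b$ is the number of isolated middle nodes in the concatenated graph. The trivial module $\mathbf{1}$ for $\mathcal{R}_n(\varepsilon)$ (both left and right) is a copy of $R$ on which diagrams in which every node has an edge act as multiplication by $1$ and all other diagrams act as multiplication by $0$. The trivial module $\mathbf{1}$ for $R\Sigma_n$ is $R$ with every element of $\Sigma_n$ acting as the identity. *)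

theory Defs
  imports "HOL-Algebra.Module" "HOL-Algebra.QuotRing" "HOL-Algebra.Sym_Groups"
begin

section \<open>Modules over rings that need not be commutative\<close>

text \<open>
  The library's \<^locale>\<open>module\<close> has a commutative base ring. One-sided modules over a ring are given
  here by the same records; for a right module \<open>M\<close> the term \<open>a \<odot>\<^bsub>M\<^esub> x\<close> stands for \<open>x \<cdot> a\<close>.
  The library's algebras are commutative, too. An \<open>R\<close>-algebra \<open>A\<close> is a module record as well, with
  ring operations and with \<open>\<odot>\<^bsub>A\<^esub>\<close> the action of \<open>R\<close>.
\<close>

locale left_module = A?: ring A + M?: abelian_group M
  for A :: "('a, 'c) ring_scheme" (structure) and M :: "('a, 'm, 'd) module_scheme" (structure) +
  assumes smult_closed [simp, intro]:
      "\<lbrakk>a \<in> carrier A; x \<in> carrier M\<rbrakk> \<Longrightarrow> a \<odot>\<^bsub>M\<^esub> x \<in> carrier M"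
    and smult_l_distr:
      "\<lbrakk>a \<in> carrier A; b \<in> carrier A; x \<in> carrier M\<rbrakk> \<Longrightarrow>
        (a \<oplus>\<^bsub>A\<^esub> b) \<odot>\<^bsub>M\<^esub> x = a \<odot>\<^bsub>M\<^esub> x \<oplus>\<^bsub>M\<^esub> b \<odot>\<^bsub>M\<^esub> x"
    and smult_r_distr:
      "\<lbrakk>a \<in> carrier A; x \<in> carrier M; y \<in> carrier M\<rbrakk> \<Longrightarrow>
        a \<odot>\<^bsub>M\<^esub> (x \<oplus>\<^bsub>M\<^esub> y) = a \<odot>\<^bsub>M\<^esub> x \<oplus>\<^bsub>M\<^esub> a \<odot>\<^bsub>M\<^esub> y"
    and smult_assoc:
      "\<lbrakk>a \<in> carrier A; b \<in> carrier A; x \<in> carrier M\<rbrakk> \<Longrightarrow>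
        (a \<otimes>\<^bsub>A\<^esub> b) \<odot>\<^bsub>M\<^esub> x = a \<odot>\<^bsub>M\<^esub> (b \<odot>\<^bsub>M\<^esub> x)"
    and smult_one [simp]: "x \<in> carrier M \<Longrightarrow> \<one>\<^bsub>A\<^esub> \<odot>\<^bsub>M\<^esub> x = x"

locale right_module = A?: ring A + M?: abelian_group M
  for A :: "('a, 'c) ring_scheme" (structure) and M :: "('a, 'm, 'd) module_scheme" (structure) +
  assumes smult_closed [simp, intro]:
      "\<lbrakk>a \<in> carrier A; x \<in> carrier M\<rbrakk> \<Longrightarrow> a \<odot>\<^bsub>M\<^esub> x \<in> carrier M"
    and smult_l_distr:
      "\<lbrakk>a \<in> carrier A; b \<in> carrier A; x \<in> carrier M\<rbrakk> \<Longrightarrow>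
        (a \<oplus>\<^bsub>A\<^esub> b) \<odot>\<^bsub>M\<^esub> x = a \<odot>\<^bsub>M\<^esub> x \<oplus>\<^bsub>M\<^esub> b \<odot>\<^bsub>M\<^esub> x"
    and smult_r_distr:
      "\<lbrakk>a \<in> carrier A; x \<in> carrier M; y \<in> carrier M\<rbrakk> \<Longrightarrow>
        a \<odot>\<^bsub>M\<^esub> (x \<oplus>\<^bsub>M\<^esub> y) = a \<odot>\<^bsub>M\<^esub> x \<oplus>\<^bsub>M\<^esub> a \<odot>\<^bsub>M\<^esub> y"
    and smult_assoc:
      "\<lbrakk>a \<in> carrier A; b \<in> carrier A; x \<in> carrier M\<rbrakk> \<Longrightarrow>
        (a \<otimes>\<^bsub>A\<^esub> b) \<odot>\<^bsub>M\<^esub> x = b \<odot>\<^bsub>M\<^esub> (a \<odot>\<^bsub>M\<^esub> x)"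
    and smult_one [simp]: "x \<in> carrier M \<Longrightarrow> \<one>\<^bsub>A\<^esub> \<odot>\<^bsub>M\<^esub> x = x"

definition mod_hom ::
  "('a, 'c) ring_scheme \<Rightarrow> ('a, 'm) module \<Rightarrow> ('a, 'n) module \<Rightarrow> ('m \<Rightarrow> 'n) set" where
  "mod_hom A M N = {f. f \<in> carrier M \<rightarrow> carrier N \<and>
     (\<forall>x\<in>carrier M. \<forall>y\<in>carrier M. f (x \<oplus>\<^bsub>M\<^esub> y) = f x \<oplus>\<^bsub>N\<^esub> f y) \<and>
     (\<forall>a\<in>carrier A. \<forall>x\<in>carrier M. f (a \<odot>\<^bsub>M\<^esub> x) = a \<odot>\<^bsub>N\<^esub> f x)}"

definition mod_iso ::
  "('a, 'c) ring_scheme \<Rightarrow> ('a, 'm) module \<Rightarrow> ('a, 'n) module \<Rightarrow> bool" where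
  "mod_iso A M N \<longleftrightarrow> (\<exists>f\<in>mod_hom A M N. bij_betw f (carrier M) (carrier N))"

definition quot_module :: "('a, 'm) module \<Rightarrow> 'm set \<Rightarrow> ('a, 'm set) module" where
  "quot_module M H = \<lparr>carrier = a_rcosets\<^bsub>M\<^esub> H, monoid.mult = undefined, one = undefined,
     zero = H, add = (<+>\<^bsub>M\<^esub>), smult = (\<lambda>a X. \<Union>x\<in>X. H +>\<^bsub>M\<^esub> (a \<odot>\<^bsub>M\<^esub> x))\<rparr>"


section \<open>Free and projective modules\<close>

definition fin_supp :: "('a, 'c) ring_scheme \<Rightarrow> 'x set \<Rightarrow> ('x \<Rightarrow> 'a) set" where
  "fin_supp A X = {f. (\<forall>x\<in>X. f x \<in> carrier A) \<and> (\<forall>x. x \<notin> X \<longrightarrow> f x = \<zero>\<^bsub>A\<^esub>) \<and>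
     finite {x. f x \<noteq> \<zero>\<^bsub>A\<^esub>}}"

definition basis_elt :: "('a, 'c) ring_scheme \<Rightarrow> 'x \<Rightarrow> 'x \<Rightarrow> 'a" where
  "basis_elt A x = (\<lambda>y. if y = x then \<one>\<^bsub>A\<^esub> else \<zero>\<^bsub>A\<^esub>)"

text \<open>The free right module with basis \<open>X\<close>; over a commutative ring the side is immaterial.\<close>

definition free_module :: "('a, 'c) ring_scheme \<Rightarrow> 'x set \<Rightarrow> ('a, 'x \<Rightarrow> 'a) module" where
  "free_module A X = \<lparr>carrier = fin_supp A X, monoid.mult = undefined, one = undefined,
     zero = (\<lambda>_. \<zero>\<^bsub>A\<^esub>), add = (\<lambda>f g x. f x \<oplus>\<^bsub>A\<^esub> g x), smult = (\<lambda>a f x. f x \<otimes>\<^bsub>A\<^esub> a)\<rparr>"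

definition free_map :: "('a, 'c) ring_scheme \<Rightarrow> ('x \<Rightarrow> 'y) \<Rightarrow> ('x \<Rightarrow> 'a) \<Rightarrow> 'y \<Rightarrow> 'a" where
  "free_map A g u = (\<lambda>y. \<Oplus>\<^bsub>A\<^esub>x\<in>{x. u x \<noteq> \<zero>\<^bsub>A\<^esub> \<and> g x = y}. u x)"

text \<open>
  A projective module is a direct summand, that is a retract, of a free module. Index sets inside
  the type of \<open>P\<close> suffice, as a projective \<open>P\<close> is a retract of the free module on \<open>carrier P\<close>.
\<close>

definition projective :: "('a, 'c) ring_scheme \<Rightarrow> ('a, 'p) module \<Rightarrow> bool" where
  "projective A P \<longleftrightarrow> right_module A P \<and>
     (\<exists>X :: 'p set. \<exists>i \<in> mod_hom A P (free_module A X). \<exists>r \<in> mod_hom A (free_module A X) P.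
        \<forall>x\<in>carrier P. r (i x) = x)"

text \<open>The complex \<open>\<dots> \<rightarrow> P 2 \<rightarrow> P 1 \<rightarrow> P 0 \<rightarrow> M \<rightarrow> 0\<close> is exact, where \<open>d k\<close> maps \<open>P (Suc k)\<close> to \<open>P k\<close>.\<close>

definition projective_resolution :: "('a, 'c) ring_scheme \<Rightarrow> ('a, 'm) module \<Rightarrow>
    (nat \<Rightarrow> ('a, 'p) module) \<Rightarrow> (nat \<Rightarrow> 'p \<Rightarrow> 'p) \<Rightarrow> ('p \<Rightarrow> 'm) \<Rightarrow> bool" where
  "projective_resolution A M P d aug \<longleftrightarrow>
     (\<forall>k. projective A (P k)) \<and> (\<forall>k. d k \<in> mod_hom A (P (Suc k)) (P k)) \<and>
     aug \<in> mod_hom A (P 0) M \<and>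
     aug ` carrier (P 0) = carrier M \<and>
     d 0 ` carrier (P (Suc 0)) = {x \<in> carrier (P 0). aug x = \<zero>\<^bsub>M\<^esub>} \<and>
     (\<forall>k. d (Suc k) ` carrier (P (Suc (Suc k))) =
        {x \<in> carrier (P (Suc k)). d k x = \<zero>\<^bsub>P k\<^esub>})"


section \<open>Tensor products, homology and Tor\<close>

text \<open>
  For an algebra \<open>A\<close> over a commutative ring \<open>R\<close>, the tensor product over \<open>A\<close> of a right module \<open>M\<close>
  and a left module \<open>N\<close> is presented as an \<open>R\<close>-module. The last set of relations says that \<open>R\<close> acts
  through \<open>r (p \<otimes> n) = (p \<cdot> r 1\<^sub>A) \<otimes> n\<close>.
\<close>

definition tensor_gen_rels :: "('r, 'c) ring_scheme \<Rightarrow> ('r, 'a, 'd) module_scheme \<Rightarrow>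
    ('a, 'm) module \<Rightarrow> ('a, 'n) module \<Rightarrow> ('m \<times> 'n \<Rightarrow> 'r) set" where
  "tensor_gen_rels R A M N =
    (let F = free_module R (carrier M \<times> carrier N); b = basis_elt R in
     {b (p \<oplus>\<^bsub>M\<^esub> q, n) \<ominus>\<^bsub>F\<^esub> (b (p, n) \<oplus>\<^bsub>F\<^esub> b (q, n)) | p q n.
        p \<in> carrier M \<and> q \<in> carrier M \<and> n \<in> carrier N} \<union>
     {b (p, m \<oplus>\<^bsub>N\<^esub> n) \<ominus>\<^bsub>F\<^esub> (b (p, m) \<oplus>\<^bsub>F\<^esub> b (p, n)) | p m n.
        p \<in> carrier M \<and> m \<in> carrier N \<and> n \<in> carrier N} \<union>
     {b (a \<odot>\<^bsub>M\<^esub> p, n) \<ominus>\<^bsub>F\<^esub> b (p, a \<odot>\<^bsub>N\<^esub> n) | p a n.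
        p \<in> carrier M \<and> a \<in> carrier A \<and> n \<in> carrier N} \<union>
     {b ((r \<odot>\<^bsub>A\<^esub> \<one>\<^bsub>A\<^esub>) \<odot>\<^bsub>M\<^esub> p, n) \<ominus>\<^bsub>F\<^esub> r \<odot>\<^bsub>F\<^esub> b (p, n) | p r n.
        p \<in> carrier M \<and> r \<in> carrier R \<and> n \<in> carrier N})"

definition tensor_rels :: "('r, 'c) ring_scheme \<Rightarrow> ('r, 'a, 'd) module_scheme \<Rightarrow>
    ('a, 'm) module \<Rightarrow> ('a, 'n) module \<Rightarrow> ('m \<times> 'n \<Rightarrow> 'r) set" where
  "tensor_rels R A M N = \<Inter>{H. submodule H R (free_module R (carrier M \<times> carrier N)) \<and>
     tensor_gen_rels R A M N \<subseteq> H}"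

definition tensor_product :: "('r, 'c) ring_scheme \<Rightarrow> ('r, 'a, 'd) module_scheme \<Rightarrow>
    ('a, 'm) module \<Rightarrow> ('a, 'n) module \<Rightarrow> ('r, ('m \<times> 'n \<Rightarrow> 'r) set) module" where
  "tensor_product R A M N =
     quot_module (free_module R (carrier M \<times> carrier N)) (tensor_rels R A M N)"

text \<open>
  The homomorphism \<open>f \<otimes> id\<close> into \<open>tensor_product R A M' N\<close>; all cosets in the union are equal if
  \<open>f\<close> is a homomorphism into \<open>M'\<close>.
\<close>

definition tensor_map :: "('r, 'c) ring_scheme \<Rightarrow> ('r, 'a, 'd) module_scheme \<Rightarrow>
    ('a, 'k) module \<Rightarrow> ('a, 'n) module \<Rightarrow> ('m \<Rightarrow> 'k) \<Rightarrow>
    ('m \<times> 'n \<Rightarrow> 'r) set \<Rightarrow> ('k \<times> 'n \<Rightarrow> 'r) set" where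
  "tensor_map R A M' N f X = (\<Union>u\<in>X. tensor_rels R A M' N
     +>\<^bsub>free_module R (carrier M' \<times> carrier N)\<^esub> free_map R (map_prod f id) u)"

definition cycles :: "(nat \<Rightarrow> ('r, 'c) module) \<Rightarrow> (nat \<Rightarrow> 'c \<Rightarrow> 'c) \<Rightarrow> nat \<Rightarrow> 'c set" where
  "cycles C d k = (case k of 0 \<Rightarrow> carrier (C 0)
     | Suc j \<Rightarrow> {x \<in> carrier (C (Suc j)). d j x = \<zero>\<^bsub>C j\<^esub>})"

definition homology ::
  "(nat \<Rightarrow> ('r, 'c) module) \<Rightarrow> (nat \<Rightarrow> 'c \<Rightarrow> 'c) \<Rightarrow> nat \<Rightarrow> ('r, 'c set) module" where
  "homology C d k = quot_module (C k\<lparr>carrier := cycles C d k\<rparr>) (d k ` carrier (C (Suc k)))"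

text \<open>
  Tor is computed from a projective resolution whose modules all live in one type. That type has to
  contain a copy of \<open>M\<close>, and a copy of each free module with basis in it; formal linear
  combinations provide the latter. The lemma \<open>projective_resolution_exists\<close> below shows that every
  right module has a projective resolution there.
\<close>

datatype ('a, 'm) formal = Gen 'm | Comb "('a \<times> ('a, 'm) formal) list"

definition chosen_resolution :: "('a, 'c) ring_scheme \<Rightarrow> ('a, 'm) module \<Rightarrow>
    (nat \<Rightarrow> ('a, ('a, 'm) formal) module) \<times>
    (nat \<Rightarrow> ('a, 'm) formal \<Rightarrow> ('a, 'm) formal)" where
  "chosen_resolution A M =
     (SOME (P, d). \<exists>aug. projective_resolution A M P d aug)"

definition Tor :: "('r, 'c) ring_scheme \<Rightarrow> ('r, 'a, 'd) module_scheme \<Rightarrow>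
    ('a, 'm) module \<Rightarrow> ('a, 'n) module \<Rightarrow> nat \<Rightarrow>
    ('r, ((('a, 'm) formal \<times> 'n) \<Rightarrow> 'r) set set) module" where
  "Tor R A M N k = (case chosen_resolution A M of (P, d) \<Rightarrow>
     homology (\<lambda>i. tensor_product R A (P i) N) (\<lambda>i. tensor_map R A (P i) N (d i)) k)"


section \<open>Algebras with a multiplicative basis\<close>

text \<open>
  The free \<open>R\<close>-module on \<open>X\<close> with the bilinear multiplication for which the product of the basis
  elements \<open>x\<close> and \<open>y\<close> is \<open>w x y\<close> times the basis element \<open>m x y\<close>, and with unit \<open>e\<close>.
\<close>

definition basis_algebra :: "('r, 'c) ring_scheme \<Rightarrow> 'x set \<Rightarrow> ('x \<Rightarrow> 'x \<Rightarrow> 'r) \<Rightarrow>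
    ('x \<Rightarrow> 'x \<Rightarrow> 'x) \<Rightarrow> 'x \<Rightarrow> ('r, 'x \<Rightarrow> 'r) module" where
  "basis_algebra R X w m e = \<lparr>carrier = fin_supp R X,
     monoid.mult = (\<lambda>f g z. \<Oplus>\<^bsub>R\<^esub>p\<in>{(x, y). f x \<noteq> \<zero>\<^bsub>R\<^esub> \<and> g y \<noteq> \<zero>\<^bsub>R\<^esub> \<and> m x y = z}.
       w (fst p) (snd p) \<otimes>\<^bsub>R\<^esub> (f (fst p) \<otimes>\<^bsub>R\<^esub> g (snd p))),
     one = basis_elt R e, zero = (\<lambda>_. \<zero>\<^bsub>R\<^esub>), add = (\<lambda>f g x. f x \<oplus>\<^bsub>R\<^esub> g x),
     smult = (\<lambda>r f x. r \<otimes>\<^bsub>R\<^esub> f x)\<rparr>"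

text \<open>
  A copy of \<open>R\<close> on which the basis element \<open>x\<close> of the algebra acts as multiplication by \<open>c x\<close>.
  As \<open>R\<close> is commutative, the same record serves as left and as right module.
\<close>

definition char_module :: "('r, 'c) ring_scheme \<Rightarrow> ('x \<Rightarrow> 'r) \<Rightarrow> ('x \<Rightarrow> 'r, 'r) module" where
  "char_module R c = \<lparr>carrier = carrier R, monoid.mult = undefined, one = undefined,
     zero = \<zero>\<^bsub>R\<^esub>, add = (\<oplus>\<^bsub>R\<^esub>),
     smult = (\<lambda>f r. (\<Oplus>\<^bsub>R\<^esub>x\<in>{x. f x \<noteq> \<zero>\<^bsub>R\<^esub>}. f x \<otimes>\<^bsub>R\<^esub> c x) \<otimes>\<^bsub>R\<^esub> r)\<rparr>"

definition group_algebra ::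
  "('r, 'c) ring_scheme \<Rightarrow> ('g, 'd) monoid_scheme \<Rightarrow> ('r, 'g \<Rightarrow> 'r) module" where
  "group_algebra R G = basis_algebra R (carrier G) (\<lambda>_ _. \<one>\<^bsub>R\<^esub>) (\<otimes>\<^bsub>G\<^esub>) \<one>\<^bsub>G\<^esub>"

definition trivial_group_module :: "('r, 'c) ring_scheme \<Rightarrow> ('g \<Rightarrow> 'r, 'r) module" where
  "trivial_group_module R = char_module R (\<lambda>_. \<one>\<^bsub>R\<^esub>)"


section \<open>Rook algebras\<close>

text \<open>A diagram is given by its edges; \<open>(i, j)\<close> joins the \<open>i\<close>-th left to the \<open>j\<close>-th right node.\<close>

definition rook_diagrams :: "nat \<Rightarrow> (nat \<times> nat) set set" where
  "rook_diagrams n = {x. x \<subseteq> {1..n} \<times> {1..n} \<and> single_valued x \<and> single_valued (x\<inverse>)}"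

datatype node = Lft nat | Mid nat | Rgt nat

definition concat_graph :: "(nat \<times> nat) set \<Rightarrow> (nat \<times> nat) set \<Rightarrow> (node \<times> node) set" where
  "concat_graph x y = {(Lft i, Mid j) | i j. (i, j) \<in> x} \<union> {(Mid j, Rgt k) | j k. (j, k) \<in> y}"

text \<open>
  A path between two distinct outer nodes always joins a left to a right one, since middle nodes
  have at most one edge on either side.
\<close>

definition rook_comp :: "(nat \<times> nat) set \<Rightarrow> (nat \<times> nat) set \<Rightarrow> (nat \<times> nat) set" where
  "rook_comp x y =
     {(i, k). (Lft i, Rgt k) \<in> (concat_graph x y \<union> (concat_graph x y)\<inverse>)\<^sup>*}"

definition isolated_middle :: "nat \<Rightarrow> (nat \<times> nat) set \<Rightarrow> (nat \<times> nat) set \<Rightarrow> nat" where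
  "isolated_middle n x y = card {j \<in> {1..n}. Mid j \<notin> Field (concat_graph x y)}"

definition rook_algebra ::
  "('r, 'c) ring_scheme \<Rightarrow> nat \<Rightarrow> 'r \<Rightarrow> ('r, (nat \<times> nat) set \<Rightarrow> 'r) module" where
  "rook_algebra R n \<epsilon> = basis_algebra R (rook_diagrams n)
     (\<lambda>x y. \<epsilon> [^]\<^bsub>R\<^esub> isolated_middle n x y) rook_comp (Id_on {1..n})"

definition trivial_rook_module ::
  "('r, 'c) ring_scheme \<Rightarrow> nat \<Rightarrow> ((nat \<times> nat) set \<Rightarrow> 'r, 'r) module" where
  "trivial_rook_module R n = char_module R
     (\<lambda>x. if Domain x = {1..n} \<and> Range x = {1..n} then \<one>\<^bsub>R\<^esub> else \<zero>\<^bsub>R\<^esub>)"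


section \<open>Existence of projective resolutions\<close>

lemma right_moduleI:
  fixes A (structure) and M (structure)
  assumes "ring A" "abelian_group M"
    and "\<And>a x. \<lbrakk>a \<in> carrier A; x \<in> carrier M\<rbrakk> \<Longrightarrow> a \<odot>\<^bsub>M\<^esub> x \<in> carrier M"
    and "\<And>a b x. \<lbrakk>a \<in> carrier A; b \<in> carrier A; x \<in> carrier M\<rbrakk> \<Longrightarrow>
        (a \<oplus>\<^bsub>A\<^esub> b) \<odot>\<^bsub>M\<^esub> x = a \<odot>\<^bsub>M\<^esub> x \<oplus>\<^bsub>M\<^esub> b \<odot>\<^bsub>M\<^esub> x"
    and "\<And>a x y. \<lbrakk>a \<in> carrier A; x \<in> carrier M; y \<in> carrier M\<rbrakk> \<Longrightarrow>
        a \<odot>\<^bsub>M\<^esub> (x \<oplus>\<^bsub>M\<^esub> y) = a \<odot>\<^bsub>M\<^esub> x \<oplus>\<^bsub>M\<^esub> a \<odot>\<^bsub>M\<^esub> y"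
    and "\<And>a b x. \<lbrakk>a \<in> carrier A; b \<in> carrier A; x \<in> carrier M\<rbrakk> \<Longrightarrow>
        (a \<otimes>\<^bsub>A\<^esub> b) \<odot>\<^bsub>M\<^esub> x = b \<odot>\<^bsub>M\<^esub> (a \<odot>\<^bsub>M\<^esub> x)"
    and "\<And>x. x \<in> carrier M \<Longrightarrow> \<one>\<^bsub>A\<^esub> \<odot>\<^bsub>M\<^esub> x = x"
  shows "right_module A M"
  using assms by (simp add: right_module_def right_module_axioms_def)

lemma (in ring) fin_supp_add:
  assumes "f \<in> fin_supp R X" "g \<in> fin_supp R X"
  shows "(\<lambda>x. f x \<oplus> g x) \<in> fin_supp R X"
proof -
  have "{x. f x \<oplus> g x \<noteq> \<zero>} \<subseteq> {x. f x \<noteq> \<zero>} \<union> {x. g x \<noteq> \<zero>}" by auto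
  then show ?thesis
    using assms by (auto simp: fin_supp_def intro: finite_subset)
qed

lemma (in ring) fin_supp_smult:
  assumes "f \<in> fin_supp R X" "a \<in> carrier R"
  shows "(\<lambda>x. f x \<otimes> a) \<in> fin_supp R X"
proof -
  have "{x. f x \<otimes> a \<noteq> \<zero>} \<subseteq> {x. f x \<noteq> \<zero>}" using assms by auto
  then show ?thesis
    using assms by (auto simp: fin_supp_def intro: finite_subset)
qed

lemma (in ring) fin_supp_closed: "f \<in> fin_supp R X \<Longrightarrow> f x \<in> carrier R"
  by (cases "x \<in> X") (auto simp: fin_supp_def)

lemma (in ring) basis_elt_fin_supp: "x \<in> X \<Longrightarrow> basis_elt R x \<in> fin_supp R X"
proof -
  have "{y. basis_elt R x y \<noteq> \<zero>} \<subseteq> {x}" by (auto simp: basis_elt_def)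
  then show "x \<in> X \<Longrightarrow> ?thesis"
    by (auto simp: fin_supp_def basis_elt_def intro: finite_subset)
qed

lemma (in ring) fin_supp_zero: "(\<lambda>_. \<zero>) \<in> fin_supp R X"
  by (simp add: fin_supp_def)

lemma (in ring) right_module_free_module: "right_module R (free_module R X)"
proof (rule right_moduleI)
  show "abelian_group (free_module R X)"
  proof (rule abelian_groupI)
    fix f assume f: "f \<in> carrier (free_module R X)"
    have "(\<lambda>x. \<ominus> f x) \<in> fin_supp R X"
    proof -
      have "{x. \<ominus> f x \<noteq> \<zero>} \<subseteq> {x. f x \<noteq> \<zero>}" by auto
      then show ?thesis
        using f by (auto simp: free_module_def fin_supp_def intro: finite_subset)
    qed
    then show "\<exists>g\<in>carrier (free_module R X). g \<oplus>\<^bsub>free_module R X\<^esub> f = \<zero>\<^bsub>free_module R X\<^esub>"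
      using f by (intro bexI[of _ "\<lambda>x. \<ominus> f x"]) 
        (auto simp: free_module_def fun_eq_iff fin_supp_closed[of f X] l_neg)
  qed (simp_all add: free_module_def fin_supp_add fin_supp_zero fun_eq_iff a_ac fin_supp_closed[where X = X])
qed (simp_all add: free_module_def fin_supp_smult fun_eq_iff fin_supp_closed[where X = X] l_distr r_distr m_assoc
       ring_axioms)

definition lin :: "('a, 'm, 'd) module_scheme \<Rightarrow> 'a \<Rightarrow> ('x \<Rightarrow> 'm) \<Rightarrow> ('x \<Rightarrow> 'a) \<Rightarrow> 'm" where
  "lin M z g f = (\<Oplus>\<^bsub>M\<^esub>x\<in>{x. f x \<noteq> z}. f x \<odot>\<^bsub>M\<^esub> g x)"

context right_module
begin

lemma smult_zero [simp]: "x \<in> carrier M \<Longrightarrow> \<zero>\<^bsub>A\<^esub> \<odot>\<^bsub>M\<^esub> x = \<zero>\<^bsub>M\<^esub>"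
  using smult_l_distr[of "\<zero>\<^bsub>A\<^esub>" "\<zero>\<^bsub>A\<^esub>" x]
  by (metis M.add.l_cancel_one' A.zero_closed A.l_zero smult_closed)

lemma smult_zero_right [simp]: "a \<in> carrier A \<Longrightarrow> a \<odot>\<^bsub>M\<^esub> \<zero>\<^bsub>M\<^esub> = \<zero>\<^bsub>M\<^esub>"
  using smult_r_distr[of a "\<zero>\<^bsub>M\<^esub>" "\<zero>\<^bsub>M\<^esub>"]
  by (metis M.add.l_cancel_one' M.zero_closed M.l_zero smult_closed)


lemma finsum_supp_mono:
  assumes "f \<in> fin_supp A X" "g \<in> X \<rightarrow> carrier M" "finite S" "{x. f x \<noteq> \<zero>\<^bsub>A\<^esub>} \<subseteq> S" "S \<subseteq> X"
  shows "lin M \<zero>\<^bsub>A\<^esub> g f = (\<Oplus>\<^bsub>M\<^esub>x\<in>S. f x \<odot>\<^bsub>M\<^esub> g x)"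
  unfolding lin_def
  using assms by (intro M.add.finprod_mono_neutral_cong_left) (auto simp: A.fin_supp_closed Pi_iff)

lemma lin_closed:
  assumes "f \<in> fin_supp A X" "g \<in> X \<rightarrow> carrier M"
  shows "lin M \<zero>\<^bsub>A\<^esub> g f \<in> carrier M"
  unfolding lin_def using assms
  by (intro M.finsum_closed) (auto simp: A.fin_supp_closed Pi_iff, (auto simp: fin_supp_def)?)


lemma lin_basis_elt:
  assumes "g \<in> X \<rightarrow> carrier M" "x \<in> X"
  shows "lin M \<zero>\<^bsub>A\<^esub> g (basis_elt A x) = g x"
proof -
  have "lin M \<zero>\<^bsub>A\<^esub> g (basis_elt A x) = (\<Oplus>\<^bsub>M\<^esub>y\<in>{x}. basis_elt A x y \<odot>\<^bsub>M\<^esub> g y)"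
    using assms by (intro finsum_supp_mono[where X = X])
      (auto simp: A.basis_elt_fin_supp, auto simp: basis_elt_def split: if_splits)
  also have "\<dots> = g x"
    using assms by (auto simp: basis_elt_def Pi_def)
  finally show ?thesis .
qed

lemma finsum_smult:
  assumes "finite S" "h \<in> S \<rightarrow> carrier M" "a \<in> carrier A"
  shows "a \<odot>\<^bsub>M\<^esub> (\<Oplus>\<^bsub>M\<^esub>x\<in>S. h x) = (\<Oplus>\<^bsub>M\<^esub>x\<in>S. a \<odot>\<^bsub>M\<^esub> h x)"
  using assms by (induction S rule: finite_induct) (auto simp: smult_r_distr Pi_def)

lemma lin_add:
  assumes g: "g \<in> X \<rightarrow> carrier M" and f: "f \<in> fin_supp A X" and h: "h \<in> fin_supp A X"
  shows "lin M \<zero>\<^bsub>A\<^esub> g (\<lambda>x. f x \<oplus>\<^bsub>A\<^esub> h x) = lin M \<zero>\<^bsub>A\<^esub> g f \<oplus>\<^bsub>M\<^esub> lin M \<zero>\<^bsub>A\<^esub> g h"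
proof -
  define S where "S = {x. f x \<noteq> \<zero>\<^bsub>A\<^esub>} \<union> {x. h x \<noteq> \<zero>\<^bsub>A\<^esub>}"
  have S: "finite S" "S \<subseteq> X"
    using f h by (auto simp: S_def fin_supp_def)
  have "lin M \<zero>\<^bsub>A\<^esub> g (\<lambda>x. f x \<oplus>\<^bsub>A\<^esub> h x) = (\<Oplus>\<^bsub>M\<^esub>x\<in>S. (f x \<oplus>\<^bsub>A\<^esub> h x) \<odot>\<^bsub>M\<^esub> g x)"
    using S by (intro finsum_supp_mono[OF A.fin_supp_add[OF f h] g]) (auto simp: S_def)
  also have "\<dots> = (\<Oplus>\<^bsub>M\<^esub>x\<in>S. f x \<odot>\<^bsub>M\<^esub> g x \<oplus>\<^bsub>M\<^esub> h x \<odot>\<^bsub>M\<^esub> g x)"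
    using S g by (intro M.finsum_cong')
      (auto simp: Pi_iff subset_iff smult_l_distr A.fin_supp_closed[OF f] A.fin_supp_closed[OF h])
  also have "\<dots> = (\<Oplus>\<^bsub>M\<^esub>x\<in>S. f x \<odot>\<^bsub>M\<^esub> g x) \<oplus>\<^bsub>M\<^esub> (\<Oplus>\<^bsub>M\<^esub>x\<in>S. h x \<odot>\<^bsub>M\<^esub> g x)"
    using S g by (intro M.finsum_addf)
      (auto simp: Pi_iff subset_iff A.fin_supp_closed[OF f] A.fin_supp_closed[OF h])
  also have "\<dots> = lin M \<zero>\<^bsub>A\<^esub> g f \<oplus>\<^bsub>M\<^esub> lin M \<zero>\<^bsub>A\<^esub> g h"
    using finsum_supp_mono[OF f g, of S] finsum_supp_mono[OF h g, of S] S by (simp add: S_def)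
  finally show ?thesis .
qed

lemma lin_smult:
  assumes g: "g \<in> X \<rightarrow> carrier M" and f: "f \<in> fin_supp A X" and a: "a \<in> carrier A"
  shows "lin M \<zero>\<^bsub>A\<^esub> g (\<lambda>x. f x \<otimes>\<^bsub>A\<^esub> a) = a \<odot>\<^bsub>M\<^esub> lin M \<zero>\<^bsub>A\<^esub> g f"
proof -
  define S where "S = {x. f x \<noteq> \<zero>\<^bsub>A\<^esub>}"
  have S: "finite S" "S \<subseteq> X"
    using f by (auto simp: S_def fin_supp_def)
  have "lin M \<zero>\<^bsub>A\<^esub> g (\<lambda>x. f x \<otimes>\<^bsub>A\<^esub> a) = (\<Oplus>\<^bsub>M\<^esub>x\<in>S. (f x \<otimes>\<^bsub>A\<^esub> a) \<odot>\<^bsub>M\<^esub> g x)"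
    using S a by (intro finsum_supp_mono[OF A.fin_supp_smult[OF f a] g]) (auto simp: S_def)
  also have "\<dots> = (\<Oplus>\<^bsub>M\<^esub>x\<in>S. a \<odot>\<^bsub>M\<^esub> (f x \<odot>\<^bsub>M\<^esub> g x))"
    using S g a by (intro M.finsum_cong')
      (auto simp: Pi_iff subset_iff smult_assoc A.fin_supp_closed[OF f])
  also have "\<dots> = a \<odot>\<^bsub>M\<^esub> lin M \<zero>\<^bsub>A\<^esub> g f"
    using S g a unfolding lin_def S_def[symmetric]
    by (intro finsum_smult[symmetric]) (auto simp: Pi_iff subset_iff A.fin_supp_closed[OF f])
  finally show ?thesis .
qed

lemma lin_in:
  assumes "g \<in> X \<rightarrow> K" "f \<in> fin_supp A X" "K \<subseteq> carrier M" "\<zero>\<^bsub>M\<^esub> \<in> K"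
    "\<And>x y. \<lbrakk>x \<in> K; y \<in> K\<rbrakk> \<Longrightarrow> x \<oplus>\<^bsub>M\<^esub> y \<in> K"
    "\<And>a x. \<lbrakk>a \<in> carrier A; x \<in> K\<rbrakk> \<Longrightarrow> a \<odot>\<^bsub>M\<^esub> x \<in> K"
  shows "lin M \<zero>\<^bsub>A\<^esub> g f \<in> K"
proof -
  have "(\<Oplus>\<^bsub>M\<^esub>x\<in>S. f x \<odot>\<^bsub>M\<^esub> g x) \<in> K" if "finite S" "S \<subseteq> X" for S
    using that
  proof (induction S rule: finite_induct)
    case (insert x S)
    have "f y \<odot>\<^bsub>M\<^esub> g y \<in> K" if "y \<in> insert x S" for y
      using insert.prems that assms(1,2,6) by (auto simp: A.fin_supp_closed Pi_iff)
    then show ?case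
      using insert assms(3,5) by (subst M.finsum_insert) (auto simp: Pi_def)
  qed (use assms in auto)
  then show ?thesis
    using assms(2) unfolding lin_def by (auto simp: fin_supp_def)
qed

end

definition transport :: "('x \<Rightarrow> 'y) \<Rightarrow> ('a, 'x) module \<Rightarrow> ('a, 'y) module" where
  "transport e M = (let d = inv_into (carrier M) e in
    \<lparr>carrier = e ` carrier M, monoid.mult = undefined, one = undefined, zero = e \<zero>\<^bsub>M\<^esub>,
     add = (\<lambda>x y. e (d x \<oplus>\<^bsub>M\<^esub> d y)), smult = (\<lambda>a x. e (a \<odot>\<^bsub>M\<^esub> d x))\<rparr>)"

lemma transport:
  assumes "right_module A M" and e: "inj_on e (carrier M)"
  shows "right_module A (transport e M)"
    and "e \<in> mod_hom A M (transport e M)"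
    and "inv_into (carrier M) e \<in> mod_hom A (transport e M) M"
proof -
  interpret right_module A M by fact
  show "right_module A (transport e M)"
  proof (rule right_moduleI)
    show "abelian_group (transport e M)"
    proof (rule abelian_groupI)
      fix x assume "x \<in> carrier (transport e M)"
      then show "\<exists>y\<in>carrier (transport e M). y \<oplus>\<^bsub>transport e M\<^esub> x = \<zero>\<^bsub>transport e M\<^esub>"
        by (auto simp: transport_def Let_def e M.l_neg intro!: bexI[of _ "\<ominus>\<^bsub>M\<^esub> _"])
    qed (auto simp: transport_def Let_def e M.a_ac)
  qed (auto simp: transport_def Let_def e smult_l_distr smult_r_distr smult_assoc intro: A.ring_axioms)
  show "e \<in> mod_hom A M (transport e M)"
    by (auto simp: transport_def Let_def e mod_hom_def)
  show "inv_into (carrier M) e \<in> mod_hom A (transport e M) M"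
    by (auto simp: transport_def Let_def e mod_hom_def)
qed

lemma mod_hom_comp:
  "\<lbrakk>f \<in> mod_hom A L M; g \<in> mod_hom A M N\<rbrakk> \<Longrightarrow> (\<lambda>x. g (f x)) \<in> mod_hom A L N"
  by (auto simp: mod_hom_def Pi_def)

definition encode :: "('a, 'c) ring_scheme \<Rightarrow> (('a, 'm) formal \<Rightarrow> 'a) \<Rightarrow> ('a, 'm) formal" where
  "encode A f = Comb (map (\<lambda>x. (f x, x)) (SOME xs. set xs = {x. f x \<noteq> \<zero>\<^bsub>A\<^esub>}))"

lemma inj_on_encode: "inj_on (encode A) (fin_supp A X)"
proof (rule inj_onI)
  fix f g assume fg: "f \<in> fin_supp A X" "g \<in> fin_supp A X" and eq: "encode A f = encode A g"
  define xs where "xs = (SOME xs. set xs = {x. f x \<noteq> \<zero>\<^bsub>A\<^esub>})"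
  define ys where "ys = (SOME xs. set xs = {x. g x \<noteq> \<zero>\<^bsub>A\<^esub>})"
  have "finite {x. f x \<noteq> \<zero>\<^bsub>A\<^esub>}" "finite {x. g x \<noteq> \<zero>\<^bsub>A\<^esub>}"
    using fg by (simp_all add: fin_supp_def)
  then have xs: "set xs = {x. f x \<noteq> \<zero>\<^bsub>A\<^esub>}" and ys: "set ys = {x. g x \<noteq> \<zero>\<^bsub>A\<^esub>}"
    unfolding xs_def ys_def by (simp_all only: someI_ex[OF finite_list])
  have "map (\<lambda>x. (f x, x)) xs = map (\<lambda>x. (g x, x)) ys"
    using eq by (simp only: encode_def xs_def ys_def formal.inject)
  then have "set (map (\<lambda>x. (f x, x)) xs) = set (map (\<lambda>x. (g x, x)) ys)" by (rule arg_cong)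
  then have eq: "(\<lambda>x. (f x, x)) ` {x. f x \<noteq> \<zero>\<^bsub>A\<^esub>} = (\<lambda>x. (g x, x)) ` {x. g x \<noteq> \<zero>\<^bsub>A\<^esub>}"
    by (simp only: set_map xs ys)
  show "f = g"
  proof
    fix x
    have "f x = g x" if "f x \<noteq> \<zero>\<^bsub>A\<^esub>"
    proof -
      have "(f x, x) \<in> (\<lambda>x. (g x, x)) ` {x. g x \<noteq> \<zero>\<^bsub>A\<^esub>}"
        using that by (subst eq[symmetric]) (rule imageI, simp)
      then show ?thesis by blast
    qed
    moreover have "f x = g x" if "g x \<noteq> \<zero>\<^bsub>A\<^esub>"
    proof -
      have "(g x, x) \<in> (\<lambda>x. (f x, x)) ` {x. f x \<noteq> \<zero>\<^bsub>A\<^esub>}"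
        using that by (subst eq) (rule imageI, simp)
      then show ?thesis by auto
    qed
    ultimately show "f x = g x" by metis
  qed
qed

lemma projective_cover:
  fixes A :: "('a, 'c) ring_scheme" and N :: "('a, 'n) module" and \<gamma> :: "'n \<Rightarrow> ('a, 'm) formal"
  assumes "right_module A N" and K: "K \<subseteq> carrier N" "\<zero>\<^bsub>N\<^esub> \<in> K"
    "\<And>x y. \<lbrakk>x \<in> K; y \<in> K\<rbrakk> \<Longrightarrow> x \<oplus>\<^bsub>N\<^esub> y \<in> K"
    "\<And>a x. \<lbrakk>a \<in> carrier A; x \<in> K\<rbrakk> \<Longrightarrow> a \<odot>\<^bsub>N\<^esub> x \<in> K"
    and \<gamma>: "inj_on \<gamma> K"
  shows "\<exists>(P :: ('a, ('a, 'm) formal) module) f.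
    projective A P \<and> f \<in> mod_hom A P N \<and> f ` carrier P = K"
proof -
  interpret right_module A N by fact
  define X where "X = \<gamma> ` K"
  define F where "F = free_module A X"
  define g where "g = inv_into K \<gamma>"
  have g: "g \<in> X \<rightarrow> K" by (auto simp: g_def X_def \<gamma>)
  then have g': "g \<in> X \<rightarrow> carrier N" using K by auto
  have gX: "g ` X = K" using \<gamma> by (simp add: g_def X_def image_image)
  have F: "right_module A F" unfolding F_def by (rule A.right_module_free_module)
  have inj: "inj_on (encode A) (carrier F)"
    using inj_on_encode by (simp add: F_def free_module_def)
  define P :: "('a, ('a, 'm) formal) module" where "P = transport (encode A) F"
  define h where "h = inv_into (carrier F) (encode A)"
  note tr = transport[OF F inj, folded P_def h_def]
  have cP: "carrier P = encode A ` carrier F" by (simp add: P_def transport_def Let_def)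
  have eh: "encode A (h x) = x" if "x \<in> carrier P" for x
    using that by (simp add: h_def f_inv_into_f cP)
  have he: "h ` carrier P = carrier F"
    using inj by (simp add: h_def cP image_image)
  have "projective A P"
    unfolding projective_def using tr eh F_def by blast
  moreover have lin: "lin N \<zero>\<^bsub>A\<^esub> g \<in> mod_hom A F N"
    using lin_add[OF g'] lin_smult[OF g'] lin_closed[OF _ g']
    by (auto simp: mod_hom_def F_def free_module_def)
  have "(\<lambda>x. lin N \<zero>\<^bsub>A\<^esub> g (h x)) \<in> mod_hom A P N"
    by (rule mod_hom_comp[OF tr(3) lin])
  moreover have "(\<lambda>x. lin N \<zero>\<^bsub>A\<^esub> g (h x)) ` carrier P = K"
  proof -
    have "lin N \<zero>\<^bsub>A\<^esub> g ` carrier F = K"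
    proof
      show "lin N \<zero>\<^bsub>A\<^esub> g ` carrier F \<subseteq> K"
        using lin_in[OF g _ K] by (auto simp: F_def free_module_def)
      show "K \<subseteq> lin N \<zero>\<^bsub>A\<^esub> g ` carrier F"
      proof
        fix k assume "k \<in> K"
        then obtain x where x: "x \<in> X" "g x = k" using gX by auto
        then show "k \<in> lin N \<zero>\<^bsub>A\<^esub> g ` carrier F"
          using lin_basis_elt[OF g' x(1)] A.basis_elt_fin_supp[OF x(1)]
          by (intro image_eqI[of _ _ "basis_elt A x"]) (auto simp: F_def free_module_def)
      qed
    qed
    then show ?thesis by (metis he image_image)
  qed
  ultimately show ?thesis by blast
qed

lemma projective_cover_kernel:
  fixes A :: "('a, 'c) ring_scheme" and N :: "('a, ('a, 'm) formal) module" and L :: "('a, 'l) module"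
  assumes N: "right_module A N" and L: "right_module A L" and f: "f \<in> mod_hom A N L"
  shows "\<exists>(P :: ('a, ('a, 'm) formal) module) g.
    projective A P \<and> g \<in> mod_hom A P N \<and> g ` carrier P = {x \<in> carrier N. f x = \<zero>\<^bsub>L\<^esub>}"
proof (rule projective_cover[OF N])
  interpret N: right_module A N by fact
  interpret L: right_module A L by fact
  have f0: "f \<zero>\<^bsub>N\<^esub> = \<zero>\<^bsub>L\<^esub>"
  proof -
    have "f (\<zero>\<^bsub>N\<^esub> \<oplus>\<^bsub>N\<^esub> \<zero>\<^bsub>N\<^esub>) = f \<zero>\<^bsub>N\<^esub> \<oplus>\<^bsub>L\<^esub> f \<zero>\<^bsub>N\<^esub>" and "f \<zero>\<^bsub>N\<^esub> \<in> carrier L"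
      using f N.M.zero_closed by (auto simp only: mod_hom_def mem_Collect_eq Pi_iff)
    then show ?thesis by (metis L.M.add.l_cancel_one' N.M.l_zero N.M.zero_closed)
  qed
  show "\<zero>\<^bsub>N\<^esub> \<in> {x \<in> carrier N. f x = \<zero>\<^bsub>L\<^esub>}" using f0 by simp
  show "inj_on (\<lambda>x. x) {x \<in> carrier N. f x = \<zero>\<^bsub>L\<^esub>}" by simp
  fix x y assume "x \<in> {x \<in> carrier N. f x = \<zero>\<^bsub>L\<^esub>}" "y \<in> {x \<in> carrier N. f x = \<zero>\<^bsub>L\<^esub>}"
  then show "x \<oplus>\<^bsub>N\<^esub> y \<in> {x \<in> carrier N. f x = \<zero>\<^bsub>L\<^esub>}"
    using f by (simp add: mod_hom_def)
next
  interpret N: right_module A N by fact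
  interpret L: right_module A L by fact
  fix a x assume "a \<in> carrier A" "x \<in> {x \<in> carrier N. f x = \<zero>\<^bsub>L\<^esub>}"
  then show "a \<odot>\<^bsub>N\<^esub> x \<in> {x \<in> carrier N. f x = \<zero>\<^bsub>L\<^esub>}"
    using f by (simp add: mod_hom_def)
qed auto

lemma projective_right_module: "projective A P \<Longrightarrow> right_module A P"
  by (simp add: projective_def)

theorem projective_resolution_exists:
  fixes A :: "('a, 'c) ring_scheme" and M :: "('a, 'm) module"
  assumes M: "right_module A M"
  shows "\<exists>aug. projective_resolution A M (fst (chosen_resolution A M)) (snd (chosen_resolution A M)) aug"
proof -
  interpret right_module A M by fact
  obtain P0 :: "('a, ('a, 'm) formal) module" and aug where P0: "projective A P0"
      "aug \<in> mod_hom A P0 M" "aug ` carrier P0 = carrier M"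
    using projective_cover[OF M subset_refl M.zero_closed M.a_closed smult_closed, of Gen]
    by (force simp: inj_on_def)
  obtain P1 :: "('a, ('a, 'm) formal) module" and d0 where P1: "projective A P1"
      "d0 \<in> mod_hom A P1 P0" "d0 ` carrier P1 = {x \<in> carrier P0. aug x = \<zero>\<^bsub>M\<^esub>}"
    using projective_cover_kernel[OF projective_right_module[OF P0(1)] M P0(2)] by blast
  define good where "good = (\<lambda>(Q, P, d). projective A (Q :: ('a, ('a, 'm) formal) module) \<and>
    projective A (P :: ('a, ('a, 'm) formal) module) \<and> d \<in> mod_hom A Q P)"
  define nxt where "nxt = (\<lambda>(Q, P, d) (Q' :: ('a, ('a, 'm) formal) module, P', d' :: ('a, 'm) formal \<Rightarrow> ('a, 'm) formal).
     P' = Q \<and> d' ` carrier Q' = {x \<in> carrier (Q :: ('a, ('a, 'm) formal) module).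
       d x = \<zero>\<^bsub>P :: ('a, ('a, 'm) formal) module\<^esub>})"
  have "\<exists>S. \<forall>n. (good (S n) \<and> (n = 0 \<longrightarrow> S n = (P1, P0, d0))) \<and> nxt (S n) (S (Suc n))"
  proof (rule dependent_nat_choice)
    show "\<exists>s. good s \<and> ((0::nat) = 0 \<longrightarrow> s = (P1, P0, d0))"
      using P0 P1 by (auto simp: good_def)
    fix s and n :: nat assume "good s \<and> (n = 0 \<longrightarrow> s = (P1, P0, d0))"
    then obtain Q P d where s: "s = (Q, P, d)" "projective A Q" "projective A P" "d \<in> mod_hom A Q P"
      by (auto simp: good_def split: prod.splits)
    obtain Q' :: "('a, ('a, 'm) formal) module" and d' where "projective A Q'" "d' \<in> mod_hom A Q' Q"
        "d' ` carrier Q' = {x \<in> carrier Q. d x = \<zero>\<^bsub>P\<^esub>}"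
      using projective_cover_kernel[OF projective_right_module[OF s(2)]
        projective_right_module[OF s(3)] s(4)] by blast
    then show "\<exists>s'. (good s' \<and> (Suc n = 0 \<longrightarrow> s' = (P1, P0, d0))) \<and> nxt s s'"
      using s by (intro exI[of _ "(Q', Q, d')"]) (auto simp: good_def nxt_def)
  qed
  then obtain S where S: "\<And>n. good (S n)" "S 0 = (P1, P0, d0)" "\<And>n. nxt (S n) (S (Suc n))"
    by blast
  define P where "P = (\<lambda>n. fst (snd (S n)))"
  define d where "d = (\<lambda>n. snd (snd (S n)))"
  have SP: "S n = (P (Suc n), P n, d n)" for n
    using S(3)[of n] by (auto simp: nxt_def P_def d_def split: prod.splits)
  have 0: "P 0 = P0" "P (Suc 0) = P1" "d 0 = d0"
    using SP[of 0] S(2) by simp_all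
  have good: "projective A (P n) \<and> d n \<in> mod_hom A (P (Suc n)) (P n)" for n
    using S(1)[of n] by (simp add: SP good_def)
  have nxt: "d (Suc n) ` carrier (P (Suc (Suc n))) = {x \<in> carrier (P (Suc n)). d n x = \<zero>\<^bsub>P n\<^esub>}" for n
    using S(3)[of n] by (simp add: SP nxt_def)
  have "projective_resolution A M P d aug"
    unfolding projective_resolution_def using good nxt P0 P1 by (simp add: 0)
  then have "\<exists>Pd. case Pd of (P :: nat \<Rightarrow> ('a, ('a, 'm) formal) module, d) \<Rightarrow>
      \<exists>aug. projective_resolution A M P d aug"
    by (intro exI[of _ "(P, d)"]) auto
  then have "case chosen_resolution A M of (P, d) \<Rightarrow> \<exists>aug. projective_resolution A M P d aug"
    unfolding chosen_resolution_def by (rule someI_ex)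
  then show ?thesis by (simp add: case_prod_beta)
qed


section \<open>The algebras are rings and their trivial modules are modules\<close>

text \<open>
  The conditions under which \<^const>\<open>basis_algebra\<close> is an associative unital algebra and \<open>c\<close> gives
  modules \<^term>\<open>char_module R c\<close> over it. They hold for rook algebras and for group algebras, so that
  \<open>projective_resolution_exists\<close> applies to the trivial modules.
\<close>

locale based_algebra = cring R for R :: "('r, 'c) ring_scheme" (structure) +
  fixes X :: "'x set" and w :: "'x \<Rightarrow> 'x \<Rightarrow> 'r" and m :: "'x \<Rightarrow> 'x \<Rightarrow> 'x" and e :: 'x
    and c :: "'x \<Rightarrow> 'r"
  assumes m_closed': "\<And>x y. \<lbrakk>x \<in> X; y \<in> X\<rbrakk> \<Longrightarrow> m x y \<in> X"
    and w_closed: "\<And>x y. \<lbrakk>x \<in> X; y \<in> X\<rbrakk> \<Longrightarrow> w x y \<in> carrier R"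
    and assoc: "\<And>x y z. \<lbrakk>x \<in> X; y \<in> X; z \<in> X\<rbrakk> \<Longrightarrow> m (m x y) z = m x (m y z)"
    and cocycle: "\<And>x y z. \<lbrakk>x \<in> X; y \<in> X; z \<in> X\<rbrakk> \<Longrightarrow>
      w x y \<otimes> w (m x y) z = w y z \<otimes> w x (m y z)"
    and e_closed: "e \<in> X"
    and unit: "\<And>x. x \<in> X \<Longrightarrow> m e x = x \<and> m x e = x \<and> w e x = \<one> \<and> w x e = \<one>"
    and c_closed: "\<And>x. x \<in> X \<Longrightarrow> c x \<in> carrier R"
    and c_mult: "\<And>x y. \<lbrakk>x \<in> X; y \<in> X\<rbrakk> \<Longrightarrow> w x y \<otimes> c (m x y) = c x \<otimes> c y"
    and c_unit: "c e = \<one>"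
begin

definition A where "A = basis_algebra R X w m e"
abbreviation bas where "bas \<equiv> basis_elt R"
abbreviation supp where "supp f \<equiv> {x. f x \<noteq> \<zero>}"

lemma A_simps: "carrier A = fin_supp R X" "zero A = (\<lambda>_. \<zero>)" "one A = bas e"
  "f \<oplus>\<^bsub>A\<^esub> g = (\<lambda>x. f x \<oplus> g x)" "r \<odot>\<^bsub>A\<^esub> f = (\<lambda>x. r \<otimes> f x)"
  by (simp_all add: A_def basis_algebra_def)

lemma suppD: "f \<in> fin_supp R X \<Longrightarrow> finite (supp f) \<and> supp f \<subseteq> X"
  by (auto simp: fin_supp_def)

lemma mult_eq:
  assumes f: "f \<in> fin_supp R X" and g: "g \<in> fin_supp R X" and S: "finite S" "supp f \<subseteq> S" "S \<subseteq> X"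
    and T: "finite T" "supp g \<subseteq> T" "T \<subseteq> X"
  shows "(f \<otimes>\<^bsub>A\<^esub> g) z = (\<Oplus>p\<in>S \<times> T. if m (fst p) (snd p) = z
    then w (fst p) (snd p) \<otimes> (f (fst p) \<otimes> g (snd p)) else \<zero>)"
proof -
  have cl: "w x y \<otimes> (f x \<otimes> g y) \<in> carrier R" if "x \<in> S" "y \<in> T" for x y
    using that S T by (intro m_closed w_closed fin_supp_closed[OF f] fin_supp_closed[OF g]) auto
  have z: "w x y \<otimes> (f x \<otimes> g y) = \<zero>" if "x \<in> S" "y \<in> T" "f x = \<zero> \<or> g y = \<zero>" for x y
  proof -
    have "w x y \<in> carrier R" using that(1,2) S(3) T(3) by (intro w_closed) auto
    then show ?thesis using that(3) fin_supp_closed[OF f, of x] fin_supp_closed[OF g, of y] by auto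
  qed
  have "(f \<otimes>\<^bsub>A\<^esub> g) z = (\<Oplus>p\<in>{(x, y). f x \<noteq> \<zero> \<and> g y \<noteq> \<zero> \<and> m x y = z}.
       w (fst p) (snd p) \<otimes> (f (fst p) \<otimes> g (snd p)))"
    by (simp add: A_def basis_algebra_def)
  also have "\<dots> = (\<Oplus>p\<in>S \<times> T. if m (fst p) (snd p) = z
    then w (fst p) (snd p) \<otimes> (f (fst p) \<otimes> g (snd p)) else \<zero>)"
  proof (rule add.finprod_mono_neutral_cong_left)
    show "finite (S \<times> T)" using S T by simp
    show "{(x, y). f x \<noteq> \<zero> \<and> g y \<noteq> \<zero> \<and> m x y = z} \<subseteq> S \<times> T" using S T by blast
  qed (use cl z in \<open>auto split: prod.splits\<close>)
  finally show ?thesis .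
qed

lemma smult_fin_supp: "\<lbrakk>r \<in> carrier R; f \<in> fin_supp R X\<rbrakk> \<Longrightarrow> (\<lambda>x. r \<otimes> f x) \<in> fin_supp R X"
  using fin_supp_smult[of f X r] by (simp add: m_comm fin_supp_closed[where X = X])

lemma term_closed:
  assumes "f \<in> fin_supp R X" "g \<in> fin_supp R X" "x \<in> X" "y \<in> X"
  shows "(if m x y = z then w x y \<otimes> (f x \<otimes> g y) else \<zero>) \<in> carrier R"
  using assms by (auto simp: fin_supp_closed[where X = X] w_closed)

lemma mult_fin_supp:
  assumes f: "f \<in> fin_supp R X" and g: "g \<in> fin_supp R X"
  shows "f \<otimes>\<^bsub>A\<^esub> g \<in> fin_supp R X"
proof -
  note s = suppD[OF f] suppD[OF g]
  have eq: "(f \<otimes>\<^bsub>A\<^esub> g) z = (\<Oplus>p\<in>supp f \<times> supp g. if m (fst p) (snd p) = z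
    then w (fst p) (snd p) \<otimes> (f (fst p) \<otimes> g (snd p)) else \<zero>)" for z
    using s by (intro mult_eq f g) auto
  have cl: "(f \<otimes>\<^bsub>A\<^esub> g) z \<in> carrier R" for z
    unfolding eq using s by (intro finsum_closed) (auto intro!: term_closed[OF f g] w_closed simp: fin_supp_closed[OF f] fin_supp_closed[OF g])
  have z: "(f \<otimes>\<^bsub>A\<^esub> g) z = \<zero>" if "z \<notin> (\<lambda>p. m (fst p) (snd p)) ` (supp f \<times> supp g)" for z
    unfolding eq using that by (intro add.finprod_one_eqI) force
  have "supp (f \<otimes>\<^bsub>A\<^esub> g) \<subseteq> (\<lambda>p. m (fst p) (snd p)) ` (supp f \<times> supp g)"
    using z by blast
  moreover have "(\<lambda>p. m (fst p) (snd p)) ` (supp f \<times> supp g) \<subseteq> X"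
    using s m_closed' by force
  moreover have "finite ((\<lambda>p. m (fst p) (snd p)) ` (supp f \<times> supp g))" using s by simp
  ultimately show ?thesis
    unfolding fin_supp_def using cl z by (blast intro: finite_subset)
qed

lemma l_distr': 
  assumes f: "f \<in> fin_supp R X" and g: "g \<in> fin_supp R X" and h: "h \<in> fin_supp R X"
  shows "(\<lambda>x. f x \<oplus> g x) \<otimes>\<^bsub>A\<^esub> h = (\<lambda>x. (f \<otimes>\<^bsub>A\<^esub> h) x \<oplus> (g \<otimes>\<^bsub>A\<^esub> h) x)"
proof
  fix z
  define S where "S = supp f \<union> supp g"
  have S: "finite S" "S \<subseteq> X" "supp f \<subseteq> S" "supp g \<subseteq> S" "supp (\<lambda>x. f x \<oplus> g x) \<subseteq> S"
    using suppD[OF f] suppD[OF g] by (auto simp: S_def)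
  have T: "finite (supp h)" "supp h \<subseteq> X" using suppD[OF h] by auto
  have XX: "p \<in> S \<times> supp h \<Longrightarrow> fst p \<in> X \<and> snd p \<in> X" for p using S T by auto
  show "((\<lambda>x. f x \<oplus> g x) \<otimes>\<^bsub>A\<^esub> h) z = (f \<otimes>\<^bsub>A\<^esub> h) z \<oplus> (g \<otimes>\<^bsub>A\<^esub> h) z"
    unfolding mult_eq[OF fin_supp_add[OF f g] h S(1,5,2) T(1) subset_refl T(2)]
      mult_eq[OF f h S(1,3,2) T(1) subset_refl T(2)] mult_eq[OF g h S(1,4,2) T(1) subset_refl T(2)]
  proof -
    have cl: "(if m (fst p) (snd p) = z then w (fst p) (snd p) \<otimes> (f (fst p) \<otimes> h (snd p)) else \<zero>) \<in> carrier R" "(if m (fst p) (snd p) = z then w (fst p) (snd p) \<otimes> (g (fst p) \<otimes> h (snd p)) else \<zero>) \<in> carrier R" if "p \<in> S \<times> supp h" for p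
      using XX[OF that] by (simp_all add: w_closed fin_supp_closed[OF f] fin_supp_closed[OF g] fin_supp_closed[OF h])
    have "(\<Oplus>p\<in>S \<times> supp h. (if m (fst p) (snd p) = z then w (fst p) (snd p) \<otimes> ((f (fst p) \<oplus> g (fst p)) \<otimes> h (snd p)) else \<zero>)) = (\<Oplus>p\<in>S \<times> supp h. (if m (fst p) (snd p) = z then w (fst p) (snd p) \<otimes> (f (fst p) \<otimes> h (snd p)) else \<zero>) \<oplus> (if m (fst p) (snd p) = z then w (fst p) (snd p) \<otimes> (g (fst p) \<otimes> h (snd p)) else \<zero>))"
    proof (rule finsum_cong')
      fix p assume "p \<in> S \<times> supp h"
      then show "(if m (fst p) (snd p) = z then w (fst p) (snd p) \<otimes> ((f (fst p) \<oplus> g (fst p)) \<otimes> h (snd p)) else \<zero>) = (if m (fst p) (snd p) = z then w (fst p) (snd p) \<otimes> (f (fst p) \<otimes> h (snd p)) else \<zero>) \<oplus> (if m (fst p) (snd p) = z then w (fst p) (snd p) \<otimes> (g (fst p) \<otimes> h (snd p)) else \<zero>)"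
        using XX[of p] by (simp add: w_closed fin_supp_closed[OF f] fin_supp_closed[OF g] fin_supp_closed[OF h] l_distr r_distr)
    qed (use cl in \<open>simp_all add: Pi_iff del: mem_Sigma_iff\<close>)
    also have "\<dots> = (\<Oplus>p\<in>S \<times> supp h. (if m (fst p) (snd p) = z then w (fst p) (snd p) \<otimes> (f (fst p) \<otimes> h (snd p)) else \<zero>)) \<oplus> (\<Oplus>p\<in>S \<times> supp h. (if m (fst p) (snd p) = z then w (fst p) (snd p) \<otimes> (g (fst p) \<otimes> h (snd p)) else \<zero>))"
      using cl by (intro finsum_addf) (simp_all add: Pi_iff del: mem_Sigma_iff)
    finally show "(\<Oplus>p\<in>S \<times> supp h. (if m (fst p) (snd p) = z then w (fst p) (snd p) \<otimes> ((f (fst p) \<oplus> g (fst p)) \<otimes> h (snd p)) else \<zero>)) = (\<Oplus>p\<in>S \<times> supp h. (if m (fst p) (snd p) = z then w (fst p) (snd p) \<otimes> (f (fst p) \<otimes> h (snd p)) else \<zero>)) \<oplus> (\<Oplus>p\<in>S \<times> supp h. (if m (fst p) (snd p) = z then w (fst p) (snd p) \<otimes> (g (fst p) \<otimes> h (snd p)) else \<zero>))" .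
  qed
qed

lemma r_distr': 
  assumes f: "f \<in> fin_supp R X" and g: "g \<in> fin_supp R X" and h: "h \<in> fin_supp R X"
  shows "h \<otimes>\<^bsub>A\<^esub> (\<lambda>x. f x \<oplus> g x) = (\<lambda>x. (h \<otimes>\<^bsub>A\<^esub> f) x \<oplus> (h \<otimes>\<^bsub>A\<^esub> g) x)"
proof
  fix z
  define S where "S = supp f \<union> supp g"
  have S: "finite S" "S \<subseteq> X" "supp f \<subseteq> S" "supp g \<subseteq> S" "supp (\<lambda>x. f x \<oplus> g x) \<subseteq> S"
    using suppD[OF f] suppD[OF g] by (auto simp: S_def)
  have T: "finite (supp h)" "supp h \<subseteq> X" using suppD[OF h] by auto
  have XX: "p \<in> supp h \<times> S \<Longrightarrow> fst p \<in> X \<and> snd p \<in> X" for p using S T by auto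
  show "(h \<otimes>\<^bsub>A\<^esub> (\<lambda>x. f x \<oplus> g x)) z = (h \<otimes>\<^bsub>A\<^esub> f) z \<oplus> (h \<otimes>\<^bsub>A\<^esub> g) z"
    unfolding mult_eq[OF h fin_supp_add[OF f g] T(1) subset_refl T(2) S(1,5,2)]
      mult_eq[OF h f T(1) subset_refl T(2) S(1,3,2)] mult_eq[OF h g T(1) subset_refl T(2) S(1,4,2)]
  proof -
    have cl: "(if m (fst p) (snd p) = z then w (fst p) (snd p) \<otimes> (h (fst p) \<otimes> f (snd p)) else \<zero>) \<in> carrier R" "(if m (fst p) (snd p) = z then w (fst p) (snd p) \<otimes> (h (fst p) \<otimes> g (snd p)) else \<zero>) \<in> carrier R" if "p \<in> supp h \<times> S" for p
      using XX[OF that] by (simp_all add: w_closed fin_supp_closed[OF f] fin_supp_closed[OF g] fin_supp_closed[OF h])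
    have "(\<Oplus>p\<in>supp h \<times> S. (if m (fst p) (snd p) = z then w (fst p) (snd p) \<otimes> (h (fst p) \<otimes> (f (snd p) \<oplus> g (snd p))) else \<zero>)) = (\<Oplus>p\<in>supp h \<times> S. (if m (fst p) (snd p) = z then w (fst p) (snd p) \<otimes> (h (fst p) \<otimes> f (snd p)) else \<zero>) \<oplus> (if m (fst p) (snd p) = z then w (fst p) (snd p) \<otimes> (h (fst p) \<otimes> g (snd p)) else \<zero>))"
    proof (rule finsum_cong')
      fix p assume "p \<in> supp h \<times> S"
      then show "(if m (fst p) (snd p) = z then w (fst p) (snd p) \<otimes> (h (fst p) \<otimes> (f (snd p) \<oplus> g (snd p))) else \<zero>) = (if m (fst p) (snd p) = z then w (fst p) (snd p) \<otimes> (h (fst p) \<otimes> f (snd p)) else \<zero>) \<oplus> (if m (fst p) (snd p) = z then w (fst p) (snd p) \<otimes> (h (fst p) \<otimes> g (snd p)) else \<zero>)"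
        using XX[of p] by (simp add: w_closed fin_supp_closed[OF f] fin_supp_closed[OF g] fin_supp_closed[OF h] l_distr r_distr)
    qed (use cl in \<open>simp_all add: Pi_iff del: mem_Sigma_iff\<close>)
    also have "\<dots> = (\<Oplus>p\<in>supp h \<times> S. (if m (fst p) (snd p) = z then w (fst p) (snd p) \<otimes> (h (fst p) \<otimes> f (snd p)) else \<zero>)) \<oplus> (\<Oplus>p\<in>supp h \<times> S. (if m (fst p) (snd p) = z then w (fst p) (snd p) \<otimes> (h (fst p) \<otimes> g (snd p)) else \<zero>))"
      using cl by (intro finsum_addf) (simp_all add: Pi_iff del: mem_Sigma_iff)
    finally show "(\<Oplus>p\<in>supp h \<times> S. (if m (fst p) (snd p) = z then w (fst p) (snd p) \<otimes> (h (fst p) \<otimes> (f (snd p) \<oplus> g (snd p))) else \<zero>)) = (\<Oplus>p\<in>supp h \<times> S. (if m (fst p) (snd p) = z then w (fst p) (snd p) \<otimes> (h (fst p) \<otimes> f (snd p)) else \<zero>)) \<oplus> (\<Oplus>p\<in>supp h \<times> S. (if m (fst p) (snd p) = z then w (fst p) (snd p) \<otimes> (h (fst p) \<otimes> g (snd p)) else \<zero>))" .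
  qed
qed

lemma smult_l:
  assumes f: "f \<in> fin_supp R X" and h: "h \<in> fin_supp R X" and r: "r \<in> carrier R"
  shows "(\<lambda>x. r \<otimes> f x) \<otimes>\<^bsub>A\<^esub> h = (\<lambda>x. r \<otimes> (f \<otimes>\<^bsub>A\<^esub> h) x)"
proof
  fix z
  have S: "finite (supp f)" "supp f \<subseteq> X" "supp (\<lambda>x. r \<otimes> f x) \<subseteq> supp f"
    using suppD[OF f] r by auto
  have T: "finite (supp h)" "supp h \<subseteq> X" using suppD[OF h] by auto
  have XX: "p \<in> supp f \<times> supp h \<Longrightarrow> fst p \<in> X \<and> snd p \<in> X" for p using S T by auto
  show "((\<lambda>x. r \<otimes> f x) \<otimes>\<^bsub>A\<^esub> h) z = r \<otimes> (f \<otimes>\<^bsub>A\<^esub> h) z"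
    unfolding mult_eq[OF smult_fin_supp[OF r f] h S(1,3,2) T(1) subset_refl T(2)]
      mult_eq[OF f h S(1) subset_refl S(2) T(1) subset_refl T(2)]
  proof -
    have cl: "(if m (fst p) (snd p) = z then w (fst p) (snd p) \<otimes> (f (fst p) \<otimes> h (snd p)) else \<zero>) \<in> carrier R" if "p \<in> supp f \<times> supp h" for p
      using XX[OF that] by (simp_all add: w_closed fin_supp_closed[OF f] fin_supp_closed[OF h])
    have clt: "(if m (fst p) (snd p) = z then w (fst p) (snd p) \<otimes> (r \<otimes> f (fst p) \<otimes> h (snd p)) else \<zero>) \<in> carrier R" if "p \<in> supp f \<times> supp h" for p
        using XX[OF that] r by (simp add: w_closed fin_supp_closed[OF f] fin_supp_closed[OF h])
    have "r \<otimes> (\<Oplus>p\<in>supp f \<times> supp h. (if m (fst p) (snd p) = z then w (fst p) (snd p) \<otimes> (f (fst p) \<otimes> h (snd p)) else \<zero>)) = (\<Oplus>p\<in>supp f \<times> supp h. r \<otimes> (if m (fst p) (snd p) = z then w (fst p) (snd p) \<otimes> (f (fst p) \<otimes> h (snd p)) else \<zero>))"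
      using cl r S T by (intro finsum_rdistr) (simp_all add: Pi_iff del: mem_Sigma_iff)
    also have "\<dots> = (\<Oplus>p\<in>supp f \<times> supp h. (if m (fst p) (snd p) = z then w (fst p) (snd p) \<otimes> (r \<otimes> f (fst p) \<otimes> h (snd p)) else \<zero>))"
    proof (rule finsum_cong')
      fix p assume "p \<in> supp f \<times> supp h"
      then show "r \<otimes> (if m (fst p) (snd p) = z then w (fst p) (snd p) \<otimes> (f (fst p) \<otimes> h (snd p)) else \<zero>) = (if m (fst p) (snd p) = z then w (fst p) (snd p) \<otimes> (r \<otimes> f (fst p) \<otimes> h (snd p)) else \<zero>)"
        using XX[of p] r by (simp add: w_closed fin_supp_closed[OF f] fin_supp_closed[OF h] m_ac)
    qed (use clt in \<open>simp_all add: Pi_iff del: mem_Sigma_iff\<close>)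
    finally show "(\<Oplus>p\<in>supp f \<times> supp h. (if m (fst p) (snd p) = z then w (fst p) (snd p) \<otimes> (r \<otimes> f (fst p) \<otimes> h (snd p)) else \<zero>)) = r \<otimes> (\<Oplus>p\<in>supp f \<times> supp h. (if m (fst p) (snd p) = z then w (fst p) (snd p) \<otimes> (f (fst p) \<otimes> h (snd p)) else \<zero>))" by simp
  qed
qed

lemma smult_r:
  assumes f: "f \<in> fin_supp R X" and h: "h \<in> fin_supp R X" and r: "r \<in> carrier R"
  shows "h \<otimes>\<^bsub>A\<^esub> (\<lambda>x. r \<otimes> f x) = (\<lambda>x. r \<otimes> (h \<otimes>\<^bsub>A\<^esub> f) x)"
proof
  fix z
  have S: "finite (supp f)" "supp f \<subseteq> X" "supp (\<lambda>x. r \<otimes> f x) \<subseteq> supp f"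
    using suppD[OF f] r by auto
  have T: "finite (supp h)" "supp h \<subseteq> X" using suppD[OF h] by auto
  have XX: "p \<in> supp h \<times> supp f \<Longrightarrow> fst p \<in> X \<and> snd p \<in> X" for p using S T by auto
  show "(h \<otimes>\<^bsub>A\<^esub> (\<lambda>x. r \<otimes> f x)) z = r \<otimes> (h \<otimes>\<^bsub>A\<^esub> f) z"
    unfolding mult_eq[OF h smult_fin_supp[OF r f] T(1) subset_refl T(2) S(1,3,2)]
      mult_eq[OF h f T(1) subset_refl T(2) S(1) subset_refl S(2)]
  proof -
    have cl: "(if m (fst p) (snd p) = z then w (fst p) (snd p) \<otimes> (h (fst p) \<otimes> f (snd p)) else \<zero>) \<in> carrier R" if "p \<in> supp h \<times> supp f" for p
      using XX[OF that] by (simp_all add: w_closed fin_supp_closed[OF f] fin_supp_closed[OF h])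
    have clt: "(if m (fst p) (snd p) = z then w (fst p) (snd p) \<otimes> (h (fst p) \<otimes> (r \<otimes> f (snd p))) else \<zero>) \<in> carrier R" if "p \<in> supp h \<times> supp f" for p
        using XX[OF that] r by (simp add: w_closed fin_supp_closed[OF f] fin_supp_closed[OF h])
    have "r \<otimes> (\<Oplus>p\<in>supp h \<times> supp f. (if m (fst p) (snd p) = z then w (fst p) (snd p) \<otimes> (h (fst p) \<otimes> f (snd p)) else \<zero>)) = (\<Oplus>p\<in>supp h \<times> supp f. r \<otimes> (if m (fst p) (snd p) = z then w (fst p) (snd p) \<otimes> (h (fst p) \<otimes> f (snd p)) else \<zero>))"
      using cl r S T by (intro finsum_rdistr) (simp_all add: Pi_iff del: mem_Sigma_iff)
    also have "\<dots> = (\<Oplus>p\<in>supp h \<times> supp f. (if m (fst p) (snd p) = z then w (fst p) (snd p) \<otimes> (h (fst p) \<otimes> (r \<otimes> f (snd p))) else \<zero>))"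
    proof (rule finsum_cong')
      fix p assume "p \<in> supp h \<times> supp f"
      then show "r \<otimes> (if m (fst p) (snd p) = z then w (fst p) (snd p) \<otimes> (h (fst p) \<otimes> f (snd p)) else \<zero>) = (if m (fst p) (snd p) = z then w (fst p) (snd p) \<otimes> (h (fst p) \<otimes> (r \<otimes> f (snd p))) else \<zero>)"
        using XX[of p] r by (simp add: w_closed fin_supp_closed[OF f] fin_supp_closed[OF h] m_ac)
    qed (use clt in \<open>simp_all add: Pi_iff del: mem_Sigma_iff\<close>)
    finally show "(\<Oplus>p\<in>supp h \<times> supp f. (if m (fst p) (snd p) = z then w (fst p) (snd p) \<otimes> (h (fst p) \<otimes> (r \<otimes> f (snd p))) else \<zero>)) = r \<otimes> (\<Oplus>p\<in>supp h \<times> supp f. (if m (fst p) (snd p) = z then w (fst p) (snd p) \<otimes> (h (fst p) \<otimes> f (snd p)) else \<zero>))" by simp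
  qed
qed

lemma bas_in: "x \<in> X \<Longrightarrow> bas x \<in> fin_supp R X" by (rule basis_elt_fin_supp)

lemma bas_mult:
  assumes "x \<in> X" "y \<in> X"
  shows "bas x \<otimes>\<^bsub>A\<^esub> bas y = (\<lambda>z. w x y \<otimes> bas (m x y) z)"
proof
  fix z
  have "(bas x \<otimes>\<^bsub>A\<^esub> bas y) z = (\<Oplus>p\<in>{x} \<times> {y}. if m (fst p) (snd p) = z
    then w (fst p) (snd p) \<otimes> (bas x (fst p) \<otimes> bas y (snd p)) else \<zero>)"
    by (rule mult_eq) (use assms in \<open>auto simp: bas_in\<close>, (auto simp: basis_elt_def split: if_splits)?)
  also have "\<dots> = w x y \<otimes> bas (m x y) z"
    using assms w_closed[of x y] by (auto simp: basis_elt_def)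
  finally show "(bas x \<otimes>\<^bsub>A\<^esub> bas y) z = w x y \<otimes> bas (m x y) z" .
qed

lemma induct_fs [consumes 1, case_names zero add]:
  assumes f: "f \<in> fin_supp R X" and z: "P (\<lambda>_. \<zero>)"
    and step: "\<And>x r g. \<lbrakk>x \<in> X; r \<in> carrier R; g \<in> fin_supp R X; P g\<rbrakk> \<Longrightarrow>
      P (\<lambda>y. g y \<oplus> r \<otimes> bas x y)"
  shows "P f"
proof -
  have "P f" if "finite S" "S \<subseteq> X" "f \<in> fin_supp R X" "supp f \<subseteq> S" for S f
    using that
  proof (induction S arbitrary: f rule: finite_induct)
    case empty
    then have "f = (\<lambda>_. \<zero>)" by auto
    then show ?case using z by simp
  next
    case (insert x S)
    define g where "g = (\<lambda>y. if y = x then \<zero> else f y)"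
    have g: "g \<in> fin_supp R X" "supp g \<subseteq> S"
    proof -
      have "supp g \<subseteq> supp f" by (auto simp: g_def)
      then show "g \<in> fin_supp R X"
        using insert.prems(2) by (auto simp: fin_supp_def g_def intro: finite_subset)
      show "supp g \<subseteq> S" using insert.prems(3) by (auto simp: g_def)
    qed
    have "f = (\<lambda>y. g y \<oplus> f x \<otimes> bas x y)"
      using fin_supp_closed[OF insert.prems(2)] by (auto simp: g_def basis_elt_def fun_eq_iff)
    moreover have "P (\<lambda>y. g y \<oplus> f x \<otimes> bas x y)"
      using insert fin_supp_closed[OF insert.prems(2)] g by (intro step insert.IH) auto
    ultimately show ?case by simp
  qed
  then show ?thesis using f suppD[OF f] by blast
qed

lemma zero_mult [simp]: "f \<in> fin_supp R X \<Longrightarrow> (\<lambda>_. \<zero>) \<otimes>\<^bsub>A\<^esub> f = (\<lambda>_. \<zero>)"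
  by (simp add: A_def basis_algebra_def)
lemma mult_zero [simp]: "f \<in> fin_supp R X \<Longrightarrow> f \<otimes>\<^bsub>A\<^esub> (\<lambda>_. \<zero>) = (\<lambda>_. \<zero>)"
  by (simp add: A_def basis_algebra_def)

lemmas fs = fin_supp_add smult_fin_supp bas_in mult_fin_supp fin_supp_zero m_closed' w_closed

lemma bas_assoc:
  assumes "x \<in> X" "y \<in> X" "z \<in> X"
  shows "(bas x \<otimes>\<^bsub>A\<^esub> bas y) \<otimes>\<^bsub>A\<^esub> bas z = bas x \<otimes>\<^bsub>A\<^esub> (bas y \<otimes>\<^bsub>A\<^esub> bas z)"
  using assms cocycle[OF assms]
  by (simp add: bas_mult smult_l smult_r fs assoc m_assoc[symmetric] fin_supp_closed[OF bas_in])

lemma mult_assoc: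
  assumes f: "f \<in> fin_supp R X" and g: "g \<in> fin_supp R X" and h: "h \<in> fin_supp R X"
  shows "(f \<otimes>\<^bsub>A\<^esub> g) \<otimes>\<^bsub>A\<^esub> h = f \<otimes>\<^bsub>A\<^esub> (g \<otimes>\<^bsub>A\<^esub> h)"
proof -
  have 1: "(bas x \<otimes>\<^bsub>A\<^esub> bas y) \<otimes>\<^bsub>A\<^esub> h = bas x \<otimes>\<^bsub>A\<^esub> (bas y \<otimes>\<^bsub>A\<^esub> h)" if "x \<in> X" "y \<in> X" for x y
    using h by (induction h rule: induct_fs) (simp_all add: that fs r_distr' smult_r bas_assoc)
  have 2: "(bas x \<otimes>\<^bsub>A\<^esub> g) \<otimes>\<^bsub>A\<^esub> h = bas x \<otimes>\<^bsub>A\<^esub> (g \<otimes>\<^bsub>A\<^esub> h)" if "x \<in> X" for x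
    using g by (induction g rule: induct_fs) (simp_all add: that h fs r_distr' l_distr' smult_l smult_r 1)
  show ?thesis
    using f by (induction f rule: induct_fs) (simp_all add: g h fs l_distr' smult_l 2)
qed

lemma ring_A: "ring A"
proof (rule ringI)
  have "abelian_group (free_module R X)"
    using right_module_free_module[of X] by (simp add: right_module_def)
  then show "abelian_group A"
    by (simp add: abelian_group_def abelian_group_axioms_def abelian_monoid_def comm_group_def
      A_simps free_module_def A_def basis_algebra_def)
  show "Group.monoid A"
  proof (rule monoidI)
    fix f assume "f \<in> carrier A"
    then have f: "f \<in> fin_supp R X" by (simp add: A_simps)
    then show "\<one>\<^bsub>A\<^esub> \<otimes>\<^bsub>A\<^esub> f = f"
      by (induction f rule: induct_fs)
        (simp_all add: A_simps fs e_closed unit r_distr' smult_r bas_mult fin_supp_closed[OF bas_in])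
    from f show "f \<otimes>\<^bsub>A\<^esub> \<one>\<^bsub>A\<^esub> = f"
      by (induction f rule: induct_fs)
        (simp_all add: A_simps fs e_closed unit l_distr' smult_l bas_mult fin_supp_closed[OF bas_in])
  qed (simp_all add: A_simps fs e_closed mult_assoc)
qed (simp_all add: A_simps l_distr' r_distr')


definition chi where "chi f = (\<Oplus>x\<in>supp f. f x \<otimes> c x)"

lemma chi_eq:
  assumes f: "f \<in> fin_supp R X" and "finite S" "supp f \<subseteq> S" "S \<subseteq> X"
  shows "chi f = (\<Oplus>x\<in>S. f x \<otimes> c x)"
  unfolding chi_def using assms
  by (intro add.finprod_mono_neutral_cong_left) (auto simp: fin_supp_closed[OF f] c_closed subset_iff Pi_iff)

lemma chi_closed: "f \<in> fin_supp R X \<Longrightarrow> chi f \<in> carrier R"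
  unfolding chi_def using suppD[of f]
  by (intro finsum_closed) (auto simp: fin_supp_closed c_closed subset_iff Pi_iff)

lemma chi_add:
  assumes f: "f \<in> fin_supp R X" and g: "g \<in> fin_supp R X"
  shows "chi (\<lambda>x. f x \<oplus> g x) = chi f \<oplus> chi g"
proof -
  define S where "S = supp f \<union> supp g"
  have S: "finite S" "S \<subseteq> X" "supp f \<subseteq> S" "supp g \<subseteq> S" "supp (\<lambda>x. f x \<oplus> g x) \<subseteq> S"
    using suppD[OF f] suppD[OF g] by (auto simp: S_def)
  have c: "c x \<in> carrier R" if "x \<in> S" for x using that S c_closed by auto
  have "chi (\<lambda>x. f x \<oplus> g x) = (\<Oplus>x\<in>S. f x \<otimes> c x \<oplus> g x \<otimes> c x)"
    unfolding chi_eq[OF fin_supp_add[OF f g] S(1,5,2)]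
    by (intro finsum_cong') (auto simp: fin_supp_closed[OF f] fin_supp_closed[OF g] c l_distr)
  also have "\<dots> = chi f \<oplus> chi g"
    unfolding chi_eq[OF f S(1,3,2)] chi_eq[OF g S(1,4,2)]
    by (intro finsum_addf) (auto simp: fin_supp_closed[OF f] fin_supp_closed[OF g] c)
  finally show ?thesis .
qed

lemma chi_smult:
  assumes f: "f \<in> fin_supp R X" and r: "r \<in> carrier R"
  shows "chi (\<lambda>x. r \<otimes> f x) = r \<otimes> chi f"
proof -
  have S: "finite (supp f)" "supp f \<subseteq> X" "supp (\<lambda>x. r \<otimes> f x) \<subseteq> supp f"
    using suppD[OF f] r by auto
  have c: "c x \<in> carrier R" if "f x \<noteq> \<zero>" for x using that S c_closed by auto
  have "chi (\<lambda>x. r \<otimes> f x) = (\<Oplus>x\<in>supp f. r \<otimes> (f x \<otimes> c x))"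
    unfolding chi_eq[OF smult_fin_supp[OF r f] S(1,3,2)]
    by (intro finsum_cong') (auto simp: fin_supp_closed[OF f] c r m_assoc)
  also have "\<dots> = r \<otimes> chi f"
    unfolding chi_def using S by (intro finsum_rdistr[symmetric]) (auto simp: fin_supp_closed[OF f] c r)
  finally show ?thesis .
qed

lemma chi_bas: "x \<in> X \<Longrightarrow> chi (bas x) = c x"
proof -
  assume x: "x \<in> X"
  have "chi (bas x) = (\<Oplus>y\<in>{x}. bas x y \<otimes> c y)"
    by (rule chi_eq) (use x in \<open>auto simp: bas_in\<close>, auto simp: basis_elt_def split: if_splits)
  then show ?thesis using x c_closed by (simp add: basis_elt_def)
qed

lemma chi_zero: "chi (\<lambda>_. \<zero>) = \<zero>" by (simp add: chi_def)

lemma chi_mult: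
  assumes f: "f \<in> fin_supp R X" and g: "g \<in> fin_supp R X"
  shows "chi (f \<otimes>\<^bsub>A\<^esub> g) = chi f \<otimes> chi g"
proof -
  note cs = fs chi_add chi_smult chi_bas chi_closed c_closed chi_zero
  have 1: "chi (bas x \<otimes>\<^bsub>A\<^esub> g) = c x \<otimes> chi g" if x: "x \<in> X" for x
    using g
  proof (induction g rule: induct_fs)
    case (add y r g)
    have "c x \<otimes> (r \<otimes> c y) = r \<otimes> (w x y \<otimes> c (m x y))"
      using add x by (simp add: c_mult c_closed m_ac)
    then show ?case using add x
      by (simp add: cs r_distr' smult_r bas_mult fin_supp_closed[OF bas_in] r_distr)
  qed (simp add: cs x)
  show ?thesis
    using f
  proof (induction f rule: induct_fs)
    case (add x r f)
    then show ?case using g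
      by (simp add: cs l_distr' smult_l 1 l_distr m_assoc)
  qed (simp add: cs g)
qed

lemma char_smult: "f \<odot>\<^bsub>char_module R c\<^esub> r = chi f \<otimes> r"
  by (simp add: char_module_def chi_def)

lemma abelian_group_char: "abelian_group (char_module R c)"
proof (rule abelian_groupI)
  fix x assume "x \<in> carrier (char_module R c)"
  then have "\<ominus> x \<in> carrier R" "\<ominus> x \<oplus> x = \<zero>" by (simp_all add: char_module_def l_neg)
  then show "\<exists>y\<in>carrier (char_module R c). y \<oplus>\<^bsub>char_module R c\<^esub> x = \<zero>\<^bsub>char_module R c\<^esub>"
    by (auto simp: char_module_def)
qed (simp_all add: char_module_def a_ac)

lemma char_rest: "carrier (char_module R c) = carrier R" "x \<oplus>\<^bsub>char_module R c\<^esub> y = x \<oplus> y"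
  by (simp_all add: char_module_def)

lemma left_module_char: "left_module A (char_module R c)"
proof (intro left_module.intro left_module_axioms.intro ring_A abelian_group_char)
  fix f g r s
  assume "f \<in> carrier A" "r \<in> carrier (char_module R c)"
  then have f: "f \<in> fin_supp R X" and r: "r \<in> carrier R" by (simp_all add: A_simps char_rest)
  note * = chi_closed[OF f] r
  show "f \<odot>\<^bsub>char_module R c\<^esub> r \<in> carrier (char_module R c)"
    using * by (simp add: char_smult char_rest)
  { assume "s \<in> carrier (char_module R c)"
    then show "f \<odot>\<^bsub>char_module R c\<^esub> (r \<oplus>\<^bsub>char_module R c\<^esub> s) =
      f \<odot>\<^bsub>char_module R c\<^esub> r \<oplus>\<^bsub>char_module R c\<^esub> f \<odot>\<^bsub>char_module R c\<^esub> s"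
      using * by (simp add: char_smult char_rest r_distr) }
  assume "g \<in> carrier A"
  then have g: "g \<in> fin_supp R X" by (simp add: A_simps)
  note ** = * chi_closed[OF g]
  show "(f \<oplus>\<^bsub>A\<^esub> g) \<odot>\<^bsub>char_module R c\<^esub> r =
      f \<odot>\<^bsub>char_module R c\<^esub> r \<oplus>\<^bsub>char_module R c\<^esub> g \<odot>\<^bsub>char_module R c\<^esub> r"
    using ** by (simp add: char_smult char_rest A_simps chi_add[OF f g] l_distr)
  show "(f \<otimes>\<^bsub>A\<^esub> g) \<odot>\<^bsub>char_module R c\<^esub> r =
      f \<odot>\<^bsub>char_module R c\<^esub> (g \<odot>\<^bsub>char_module R c\<^esub> r)"
    using ** by (simp add: char_smult chi_mult[OF f g] m_assoc)
qed (simp add: char_smult char_rest A_simps chi_bas e_closed c_unit)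

lemma right_module_char: "right_module A (char_module R c)"
proof (intro right_module.intro right_module_axioms.intro ring_A abelian_group_char)
  fix f g r
  assume "f \<in> carrier A" "g \<in> carrier A" "r \<in> carrier (char_module R c)"
  then have f: "f \<in> fin_supp R X" and g: "g \<in> fin_supp R X" and r: "r \<in> carrier R"
    by (simp_all add: A_simps char_rest)
  show "(f \<otimes>\<^bsub>A\<^esub> g) \<odot>\<^bsub>char_module R c\<^esub> r =
      g \<odot>\<^bsub>char_module R c\<^esub> (f \<odot>\<^bsub>char_module R c\<^esub> r)"
    using chi_closed[OF f] chi_closed[OF g] r by (simp add: char_smult chi_mult[OF f g] m_ac)
qed (use left_module_char in \<open>simp_all only: left_module_def left_module_axioms_def\<close>)

end

lemma group_based:
  assumes "cring R" "Group.group G"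
  shows "based_algebra R (carrier G) (\<lambda>_ _. \<one>\<^bsub>R\<^esub>) (\<otimes>\<^bsub>G\<^esub>) \<one>\<^bsub>G\<^esub> (\<lambda>_. \<one>\<^bsub>R\<^esub>)"
proof -
  interpret cring R by fact
  interpret G: Group.group G by fact
  show ?thesis by unfold_locales (auto simp: G.m_assoc)
qed

lemma rook_comp_eq: "rook_comp x y = x O y" if x: "x \<in> rook_diagrams n" and y: "y \<in> rook_diagrams n"
proof -
  let ?E = "concat_graph x y"
  let ?S = "?E \<union> ?E\<inverse>"
  have inv: "(case v of Lft i' \<Rightarrow> i' = i | Mid j \<Rightarrow> (i, j) \<in> x | Rgt k \<Rightarrow> (i, k) \<in> x O y)"
    if "(Lft i, v) \<in> ?S\<^sup>*" for i v
    using that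
  proof (induction rule: rtrancl_induct)
    case (step u v)
    have sv: "single_valued x" "single_valued (x\<inverse>)" "single_valued (y\<inverse>)"
      using x y by (auto simp: rook_diagrams_def)
    have 1: "a = i" if "(a, j) \<in> x" "(i, j) \<in> x" for a j
      using sv(2) that by (auto simp: single_valued_def)
    have 2: "a = b" if "(i, a) \<in> x" "(i, b) \<in> x" for a b
      using sv(1) that by (auto simp: single_valued_def)
    have 3: "a = b" if "(a, j) \<in> y" "(b, j) \<in> y" for a b j
      using sv(3) that by (auto simp: single_valued_def)
    show ?case
      using step.hyps(2) step.IH
      by (cases u; cases v; simp add: concat_graph_def) (blast dest: 1 3)+
  qed simp
  show ?thesis
  proof (rule equalityI; rule subrelI)
    fix i k assume "(i, k) \<in> rook_comp x y"
    then have "(Lft i, Rgt k) \<in> ?S\<^sup>*" by (simp add: rook_comp_def)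
    from inv[OF this] show "(i, k) \<in> x O y" by simp
  next
    fix i k assume "(i, k) \<in> x O y"
    then obtain j where "(i, j) \<in> x" "(j, k) \<in> y" by blast
    then have "(Lft i, Mid j) \<in> ?S" "(Mid j, Rgt k) \<in> ?S" by (auto simp: concat_graph_def)
    then have "(Lft i, Rgt k) \<in> ?S\<^sup>*" by (rule converse_rtrancl_into_rtrancl[OF _ r_into_rtrancl])
    then show "(i, k) \<in> rook_comp x y" unfolding rook_comp_def by simp
  qed
qed

lemma isolated_eq: "isolated_middle n x y = card {j \<in> {1..n}. j \<notin> Range x \<and> j \<notin> Domain y}"
proof -
  have "Mid j \<in> Field (concat_graph x y) \<longleftrightarrow> j \<in> Range x \<or> j \<in> Domain y" for j
    by (auto simp: concat_graph_def Field_def Domain_iff Range_iff)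
  then show ?thesis by (simp add: isolated_middle_def)
qed

lemma rook_O: "\<lbrakk>x \<in> rook_diagrams n; y \<in> rook_diagrams n\<rbrakk> \<Longrightarrow> x O y \<in> rook_diagrams n"
  unfolding rook_diagrams_def
  by (auto simp: converse_relcomp intro!: single_valued_relcomp)

lemma rook_card: assumes "x \<in> rook_diagrams n" shows "finite x" "card (Domain x) = card x" "card (Range x) = card x"
proof -
  show "finite x" using assms by (auto simp: rook_diagrams_def intro: finite_subset)
  have "inj_on fst x" "inj_on snd x"
    using assms by (auto simp: rook_diagrams_def single_valued_def inj_on_def)
  then show "card (Domain x) = card x" "card (Range x) = card x"
    by (simp_all add: Domain_fst Range_snd card_image)
qed

lemma rook_perfect: assumes x: "x \<in> rook_diagrams n" shows "Domain x = {1..n} \<longleftrightarrow> Range x = {1..n}"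
proof -
  have "Domain x \<subseteq> {1..n}" "Range x \<subseteq> {1..n}" using x by (auto simp: rook_diagrams_def)
  then show ?thesis using rook_card[OF x] by (metis card_subset_eq finite_atLeastAtMost)
qed

lemma isolated_middle_cocycle:
  assumes x: "x \<in> rook_diagrams n" and y: "y \<in> rook_diagrams n" and z: "z \<in> rook_diagrams n"
  shows "isolated_middle n x y + isolated_middle n (x O y) z
    = isolated_middle n y z + isolated_middle n x (y O z)"
proof -
  have r: "x \<subseteq> {1..n} \<times> {1..n}" "y \<subseteq> {1..n} \<times> {1..n}" "z \<subseteq> {1..n} \<times> {1..n}"
    using assms by (auto simp: rook_diagrams_def)
  define E where "E = {(j, k) \<in> y. j \<notin> Range x \<and> k \<notin> Domain z}"
  have fE: "finite E" using rook_card(1)[OF y] by (auto simp: E_def intro: finite_subset)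
  have i: "inj_on fst E" "inj_on snd E"
    using y by (auto simp: E_def rook_diagrams_def single_valued_def inj_on_def)
  have 1: "isolated_middle n (x O y) z = isolated_middle n y z + card E"
  proof -
    have "{j \<in> {1..n}. j \<notin> Range (x O y) \<and> j \<notin> Domain z} =
      {j \<in> {1..n}. j \<notin> Range y \<and> j \<notin> Domain z} \<union> snd ` E" 
    proof (rule Set.set_eqI, rule iffI)
      fix k assume k: "k \<in> {j \<in> {1..n}. j \<notin> Range (x O y) \<and> j \<notin> Domain z}"
      show "k \<in> {j \<in> {1..n}. j \<notin> Range y \<and> j \<notin> Domain z} \<union> snd ` E"
      proof (cases "k \<in> Range y")
        case True
        then obtain j where "(j, k) \<in> y" by blast
        then have "(j, k) \<in> E" using k by (auto simp: E_def)
        then show ?thesis by force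
      qed (use k in auto)
    next
      fix k assume "k \<in> {j \<in> {1..n}. j \<notin> Range y \<and> j \<notin> Domain z} \<union> snd ` E"
      then show "k \<in> {j \<in> {1..n}. j \<notin> Range (x O y) \<and> j \<notin> Domain z}"
      proof
        assume "k \<in> snd ` E"
        then obtain j where j: "(j, k) \<in> y" "j \<notin> Range x" "k \<notin> Domain z" by (auto simp: E_def)
        have "j' = j" if "(j', k) \<in> y" for j'
          using y j(1) that by (auto simp: rook_diagrams_def single_valued_def)
        then show ?thesis using j r by blast
      qed blast
    qed
    moreover have "{j \<in> {1..n}. j \<notin> Range y \<and> j \<notin> Domain z} \<inter> snd ` E = {}"
      by (auto simp: E_def)
    ultimately show ?thesis unfolding isolated_eq using fE i by (simp add: card_Un_disjoint card_image)
  qed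
  have 2: "isolated_middle n x (y O z) = isolated_middle n x y + card E"
  proof -
    have "{j \<in> {1..n}. j \<notin> Range x \<and> j \<notin> Domain (y O z)} =
      {j \<in> {1..n}. j \<notin> Range x \<and> j \<notin> Domain y} \<union> fst ` E" 
    proof (rule Set.set_eqI, rule iffI)
      fix j assume j: "j \<in> {j \<in> {1..n}. j \<notin> Range x \<and> j \<notin> Domain (y O z)}"
      show "j \<in> {j \<in> {1..n}. j \<notin> Range x \<and> j \<notin> Domain y} \<union> fst ` E"
      proof (cases "j \<in> Domain y")
        case True
        then obtain k where "(j, k) \<in> y" by blast
        then have "(j, k) \<in> E" using j by (auto simp: E_def)
        then show ?thesis by force
      qed (use j in auto)
    next
      fix j assume "j \<in> {j \<in> {1..n}. j \<notin> Range x \<and> j \<notin> Domain y} \<union> fst ` E"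
      then show "j \<in> {j \<in> {1..n}. j \<notin> Range x \<and> j \<notin> Domain (y O z)}"
      proof
        assume "j \<in> fst ` E"
        then obtain k where k: "(j, k) \<in> y" "j \<notin> Range x" "k \<notin> Domain z" by (auto simp: E_def)
        have "k' = k" if "(j, k') \<in> y" for k'
          using y k(1) that by (auto simp: rook_diagrams_def single_valued_def)
        then show ?thesis using k r by blast
      qed blast
    qed
    moreover have "{j \<in> {1..n}. j \<notin> Range x \<and> j \<notin> Domain y} \<inter> fst ` E = {}"
      by (auto simp: E_def)
    ultimately show ?thesis unfolding isolated_eq using fE i by (simp add: card_Un_disjoint card_image)
  qed
  show ?thesis using 1 2 by simp
qed

lemma rook_based:
  assumes "cring R" and e: "\<epsilon> \<in> carrier R"
  shows "based_algebra R (rook_diagrams n) (\<lambda>x y. \<epsilon> [^]\<^bsub>R\<^esub> isolated_middle n x y) rook_comp (Id_on {1..n})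
     (\<lambda>x. if Domain x = {1..n} \<and> Range x = {1..n} then \<one>\<^bsub>R\<^esub> else \<zero>\<^bsub>R\<^esub>)"
proof -
  interpret cring R by fact
  have Id: "Id_on {1..n} \<in> rook_diagrams n"
    by (auto simp: rook_diagrams_def single_valued_def)
  show ?thesis
  proof unfold_locales
    fix x assume x: "x \<in> rook_diagrams n"
    have sub: "x \<subseteq> {1..n} \<times> {1..n}" using x by (auto simp: rook_diagrams_def)
    have "Id_on {1..n} O x = x" "x O Id_on {1..n} = x" using sub by auto
    moreover have "isolated_middle n (Id_on {1..n}) x = 0" "isolated_middle n x (Id_on {1..n}) = 0"
      by (simp_all add: isolated_eq Range_Id_on)
    ultimately show "rook_comp (Id_on {1..n}) x = x \<and> rook_comp x (Id_on {1..n}) = x \<and>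
        \<epsilon> [^]\<^bsub>R\<^esub> isolated_middle n (Id_on {1..n}) x = \<one>\<^bsub>R\<^esub> \<and> \<epsilon> [^]\<^bsub>R\<^esub> isolated_middle n x (Id_on {1..n}) = \<one>\<^bsub>R\<^esub>"
      by (simp add: rook_comp_eq[OF x Id] rook_comp_eq[OF Id x] del: One_nat_def)
  next
    fix x y assume x: "x \<in> rook_diagrams n" and y: "y \<in> rook_diagrams n"
    let ?c = "\<lambda>x. if Domain x = {1..n} \<and> Range x = {1..n} then \<one>\<^bsub>R\<^esub> else \<zero>\<^bsub>R\<^esub>"
    have sub: "Range x \<subseteq> {1..n}" "Domain y \<subseteq> {1..n}" using x y by (auto simp: rook_diagrams_def)
    have O: "x O y \<in> rook_diagrams n" by (rule rook_O[OF x y])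
    have "isolated_middle n x y = 0" if "Domain x = {1..n}"
      using that rook_perfect[OF x] by (simp add: isolated_eq)
    moreover have "Domain (x O y) = {1..n} \<longleftrightarrow> Domain x = {1..n} \<and> Domain y = {1..n}"
    proof
      assume D: "Domain (x O y) = {1..n}"
      have "Domain (x O y) \<subseteq> Domain x" "Range (x O y) \<subseteq> Range y" by auto
      moreover have "Domain x \<subseteq> {1..n}" "Range y \<subseteq> {1..n}" using x y by (auto simp: rook_diagrams_def)
      ultimately show "Domain x = {1..n} \<and> Domain y = {1..n}"
        using D rook_perfect[OF O] rook_perfect[OF y] by blast
    next
      assume "Domain x = {1..n} \<and> Domain y = {1..n}"
      then show "Domain (x O y) = {1..n}"
        using rook_perfect[OF x] by (auto simp: set_eq_iff Domain_iff Range_iff relcomp_unfold) (metis atLeastAtMost_iff)+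
    qed
    ultimately show "\<epsilon> [^]\<^bsub>R\<^esub> isolated_middle n x y \<otimes>\<^bsub>R\<^esub> ?c (rook_comp x y) = ?c x \<otimes>\<^bsub>R\<^esub> ?c y"
      using rook_perfect[OF x] rook_perfect[OF y] rook_perfect[OF O] e
      by (cases "Domain x = {1..n}"; cases "Domain y = {1..n}") (simp_all add: rook_comp_eq[OF x y] del: One_nat_def)
  next
    fix x y z assume "x \<in> rook_diagrams n" "y \<in> rook_diagrams n" "z \<in> rook_diagrams n"
    then show "\<epsilon> [^]\<^bsub>R\<^esub> isolated_middle n x y \<otimes>\<^bsub>R\<^esub> \<epsilon> [^]\<^bsub>R\<^esub> isolated_middle n (rook_comp x y) z =
       \<epsilon> [^]\<^bsub>R\<^esub> isolated_middle n y z \<otimes>\<^bsub>R\<^esub> \<epsilon> [^]\<^bsub>R\<^esub> isolated_middle n x (rook_comp y z)"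
      using e isolated_middle_cocycle[of x n y z] by (simp add: rook_comp_eq[of _ n] nat_pow_mult)
  qed (use e Id in \<open>auto simp: rook_comp_eq[of _ n] rook_O O_assoc Domain_Id_on Range_Id_on\<close>)
qed

lemma trivial_group_modules:
  assumes "cring R"
  shows "right_module (group_algebra R (sym_group n)) (trivial_group_module R)"
    "left_module (group_algebra R (sym_group n)) (trivial_group_module R)"
proof -
  note b = group_based[OF assms sym_group_is_group[of n]]
  show "right_module (group_algebra R (sym_group n)) (trivial_group_module R)"
    using based_algebra.right_module_char[OF b]
    unfolding group_algebra_def trivial_group_module_def based_algebra.A_def[OF b] .
  show "left_module (group_algebra R (sym_group n)) (trivial_group_module R)"
    using based_algebra.left_module_char[OF b]
    unfolding group_algebra_def trivial_group_module_def based_algebra.A_def[OF b] .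
qed

lemma trivial_rook_modules:
  assumes "cring R" "\<epsilon> \<in> carrier R"
  shows "right_module (rook_algebra R n \<epsilon>) (trivial_rook_module R n)"
    "left_module (rook_algebra R n \<epsilon>) (trivial_rook_module R n)"
proof -
  note b = rook_based[OF assms, of n]
  show "right_module (rook_algebra R n \<epsilon>) (trivial_rook_module R n)"
    using based_algebra.right_module_char[OF b]
    unfolding rook_algebra_def trivial_rook_module_def based_algebra.A_def[OF b] .
  show "left_module (rook_algebra R n \<epsilon>) (trivial_rook_module R n)"
    using based_algebra.left_module_char[OF b]
    unfolding rook_algebra_def trivial_rook_module_def based_algebra.A_def[OF b] .
qed


end

theory Submission
  imports Defs
begin

text \<open>
  Sending a diagram in which every node has an edge to the corresponding permutation and all other diagrams to
  \<open>0\<close> is a surjective homomorphism from the rook algebra \<open>A\<close> to the group algebra \<open>B\<close>, through which \<open>A\<close> acts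
  on the trivial modules. As \<open>\<epsilon>\<close> is invertible, some \<open>f \<in> A\<close> is sent to \<open>1\<close> and annihilates the kernel under
  left multiplication. Hence multiplication by \<open>f\<close> induces a right \<open>A\<close>-linear section \<open>B \<rightarrow> A\<close>, so projective
  right \<open>B\<close>-modules remain projective over \<open>A\<close>, and a projective resolution of the trivial module over \<open>B\<close> is
  also one over \<open>A\<close>. Tensoring it with the trivial module gives the same complex over both algebras, and the
  homology does not depend on the resolution.
\<close>

section \<open>Homomorphisms\<close>

text \<open>The obvious section of the quotient map, a permutation to its diagram, is in general not
  right \<open>A\<close>-linear: a permutation diagram times a diagram with missing edges need not
  vanish. Multiplying it by \<open>f\<close> from the left repairs this. Then \<open>f a\<close>
  depends only on the image of \<open>a\<close>, and \<open>B\<close> becomes the right ideal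
  \<open>f A\<close>. The origin of \<open>f\<close> are the identity diagrams with one edge
  removed: such a diagram squares to \<epsilon> times itself, because one middle node is isolated,
  so the inverse of \<epsilon> turns it into an idempotent, and \<open>f\<close> is a product of
  complements of these. A formal obstacle shapes the rest. \<open>Tor\<close> uses a chosen
  resolution in a type that depends on the algebra, so the resolutions over \<open>A\<close> and
  \<open>B\<close> live in different types. Independence of the resolution is therefore proved
  across types. The tensor complexes over \<open>A\<close> and \<open>B\<close> coincide because the
  quotient map is onto: both algebras impose the same set of relations, so the tensor products are
  equal and not merely isomorphic.\<close>

lemma mod_homI:
  assumes "\<And>x. x \<in> carrier M \<Longrightarrow> f x \<in> carrier N"
    and "\<And>x y. \<lbrakk>x \<in> carrier M; y \<in> carrier M\<rbrakk> \<Longrightarrow> f (x \<oplus>\<^bsub>M\<^esub> y) = f x \<oplus>\<^bsub>N\<^esub> f y"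
    and "\<And>a x. \<lbrakk>a \<in> carrier A; x \<in> carrier M\<rbrakk> \<Longrightarrow> f (a \<odot>\<^bsub>M\<^esub> x) = a \<odot>\<^bsub>N\<^esub> f x"
  shows "f \<in> mod_hom A M N"
  using assms by (auto simp: mod_hom_def)

lemma mod_homD:
  assumes "f \<in> mod_hom A M N" "x \<in> carrier M"
  shows mod_hom_closed: "f x \<in> carrier N"
    and mod_hom_add: "y \<in> carrier M \<Longrightarrow> f (x \<oplus>\<^bsub>M\<^esub> y) = f x \<oplus>\<^bsub>N\<^esub> f y"
    and mod_hom_smult: "a \<in> carrier A \<Longrightarrow> f (a \<odot>\<^bsub>M\<^esub> x) = a \<odot>\<^bsub>N\<^esub> f x"
  using assms by (auto simp: mod_hom_def)

lemma mod_hom_abelian_group_hom: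
  assumes "right_module A M" "right_module A N" "f \<in> mod_hom A M N"
  shows "abelian_group_hom M N f"
proof -
  interpret M: right_module A M by fact
  interpret N: right_module A N by fact
  show ?thesis
    using assms(3) by unfold_locales (auto simp: hom_def mod_hom_def)
qed

lemma mod_hom_zero:
  assumes "right_module A M" "right_module A N" "f \<in> mod_hom A M N"
  shows "f \<zero>\<^bsub>M\<^esub> = \<zero>\<^bsub>N\<^esub>"
  using abelian_group_hom.hom_zero[OF mod_hom_abelian_group_hom[OF assms]] .

lemma mod_hom_minus:
  assumes "right_module A M" "right_module A N" "f \<in> mod_hom A M N" "x \<in> carrier M" "y \<in> carrier M"
  shows "f (x \<ominus>\<^bsub>M\<^esub> y) = f x \<ominus>\<^bsub>N\<^esub> f y"
proof -
  interpret abelian_group_hom M N f by (rule mod_hom_abelian_group_hom) fact+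
  show ?thesis using assms(4,5) by (simp add: a_minus_def)
qed

context right_module
begin

lemma diff_eq_zero_iff: "\<lbrakk>x \<in> carrier M; y \<in> carrier M\<rbrakk> \<Longrightarrow> x \<ominus>\<^bsub>M\<^esub> y = \<zero>\<^bsub>M\<^esub> \<longleftrightarrow> x = y"
  using M.minus_equality[of x "\<ominus>\<^bsub>M\<^esub> y"] by (auto simp: a_minus_def M.r_neg)

lemma smult_uminus: "\<lbrakk>a \<in> carrier A; x \<in> carrier M\<rbrakk> \<Longrightarrow> a \<odot>\<^bsub>M\<^esub> (\<ominus>\<^bsub>M\<^esub> x) = \<ominus>\<^bsub>M\<^esub> (a \<odot>\<^bsub>M\<^esub> x)"
  by (rule M.minus_equality[symmetric]) (simp_all flip: smult_r_distr add: M.l_neg)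

lemma smult_minus: "\<lbrakk>a \<in> carrier A; x \<in> carrier M; y \<in> carrier M\<rbrakk> \<Longrightarrow>
    a \<odot>\<^bsub>M\<^esub> (x \<ominus>\<^bsub>M\<^esub> y) = a \<odot>\<^bsub>M\<^esub> x \<ominus>\<^bsub>M\<^esub> a \<odot>\<^bsub>M\<^esub> y"
  by (simp add: a_minus_def smult_r_distr smult_uminus)

end

context
  fixes A :: "('a, 'c) ring_scheme" and M :: "('a, 'm) module"
  assumes right_module: "right_module A M"
begin

interpretation right_module A M by (rule right_module)

lemma mod_hom_id: "(\<lambda>x. x) \<in> mod_hom A M M"
  by (rule mod_homI) auto

lemma mod_hom_plus:
  assumes "f \<in> mod_hom A L M" "g \<in> mod_hom A L M"
  shows "(\<lambda>x. f x \<oplus>\<^bsub>M\<^esub> g x) \<in> mod_hom A L M"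
  using assms by (intro mod_homI) (auto simp: mod_homD smult_r_distr M.add.m_ac)

lemma mod_hom_diff:
  assumes "f \<in> mod_hom A L M" "g \<in> mod_hom A L M"
  shows "(\<lambda>x. f x \<ominus>\<^bsub>M\<^esub> g x) \<in> mod_hom A L M"
  using assms
  by (intro mod_homI) (auto simp: mod_homD smult_minus a_minus_def M.minus_add M.add.m_ac smult_r_distr smult_uminus)

lemma mod_hom_const_zero: "(\<lambda>_. \<zero>\<^bsub>M\<^esub>) \<in> mod_hom A L M"
  by (rule mod_homI) auto

text \<open>Since -x = (-1) x, closure under the action yields the closure under negation that
  \<open>subgroup\<close> asks for.\<close>

lemma submoduleI:
  assumes "H \<subseteq> carrier M" "\<zero>\<^bsub>M\<^esub> \<in> H" "\<And>x y. \<lbrakk>x \<in> H; y \<in> H\<rbrakk> \<Longrightarrow> x \<oplus>\<^bsub>M\<^esub> y \<in> H"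
    and smult: "\<And>a x. \<lbrakk>a \<in> carrier A; x \<in> H\<rbrakk> \<Longrightarrow> a \<odot>\<^bsub>M\<^esub> x \<in> H"
  shows "submodule H A M"
proof (intro submodule.intro subgroup.intro)
  fix x assume x: "x \<in> H"
  have "\<ominus>\<^bsub>M\<^esub> x = (\<ominus>\<^bsub>A\<^esub> \<one>\<^bsub>A\<^esub>) \<odot>\<^bsub>M\<^esub> x"
    using x assms(1)
    by (intro M.minus_equality) (auto simp: A.l_neg subset_iff smult_l_distr[of _ "\<one>\<^bsub>A\<^esub>" x, simplified, symmetric])
  then show "inv\<^bsub>add_monoid M\<^esub> x \<in> H"
    using smult[OF _ x, of "\<ominus>\<^bsub>A\<^esub> \<one>\<^bsub>A\<^esub>"] by (simp add: a_inv_def)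
qed (use assms in \<open>auto simp: submodule_axioms_def\<close>)

lemma submodule_kernel:
  assumes "right_module A N" "f \<in> mod_hom A M N"
  shows "submodule {x \<in> carrier M. f x = \<zero>\<^bsub>N\<^esub>} A M"
proof -
  interpret N: right_module A N by fact
  show ?thesis
    using assms(2) mod_hom_zero[OF right_module assms]
    by (intro submoduleI) (auto simp: mod_homD)
qed

lemma submodule_image:
  assumes "right_module A L" "f \<in> mod_hom A L M"
  shows "submodule (f ` carrier L) A M"
proof -
  interpret L: right_module A L by fact
  show ?thesis
  proof (rule submoduleI)
    show "\<zero>\<^bsub>M\<^esub> \<in> f ` carrier L"
      using mod_hom_zero[OF assms(1) right_module assms(2)] by (metis L.M.zero_closed imageI)
  qed (auto simp: mod_hom_closed[OF assms(2)] simp flip: mod_hom_add[OF assms(2)] mod_hom_smult[OF assms(2)])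
qed

end

lemma submoduleD:
  assumes "submodule H A M"
  shows submodule_subset: "H \<subseteq> carrier M" and submodule_zero: "\<zero>\<^bsub>M\<^esub> \<in> H"
    and submodule_add: "\<lbrakk>x \<in> H; y \<in> H\<rbrakk> \<Longrightarrow> x \<oplus>\<^bsub>M\<^esub> y \<in> H"
    and submodule_uminus: "x \<in> H \<Longrightarrow> \<ominus>\<^bsub>M\<^esub> x \<in> H"
    and submodule_smult: "\<lbrakk>a \<in> carrier A; x \<in> H\<rbrakk> \<Longrightarrow> a \<odot>\<^bsub>M\<^esub> x \<in> H"
proof -
  interpret submodule H A M by fact
  show "H \<subseteq> carrier M" "\<zero>\<^bsub>M\<^esub> \<in> H" "\<lbrakk>x \<in> H; y \<in> H\<rbrakk> \<Longrightarrow> x \<oplus>\<^bsub>M\<^esub> y \<in> H" "x \<in> H \<Longrightarrow> \<ominus>\<^bsub>M\<^esub> x \<in> H"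
    "\<lbrakk>a \<in> carrier A; x \<in> H\<rbrakk> \<Longrightarrow> a \<odot>\<^bsub>M\<^esub> x \<in> H"
    using subset one_closed m_closed[of x y] m_inv_closed[of x] by (auto simp: a_inv_def)
qed

text \<open>\<open>homology\<close> is a quotient of the cycles, which enter as a record with a
  smaller carrier; this makes that record a module.\<close>

lemma right_module_submodule:
  assumes "right_module A M" "submodule H A M"
  shows "right_module A (M\<lparr>carrier := H\<rparr>)"
proof -
  interpret right_module A M by fact
  note H = submoduleD[OF assms(2)]
  show ?thesis
  proof (rule right_moduleI)
    show "abelian_group (M\<lparr>carrier := H\<rparr>)"
    proof (rule abelian_groupI)
      fix x assume "x \<in> carrier (M\<lparr>carrier := H\<rparr>)"
      then show "\<exists>y\<in>carrier (M\<lparr>carrier := H\<rparr>). y \<oplus>\<^bsub>M\<lparr>carrier := H\<rparr>\<^esub> x = \<zero>\<^bsub>M\<lparr>carrier := H\<rparr>\<^esub>"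
        using H by (auto intro!: bexI[of _ "\<ominus>\<^bsub>M\<^esub> x"] simp: subset_iff M.l_neg)
    qed (use H in \<open>auto simp: subset_iff M.add.m_ac\<close>)
  qed (use H in \<open>auto simp: subset_iff smult_l_distr smult_r_distr smult_assoc intro: A.ring_axioms\<close>)
qed


section \<open>Free modules\<close>

text \<open>The scalar stands to the right of the basis element because the ring need not be
  commutative and \<open>free_module\<close> is a right module.\<close>

lemma (in ring) fin_supp_induct [consumes 1, case_names zero add]:
  assumes f: "f \<in> fin_supp R X" and z: "P (\<lambda>_. \<zero>)"
    and step: "\<And>x r g. \<lbrakk>x \<in> X; r \<in> carrier R; g \<in> fin_supp R X; P g\<rbrakk> \<Longrightarrow>
      P (\<lambda>y. g y \<oplus> basis_elt R x y \<otimes> r)"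
  shows "P f"
proof -
  have "P f" if "finite S" "f \<in> fin_supp R X" "{x. f x \<noteq> \<zero>} \<subseteq> S" for S f
    using that
  proof (induction S arbitrary: f rule: finite_induct)
    case empty
    then have "f = (\<lambda>_. \<zero>)" by auto
    then show ?case using z by simp
  next
    case (insert x S)
    show ?case
    proof (cases "x \<in> X")
      case True
      define g where "g = (\<lambda>y. if y = x then \<zero> else f y)"
      have "{y. g y \<noteq> \<zero>} \<subseteq> {y. f y \<noteq> \<zero>}" by (auto simp: g_def)
      then have g: "g \<in> fin_supp R X" "{y. g y \<noteq> \<zero>} \<subseteq> S"
        using insert.prems by (auto simp: fin_supp_def g_def intro: finite_subset)
      have "f = (\<lambda>y. g y \<oplus> basis_elt R x y \<otimes> f x)"
        using fin_supp_closed[OF insert.prems(1)] by (auto simp: g_def basis_elt_def fun_eq_iff)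
      moreover have "P (\<lambda>y. g y \<oplus> basis_elt R x y \<otimes> f x)"
        using fin_supp_closed[OF insert.prems(1)] g True by (intro step insert.IH) auto
      ultimately show ?thesis by simp
    next
      \<comment> \<open>Since \<open>f\<close> vanishes outside \<open>X\<close>, the point
        \<open>x\<close> is not in its support.\<close>
      case False
      then have "{y. f y \<noteq> \<zero>} \<subseteq> S"
        using insert.prems by (auto simp: fin_supp_def)
      then show ?thesis using insert by blast
    qed
  qed
  then show ?thesis using f by (auto simp: fin_supp_def)
qed

lemma free_module_simps:
  "carrier (free_module A X) = fin_supp A X" "\<zero>\<^bsub>free_module A X\<^esub> = (\<lambda>_. \<zero>\<^bsub>A\<^esub>)"
  "f \<oplus>\<^bsub>free_module A X\<^esub> g = (\<lambda>x. f x \<oplus>\<^bsub>A\<^esub> g x)" "a \<odot>\<^bsub>free_module A X\<^esub> f = (\<lambda>x. f x \<otimes>\<^bsub>A\<^esub> a)"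
  by (simp_all add: free_module_def)

text \<open>Uniqueness half of the universal property of free modules; \<open>lin_hom\<close> and
  \<open>lin_basis_elt\<close> supply the existence half.\<close>

lemma free_module_hom_eq:
  assumes N: "right_module A N"
    and f: "f \<in> mod_hom A (free_module A X) N" and g: "g \<in> mod_hom A (free_module A X) N"
    and eq: "\<And>x. x \<in> X \<Longrightarrow> f (basis_elt A x) = g (basis_elt A x)"
    and u: "u \<in> fin_supp A X"
  shows "f u = g u"
proof -
  interpret N: right_module A N by fact
  note F = N.A.right_module_free_module[of X]
  interpret F: right_module A "free_module A X" by fact
  show ?thesis using u
  proof (induction rule: N.A.fin_supp_induct)
    case zero
    show ?case using mod_hom_zero[OF F N f] mod_hom_zero[OF F N g] by (simp add: free_module_simps)
  next
    case (add x r h)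
    have c: "h \<in> carrier (free_module A X)" "basis_elt A x \<in> carrier (free_module A X)"
      using add by (auto simp: free_module_simps(1) N.A.basis_elt_fin_supp)
    moreover have "r \<odot>\<^bsub>free_module A X\<^esub> basis_elt A x \<in> carrier (free_module A X)"
      using add c by simp
    moreover have "(\<lambda>y. h y \<oplus>\<^bsub>A\<^esub> basis_elt A x y \<otimes>\<^bsub>A\<^esub> r) =
        h \<oplus>\<^bsub>free_module A X\<^esub> r \<odot>\<^bsub>free_module A X\<^esub> basis_elt A x"
      by (simp add: free_module_simps)
    ultimately show ?case
      using add f g by (simp add: mod_homD eq)
  qed
qed

lemma lin_hom:
  assumes M: "right_module A M" and "g \<in> X \<rightarrow> carrier M"
  shows "lin M \<zero>\<^bsub>A\<^esub> g \<in> mod_hom A (free_module A X) M"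
proof -
  interpret right_module A M by fact
  show ?thesis
    by (rule mod_homI) (simp_all add: free_module_simps lin_closed[OF _ assms(2)] lin_add[OF assms(2)] lin_smult[OF assms(2)])
qed

context ring
begin

text \<open>The index set in \<open>free_map\<close> varies with the function and the point. One
  finite set \<open>S\<close>, with zero terms off the fibre, lets sums be added and scaled
  termwise.\<close>

lemma free_map_eq:
  assumes f: "f \<in> fin_supp R X" and S: "finite S" "{x. f x \<noteq> \<zero>} \<subseteq> S"
  shows "free_map R g f y = (\<Oplus>x\<in>S. if g x = y then f x else \<zero>)"
  unfolding free_map_def using S
  by (intro add.finprod_mono_neutral_cong_left) (auto simp: fin_supp_closed[OF f])

lemma free_map_hom:
  assumes g: "g \<in> X \<rightarrow> Y"
  shows "free_map R g \<in> mod_hom R (free_module R X) (free_module R Y)"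
proof (rule mod_homI; unfold free_module_simps)
  fix f assume f: "f \<in> fin_supp R X"
  let ?S = "{x. f x \<noteq> \<zero>}"
  have S: "finite ?S" "?S \<subseteq> X" using f by (auto simp: fin_supp_def)
  note e = free_map_eq[OF f S(1) subset_refl]
  have z: "free_map R g f y = \<zero>" if "y \<notin> g ` ?S" for y
    unfolding e using that by (intro add.finprod_one_eqI) auto
  then have "{y. free_map R g f y \<noteq> \<zero>} \<subseteq> g ` ?S" by blast
  moreover have "g ` ?S \<subseteq> Y" using S g by auto
  moreover have "free_map R g f y \<in> carrier R" for y
    unfolding e by (intro finsum_closed) (auto simp: fin_supp_closed[OF f])
  ultimately show "free_map R g f \<in> fin_supp R Y"
    unfolding fin_supp_def using z S(1) by (blast intro: finite_subset)
  {
    fix a assume a: "a \<in> carrier R"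
    show "free_map R g (\<lambda>x. f x \<otimes> a) = (\<lambda>y. free_map R g f y \<otimes> a)"
    proof
      fix y
      have "free_map R g (\<lambda>x. f x \<otimes> a) y = (\<Oplus>x\<in>?S. if g x = y then f x \<otimes> a else \<zero>)"
        using a by (intro free_map_eq[OF fin_supp_smult[OF f a]] S) auto
      also have "\<dots> = (\<Oplus>x\<in>?S. (if g x = y then f x else \<zero>) \<otimes> a)"
        using a by (intro finsum_cong') (auto simp: fin_supp_closed[OF f])
      also have "\<dots> = free_map R g f y \<otimes> a"
        unfolding e using S a by (intro finsum_ldistr[symmetric]) (auto simp: fin_supp_closed[OF f])
      finally show "free_map R g (\<lambda>x. f x \<otimes> a) y = free_map R g f y \<otimes> a" .
    qed
  }
  fix h assume h: "h \<in> fin_supp R X"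
  let ?T = "?S \<union> {x. h x \<noteq> \<zero>}"
  have T: "finite ?T" "{x. f x \<oplus> h x \<noteq> \<zero>} \<subseteq> ?T" using S h by (auto simp: fin_supp_def)
  show "free_map R g (\<lambda>x. f x \<oplus> h x) = (\<lambda>y. free_map R g f y \<oplus> free_map R g h y)"
  proof
    fix y
    have "free_map R g (\<lambda>x. f x \<oplus> h x) y = (\<Oplus>x\<in>?T. if g x = y then f x \<oplus> h x else \<zero>)"
      by (intro free_map_eq[OF fin_supp_add[OF f h]] T)
    also have "\<dots> = (\<Oplus>x\<in>?T. (if g x = y then f x else \<zero>) \<oplus> (if g x = y then h x else \<zero>))"
      by (intro finsum_cong') (auto simp: fin_supp_closed[OF f] fin_supp_closed[OF h])
    also have "\<dots> = free_map R g f y \<oplus> free_map R g h y"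
      unfolding free_map_eq[OF f T(1) Un_upper1] free_map_eq[OF h T(1) Un_upper2]
      by (intro finsum_addf) (auto simp: fin_supp_closed[OF f] fin_supp_closed[OF h])
    finally show "free_map R g (\<lambda>x. f x \<oplus> h x) y = free_map R g f y \<oplus> free_map R g h y" .
  qed
qed

lemma free_map_basis_elt: "free_map R g (basis_elt R x) = basis_elt R (g x)"
proof
  fix y
  have "free_map R g (basis_elt R x) y = (\<Oplus>z\<in>{x}. if g z = y then basis_elt R x z else \<zero>)"
    by (rule free_map_eq[of _ UNIV]) (auto simp: basis_elt_fin_supp, auto simp: basis_elt_def split: if_splits)
  then show "free_map R g (basis_elt R x) y = basis_elt R (g x) y"
    by (auto simp: basis_elt_def)
qed

end


section \<open>Quotient modules\<close>

lemma submodule_preimage: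
  assumes "right_module A M" "right_module A N" "f \<in> mod_hom A M N" "submodule H A N"
  shows "submodule {x \<in> carrier M. f x \<in> H} A M"
proof -
  interpret right_module A M by fact
  show ?thesis
    using submoduleD[OF assms(4)] mod_hom_zero[OF assms(1-3)]
    by (intro submoduleI[OF assms(1)]) (auto simp: mod_homD[OF assms(3)])
qed

locale quotient_module = right_module A M
  for A :: "('a, 'c) ring_scheme" and M :: "('a, 'm) module" +
  fixes H :: "'m set"
  assumes submodule: "submodule H A M"
begin

lemma right_module: "right_module A M" ..

sublocale H: abelian_subgroup H M
  by (rule abelian_subgroupI3[OF additive_subgroupI M.abelian_group_axioms])
    (rule submodule.axioms(1)[OF submodule])

abbreviation "proj x \<equiv> H +>\<^bsub>M\<^esub> x"
abbreviation "Q \<equiv> quot_module M H"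

lemma mem_coset_iff: "x \<in> carrier M \<Longrightarrow> y \<in> proj x \<longleftrightarrow> y \<in> carrier M \<and> y \<ominus>\<^bsub>M\<^esub> x \<in> H"
  using H.a_rcos_module[of x y] H.a_elemrcos_carrier[of x y] by (auto simp: a_minus_def)

lemma proj_eq_iff:
  assumes x: "x \<in> carrier M" and y: "y \<in> carrier M"
  shows "proj x = proj y \<longleftrightarrow> x \<ominus>\<^bsub>M\<^esub> y \<in> H"
proof -
  have "x \<in> proj y" if "proj x = proj y" using H.a_rcos_self[OF x] that by blast
  moreover have "proj x = proj y" if "x \<in> proj y"
    by (rule M.a_repr_independence[OF that y H.a_subgroup, symmetric])
  ultimately show ?thesis using mem_coset_iff[OF y, of x] x by blast
qed

text \<open>\<open>quot_module\<close> and \<open>tensor_map\<close> define values on a coset as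
  unions over its representatives. Cosets are nonempty, so such a union collapses to the common
  value.\<close>

lemma Union_coset:
  assumes "x \<in> carrier M" "\<And>y. \<lbrakk>y \<in> carrier M; y \<ominus>\<^bsub>M\<^esub> x \<in> H\<rbrakk> \<Longrightarrow> F y = F x"
  shows "(\<Union>y\<in>proj x. F y) = F x"
proof -
  have "(\<Union>y\<in>proj x. F y) = (\<Union>y\<in>proj x. F x)"
    using mem_coset_iff[OF assms(1)] assms(2) by (intro SUP_cong refl) blast
  also have "\<dots> = F x" using H.a_rcos_self[OF assms(1)] by blast
  finally show ?thesis .
qed

lemma carrier_Q: "carrier Q = proj ` carrier M"
  by (auto simp: quot_module_def A_RCOSETS_def')

lemma zero_Q: "\<zero>\<^bsub>Q\<^esub> = proj \<zero>\<^bsub>M\<^esub>"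
  using M.a_coset_join2[OF M.zero_closed H.a_subgroup H.zero_closed] by (simp add: quot_module_def)

lemma add_Q: "\<lbrakk>x \<in> carrier M; y \<in> carrier M\<rbrakk> \<Longrightarrow> proj x \<oplus>\<^bsub>Q\<^esub> proj y = proj (x \<oplus>\<^bsub>M\<^esub> y)"
  by (simp add: quot_module_def H.a_rcos_sum)

lemma smult_Q:
  assumes "a \<in> carrier A" "x \<in> carrier M"
  shows "a \<odot>\<^bsub>Q\<^esub> proj x = proj (a \<odot>\<^bsub>M\<^esub> x)"
proof -
  have "(\<Union>y\<in>proj x. proj (a \<odot>\<^bsub>M\<^esub> y)) = proj (a \<odot>\<^bsub>M\<^esub> x)"
    using assms submodule_smult[OF submodule assms(1)]
    by (intro Union_coset) (auto simp: proj_eq_iff simp flip: smult_minus)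
  then show ?thesis by (simp add: quot_module_def)
qed

lemma right_module_Q: "right_module A Q"
proof (rule right_moduleI)
  show "abelian_group Q"
  proof (rule abelian_groupI)
    fix X assume "X \<in> carrier Q"
    then obtain x where "x \<in> carrier M" "X = proj x" by (auto simp: carrier_Q)
    then show "\<exists>Y\<in>carrier Q. Y \<oplus>\<^bsub>Q\<^esub> X = \<zero>\<^bsub>Q\<^esub>"
      by (intro bexI[of _ "proj (\<ominus>\<^bsub>M\<^esub> x)"]) (auto simp: carrier_Q zero_Q add_Q M.l_neg)
  qed (auto simp: carrier_Q zero_Q add_Q M.add.m_ac)
qed (auto simp: carrier_Q add_Q smult_Q smult_l_distr smult_r_distr smult_assoc intro: A.ring_axioms)

lemma proj_hom: "proj \<in> mod_hom A M Q"
  by (rule mod_homI) (auto simp: carrier_Q add_Q smult_Q)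

lemma proj_eq_zero_iff: "x \<in> carrier M \<Longrightarrow> proj x = \<zero>\<^bsub>Q\<^esub> \<longleftrightarrow> x \<in> H"
proof -
  have "\<ominus>\<^bsub>M\<^esub> \<zero>\<^bsub>M\<^esub> = \<zero>\<^bsub>M\<^esub>" by (rule M.minus_equality) simp_all
  then have "x \<ominus>\<^bsub>M\<^esub> \<zero>\<^bsub>M\<^esub> = x" if "x \<in> carrier M" using that by (simp only: a_minus_def M.r_zero)
  then show "x \<in> carrier M \<Longrightarrow> ?thesis" by (simp add: zero_Q proj_eq_iff)
qed

text \<open>First isomorphism theorem; the isomorphism evaluates \<open>g\<close> at a chosen
  representative of the coset.\<close>

lemma quotient_iso:
  assumes N: "right_module A N" and g: "g \<in> mod_hom A M N" and onto: "carrier N \<subseteq> g ` carrier M"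
    and ker: "\<And>x. x \<in> carrier M \<Longrightarrow> g x = \<zero>\<^bsub>N\<^esub> \<longleftrightarrow> x \<in> H"
  shows "mod_iso A Q N"
proof -
  interpret N: right_module A N by fact
  have eq: "g x = g y \<longleftrightarrow> x \<ominus>\<^bsub>M\<^esub> y \<in> H" if "x \<in> carrier M" "y \<in> carrier M" for x y
    using that ker[of "x \<ominus>\<^bsub>M\<^esub> y"] mod_hom_minus[OF right_module N g that] mod_hom_closed[OF g]
    by (simp add: N.diff_eq_zero_iff)
  define f where "f X = g (SOME x. x \<in> X)" for X
  have f: "f (proj x) = g x" if x: "x \<in> carrier M" for x
  proof -
    have "(SOME y. y \<in> proj x) \<in> proj x" using H.a_rcos_self[OF x] by (rule someI)
    then show ?thesis using x by (simp add: f_def eq mem_coset_iff)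
  qed
  have "f \<in> mod_hom A Q N"
    by (rule mod_homI) (auto simp: carrier_Q add_Q smult_Q f mod_homD[OF g])
  moreover have "inj_on f (carrier Q)"
  proof (rule inj_onI)
    fix X Y assume "X \<in> carrier Q" "Y \<in> carrier Q"
    then obtain x y where "x \<in> carrier M" "X = proj x" "y \<in> carrier M" "Y = proj y"
      by (auto simp: carrier_Q)
    then show "f X = f Y \<Longrightarrow> X = Y" by (simp add: f eq proj_eq_iff)
  qed
  moreover have "f ` carrier Q = carrier N"
    using onto mod_hom_closed[OF g] by (auto simp: carrier_Q image_image f image_iff)
  ultimately show ?thesis unfolding mod_iso_def bij_betw_def by blast
qed

text \<open>Functoriality of quotients. The induced map is written in the shape of
  \<open>tensor_map\<close>, to which it is applied.\<close>

lemma quotient_map: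
  assumes "quotient_module A M' H'" and g: "g \<in> mod_hom A M M'" and "g ` H \<subseteq> H'"
  shows quotient_map_proj: "x \<in> carrier M \<Longrightarrow> (\<Union>u\<in>proj x. H' +>\<^bsub>M'\<^esub> g u) = H' +>\<^bsub>M'\<^esub> g x"
    and quotient_map_hom: "(\<lambda>X. \<Union>u\<in>X. H' +>\<^bsub>M'\<^esub> g u) \<in> mod_hom A Q (quot_module M' H')"
proof -
  interpret M': quotient_module A M' H' by fact
  show *: "(\<Union>u\<in>proj x. H' +>\<^bsub>M'\<^esub> g u) = H' +>\<^bsub>M'\<^esub> g x" if "x \<in> carrier M" for x
    using that assms(3)
    by (intro Union_coset)
      (auto simp: M'.proj_eq_iff mod_hom_closed[OF g] simp flip: mod_hom_minus[OF right_module M'.right_module g])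
  show "(\<lambda>X. \<Union>u\<in>X. H' +>\<^bsub>M'\<^esub> g u) \<in> mod_hom A Q M'.Q"
  proof (rule mod_homI)
    fix X assume "X \<in> carrier Q"
    then obtain x where x: "x \<in> carrier M" "X = proj x" by (auto simp: carrier_Q)
    note gx = mod_hom_closed[OF g x(1)]
    show "(\<Union>u\<in>X. M'.proj (g u)) \<in> carrier M'.Q"
      using x gx * by (auto simp: M'.carrier_Q)
    show "(\<Union>u\<in>a \<odot>\<^bsub>Q\<^esub> X. M'.proj (g u)) = a \<odot>\<^bsub>M'.Q\<^esub> (\<Union>u\<in>X. M'.proj (g u))"
      if "a \<in> carrier A" for a
      using that x gx by (simp add: * smult_Q M'.smult_Q mod_hom_smult[OF g])
    fix Y assume "Y \<in> carrier Q"
    then obtain y where y: "y \<in> carrier M" "Y = proj y" by (auto simp: carrier_Q)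
    show "(\<Union>u\<in>X \<oplus>\<^bsub>Q\<^esub> Y. M'.proj (g u)) = (\<Union>u\<in>X. M'.proj (g u)) \<oplus>\<^bsub>M'.Q\<^esub> (\<Union>u\<in>Y. M'.proj (g u))"
      using x y gx mod_hom_closed[OF g y(1)] by (simp add: * add_Q M'.add_Q mod_hom_add[OF g])
  qed
qed

end


section \<open>Tensor products\<close>

text \<open>Tensoring with \<open>N\<close> over \<open>A\<close>, seen as a functor from right
  \<open>A\<close>-modules to \<open>R\<close>-modules. \<open>scalar_closed\<close> keeps the
  relations that involve multiples of the unit of \<open>A\<close> inside the free module.\<close>

locale tensor_functor = cring R + N: left_module A N
  for R :: "('r, 'c) ring_scheme" and A :: "('r, 'a, 'd) module_scheme" and N :: "('a, 'n) module" +
  assumes scalar_closed: "r \<in> carrier R \<Longrightarrow> r \<odot>\<^bsub>A\<^esub> \<one>\<^bsub>A\<^esub> \<in> carrier A"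
begin

abbreviation "F M \<equiv> free_module R (carrier M \<times> carrier N)"
abbreviation "T M \<equiv> tensor_product R A M N"
abbreviation "rels M \<equiv> tensor_rels R A M N"
abbreviation "b \<equiv> basis_elt R"
abbreviation "pure M p n \<equiv> rels M +>\<^bsub>F M\<^esub> b (p, n)"
abbreviation "tmap M f \<equiv> tensor_map R A M N f"

lemma b_closed: "\<lbrakk>p \<in> carrier M; n \<in> carrier N\<rbrakk> \<Longrightarrow> b (p, n) \<in> carrier (F M)"
  by (simp add: free_module_simps basis_elt_fin_supp)

lemma tensor_gen_rels_cases:
  assumes "x \<in> tensor_gen_rels R A M N"
  obtains
    (add_left) p q n where "p \<in> carrier M" "q \<in> carrier M" "n \<in> carrier N"
      "x = b (p \<oplus>\<^bsub>M\<^esub> q, n) \<ominus>\<^bsub>F M\<^esub> (b (p, n) \<oplus>\<^bsub>F M\<^esub> b (q, n))"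
  | (add_right) p m n where "p \<in> carrier M" "m \<in> carrier N" "n \<in> carrier N"
      "x = b (p, m \<oplus>\<^bsub>N\<^esub> n) \<ominus>\<^bsub>F M\<^esub> (b (p, m) \<oplus>\<^bsub>F M\<^esub> b (p, n))"
  | (balanced) p a n where "p \<in> carrier M" "a \<in> carrier A" "n \<in> carrier N"
      "x = b (a \<odot>\<^bsub>M\<^esub> p, n) \<ominus>\<^bsub>F M\<^esub> b (p, a \<odot>\<^bsub>N\<^esub> n)"
  | (scalar) p r n where "p \<in> carrier M" "r \<in> carrier R" "n \<in> carrier N"
      "x = b ((r \<odot>\<^bsub>A\<^esub> \<one>\<^bsub>A\<^esub>) \<odot>\<^bsub>M\<^esub> p, n) \<ominus>\<^bsub>F M\<^esub> r \<odot>\<^bsub>F M\<^esub> b (p, n)"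
  using assms unfolding tensor_gen_rels_def Let_def Un_iff mem_Collect_eq
  by (elim disjE exE conjE)
    ((rule add_left; assumption), (rule add_right; assumption), (rule balanced; assumption), (rule scalar; assumption))

lemma tensor_gen_rels_closed:
  assumes "right_module A M" shows "tensor_gen_rels R A M N \<subseteq> carrier (F M)"
proof
  interpret M: right_module A M by fact
  interpret F: right_module R "F M" by (rule right_module_free_module)
  fix x assume "x \<in> tensor_gen_rels R A M N"
  then show "x \<in> carrier (F M)"
    by (cases rule: tensor_gen_rels_cases) (auto intro!: F.M.minus_closed F.M.a_closed F.smult_closed b_closed simp: scalar_closed)
qed

lemma submodule_tensor_rels:
  assumes "right_module A M" shows "submodule (rels M) R (F M)"
proof -
  interpret F: right_module R "F M" by (rule right_module_free_module)
  let ?S = "{H. submodule H R (F M) \<and> tensor_gen_rels R A M N \<subseteq> H}"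
  \<comment> \<open>The whole free module belongs to the family, so the intersection is not over an
    empty family and stays inside the carrier.\<close>
  have "submodule (carrier (F M)) R (F M)" by (rule submoduleI[OF right_module_free_module]) auto
  then have "carrier (F M) \<in> ?S" using tensor_gen_rels_closed[OF assms] by simp
  then have "\<Inter> ?S \<subseteq> carrier (F M)" by blast
  then show ?thesis
    unfolding tensor_rels_def
    by (rule submoduleI[OF right_module_free_module]) (blast intro: submodule_zero submodule_add submodule_smult)+
qed

lemma tensor_gen_rels_subset: "tensor_gen_rels R A M N \<subseteq> rels M"
  unfolding tensor_rels_def by blast

lemma tensor_rels_least: "\<lbrakk>submodule H R (F M); tensor_gen_rels R A M N \<subseteq> H\<rbrakk> \<Longrightarrow> rels M \<subseteq> H"
  unfolding tensor_rels_def by blast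

lemma quotient_module_T: "right_module A M \<Longrightarrow> quotient_module R (F M) (rels M)"
  by (intro quotient_module.intro quotient_module_axioms.intro right_module_free_module submodule_tensor_rels)

lemma right_module_T: "right_module A M \<Longrightarrow> right_module R (T M)"
  unfolding tensor_product_def by (rule quotient_module.right_module_Q[OF quotient_module_T])

lemma pure_add:
  assumes "right_module A M" "p \<in> carrier M" "q \<in> carrier M" "n \<in> carrier N"
  shows "pure M (p \<oplus>\<^bsub>M\<^esub> q) n = pure M p n \<oplus>\<^bsub>T M\<^esub> pure M q n"
proof -
  interpret M: right_module A M by fact
  interpret quotient_module R "F M" "rels M" by (rule quotient_module_T) fact
  note c = b_closed[of _ M, OF _ assms(4)] assms(2,3)
  have "b (p \<oplus>\<^bsub>M\<^esub> q, n) \<ominus>\<^bsub>F M\<^esub> (b (p, n) \<oplus>\<^bsub>F M\<^esub> b (q, n)) \<in> tensor_gen_rels R A M N"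
    unfolding tensor_gen_rels_def Let_def using assms(2-4) by blast
  then have "pure M (p \<oplus>\<^bsub>M\<^esub> q) n = proj (b (p, n) \<oplus>\<^bsub>F M\<^esub> b (q, n))"
    using tensor_gen_rels_subset[of M] c
    by (intro iffD2[OF proj_eq_iff]) (auto intro!: c M.a_closed M.add.m_closed simp del: free_module_simps)
  then show ?thesis using c by (simp add: tensor_product_def add_Q)
qed

text \<open>Pure tensors generate: after composition with \<open>proj\<close> both maps start at a
  free module and are compared on its basis. The functor laws below all reduce to pure tensors in
  this way.\<close>

lemma tensor_hom_eq:
  assumes "right_module A M" "right_module R L" "f \<in> mod_hom R (T M) L" "g \<in> mod_hom R (T M) L"
    and eq: "\<And>p n. \<lbrakk>p \<in> carrier M; n \<in> carrier N\<rbrakk> \<Longrightarrow> f (pure M p n) = g (pure M p n)"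
    and x: "x \<in> carrier (T M)"
  shows "f x = g x"
proof -
  interpret quotient_module R "F M" "rels M" by (rule quotient_module_T) fact
  note pr = proj_hom[folded tensor_product_def]
  obtain u where u: "u \<in> fin_supp R (carrier M \<times> carrier N)" "x = proj u"
    using x by (auto simp: tensor_product_def carrier_Q free_module_simps)
  have "f (proj u) = g (proj u)"
    using eq by (intro free_module_hom_eq[OF assms(2) mod_hom_comp[OF pr assms(3)] mod_hom_comp[OF pr assms(4)] _ u(1)]) auto
  then show ?thesis using u by simp
qed

text \<open>By linearity of \<open>f\<close> the induced map of free modules takes each generating
  relation to one of the same family. The preimage of \<open>rels M'\<close> is then a submodule
  that contains the generators, hence contains \<open>rels M\<close>, and the map descends to the
  quotients.\<close>

lemma tensor_map:
  assumes M: "right_module A M" and M': "right_module A M'" and f: "f \<in> mod_hom A M M'"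
  shows tensor_map_pure: "\<lbrakk>p \<in> carrier M; n \<in> carrier N\<rbrakk> \<Longrightarrow> tmap M' f (pure M p n) = pure M' (f p) n"
    and tensor_map_hom: "tmap M' f \<in> mod_hom R (T M) (T M')"
proof -
  interpret M: right_module A M by fact
  interpret M': right_module A M' by fact
  interpret Q: quotient_module R "F M" "rels M" by (rule quotient_module_T) fact
  interpret Q': quotient_module R "F M'" "rels M'" by (rule quotient_module_T) fact
  note fc = mod_homD[OF f]
  define g where "g = free_map R (map_prod f (id :: 'n \<Rightarrow> 'n))"
  have g: "g \<in> mod_hom R (F M) (F M')"
    unfolding g_def by (rule free_map_hom) (auto simp: fc)
  have gb: "g (b (p, n)) = b (f p, n)" for p n
    by (simp add: g_def free_map_basis_elt)
  note gh = mod_homD(1)[OF g] mod_hom_add[OF g] mod_hom_smult[OF g]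
    mod_hom_minus[OF Q.right_module Q'.right_module g]
  have gc: "g x \<in> tensor_gen_rels R A M' N" if "x \<in> tensor_gen_rels R A M N" for x
    using that
  proof (cases rule: tensor_gen_rels_cases)
    case (add_left p q n)
    then have "g x = b (f p \<oplus>\<^bsub>M'\<^esub> f q, n) \<ominus>\<^bsub>F M'\<^esub> (b (f p, n) \<oplus>\<^bsub>F M'\<^esub> b (f q, n))"
      by (simp add: gh gb b_closed fc)
    then show ?thesis using add_left(1-3) fc(1) unfolding tensor_gen_rels_def Let_def by blast
  next
    case (add_right p m n)
    then have "g x = b (f p, m \<oplus>\<^bsub>N\<^esub> n) \<ominus>\<^bsub>F M'\<^esub> (b (f p, m) \<oplus>\<^bsub>F M'\<^esub> b (f p, n))"
      by (simp add: gh gb b_closed fc)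
    then show ?thesis using add_right(1-3) fc(1) unfolding tensor_gen_rels_def Let_def by blast
  next
    case (balanced p a n)
    then have "g x = b (a \<odot>\<^bsub>M'\<^esub> f p, n) \<ominus>\<^bsub>F M'\<^esub> b (f p, a \<odot>\<^bsub>N\<^esub> n)"
      by (simp add: gh gb b_closed fc)
    then show ?thesis using balanced(1-3) fc(1) unfolding tensor_gen_rels_def Let_def by blast
  next
    case (scalar p r n)
    then have "g x = b ((r \<odot>\<^bsub>A\<^esub> \<one>\<^bsub>A\<^esub>) \<odot>\<^bsub>M'\<^esub> f p, n) \<ominus>\<^bsub>F M'\<^esub> r \<odot>\<^bsub>F M'\<^esub> b (f p, n)"
      by (simp add: gh gb b_closed fc scalar_closed)
    then show ?thesis using scalar(1-3) fc(1) unfolding tensor_gen_rels_def Let_def by blast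
  qed
  have "rels M \<subseteq> {x \<in> carrier (F M). g x \<in> rels M'}"
    using gc tensor_gen_rels_subset tensor_gen_rels_closed[OF M]
    by (intro tensor_rels_least submodule_preimage[OF Q.right_module Q'.right_module g Q'.submodule]) blast
  then have gr: "g ` rels M \<subseteq> rels M'" by blast
  have tm: "tmap M' f = (\<lambda>X. \<Union>u\<in>X. rels M' +>\<^bsub>F M'\<^esub> g u)"
    by (simp add: tensor_map_def g_def fun_eq_iff)
  note qm = Q.quotient_map[OF Q'.quotient_module_axioms g gr]
  show "tmap M' f (pure M p n) = pure M' (f p) n" if "p \<in> carrier M" "n \<in> carrier N"
    using qm(1)[OF b_closed[OF that]] by (simp add: tm gb)
  show "tmap M' f \<in> mod_hom R (T M) (T M')"
    using qm(2) by (simp add: tm tensor_product_def)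
qed

text \<open>Homomorphisms are total functions, so two that agree on the carrier may differ off it.
  Identities between maps of modules enter the tensor product through this lemma.\<close>

lemma tensor_map_cong:
  assumes M: "right_module A M" and M': "right_module A M'" and f: "f \<in> mod_hom A M M'"
    and eq: "\<And>x. x \<in> carrier M \<Longrightarrow> f x = g x" and X: "X \<in> carrier (T M)"
  shows "tmap M' f X = tmap M' g X"
proof -
  interpret M: right_module A M by fact
  have g: "g \<in> mod_hom A M M'"
    using f eq by (intro mod_homI) (simp_all add: mod_homD flip: eq)
  show ?thesis
    by (rule tensor_hom_eq[OF M right_module_T[OF M'] tensor_map_hom[OF M M' f] tensor_map_hom[OF M M' g] _ X])
      (simp add: tensor_map_pure[OF M M' f] tensor_map_pure[OF M M' g] eq)
qed

lemma tensor_map_id: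
  assumes M: "right_module A M" and X: "X \<in> carrier (T M)"
  shows "tmap M (\<lambda>x. x) X = X"
  by (rule tensor_hom_eq[OF M right_module_T[OF M] tensor_map_hom[OF M M mod_hom_id[OF M]]
        mod_hom_id[OF right_module_T[OF M]] _ X])
    (simp add: tensor_map_pure[OF M M mod_hom_id[OF M]])

lemma tensor_map_comp:
  assumes M: "right_module A M" and M': "right_module A M'" and M'': "right_module A M''"
    and f: "f \<in> mod_hom A M M'" and g: "g \<in> mod_hom A M' M''" and X: "X \<in> carrier (T M)"
  shows "tmap M'' g (tmap M' f X) = tmap M'' (\<lambda>x. g (f x)) X"
  by (rule tensor_hom_eq[OF M right_module_T[OF M'']
        mod_hom_comp[OF tensor_map_hom[OF M M' f] tensor_map_hom[OF M' M'' g]]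
        tensor_map_hom[OF M M'' mod_hom_comp[OF f g]] _ X])
    (simp add: tensor_map_pure[OF M M' f] tensor_map_pure[OF M' M'' g]
      tensor_map_pure[OF M M'' mod_hom_comp[OF f g]] mod_hom_closed[OF f])

lemma tensor_map_plus:
  assumes M: "right_module A M" and M': "right_module A M'"
    and f: "f \<in> mod_hom A M M'" and g: "g \<in> mod_hom A M M'" and X: "X \<in> carrier (T M)"
  shows "tmap M' (\<lambda>x. f x \<oplus>\<^bsub>M'\<^esub> g x) X = tmap M' f X \<oplus>\<^bsub>T M'\<^esub> tmap M' g X"
  by (rule tensor_hom_eq[OF M right_module_T[OF M']
        tensor_map_hom[OF M M' mod_hom_plus[OF M' f g]]
        mod_hom_plus[OF right_module_T[OF M'] tensor_map_hom[OF M M' f] tensor_map_hom[OF M M' g]] _ X])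
    (simp add: tensor_map_pure[OF M M' f] tensor_map_pure[OF M M' g] pure_add[OF M']
      tensor_map_pure[OF M M' mod_hom_plus[OF M' f g]] mod_hom_closed[OF f] mod_hom_closed[OF g])

text \<open>The zero map is its own double, so additivity gives z = z + z for its value z.\<close>

lemma tensor_map_zero:
  assumes M: "right_module A M" and M': "right_module A M'" and X: "X \<in> carrier (T M)"
  shows "tmap M' (\<lambda>_. \<zero>\<^bsub>M'\<^esub>) X = \<zero>\<^bsub>T M'\<^esub>"
proof -
  interpret M': right_module A M' by fact
  interpret T': right_module R "T M'" by (rule right_module_T[OF M'])
  let ?z = "tmap M' (\<lambda>_. \<zero>\<^bsub>M'\<^esub>) X"
  note z = mod_hom_const_zero[OF M', of M]
  have "?z \<in> carrier (T M')" using mod_hom_closed[OF tensor_map_hom[OF M M' z] X] .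
  moreover have "?z = ?z \<oplus>\<^bsub>T M'\<^esub> ?z"
    using tensor_map_plus[OF M M' z z X] by simp
  ultimately show ?thesis by (metis T'.M.add.l_cancel_one')
qed

end


section \<open>Homology of homotopy equivalent complexes\<close>

definition chain_complex :: "('r, 'c) ring_scheme \<Rightarrow> (nat \<Rightarrow> ('r, 'x) module) \<Rightarrow> (nat \<Rightarrow> 'x \<Rightarrow> 'x) \<Rightarrow> bool" where
  "chain_complex R C d \<longleftrightarrow> (\<forall>k. right_module R (C k)) \<and> (\<forall>k. d k \<in> mod_hom R (C (Suc k)) (C k)) \<and>
     (\<forall>k. \<forall>x\<in>carrier (C (Suc (Suc k))). d k (d (Suc k) x) = \<zero>\<^bsub>C k\<^esub>)"

text \<open>The two complexes may have different types, as the resolutions over the two algebras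
  do.\<close>

definition chain_map :: "('r, 'c) ring_scheme \<Rightarrow> (nat \<Rightarrow> ('r, 'x) module) \<Rightarrow> (nat \<Rightarrow> 'x \<Rightarrow> 'x) \<Rightarrow>
    (nat \<Rightarrow> ('r, 'y) module) \<Rightarrow> (nat \<Rightarrow> 'y \<Rightarrow> 'y) \<Rightarrow> (nat \<Rightarrow> 'x \<Rightarrow> 'y) \<Rightarrow> bool" where
  "chain_map R C d C' d' \<phi> \<longleftrightarrow> (\<forall>k. \<phi> k \<in> mod_hom R (C k) (C' k)) \<and>
     (\<forall>k. \<forall>x\<in>carrier (C (Suc k)). d' k (\<phi> (Suc k) x) = \<phi> k (d k x))"

lemma cycles_simps:
  "cycles C d 0 = carrier (C 0)" "cycles C d (Suc j) = {x \<in> carrier (C (Suc j)). d j x = \<zero>\<^bsub>C j\<^esub>}"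
  by (simp_all add: cycles_def)

lemma homology_quotient:
  assumes "chain_complex R C d"
  shows submodule_cycles: "submodule (cycles C d k) R (C k)"
    and quotient_module_homology:
      "quotient_module R (C k\<lparr>carrier := cycles C d k\<rparr>) (d k ` carrier (C (Suc k)))"
proof -
  have C: "\<And>k. right_module R (C k)" and d: "\<And>k. d k \<in> mod_hom R (C (Suc k)) (C k)"
    and dd: "\<And>k x. x \<in> carrier (C (Suc (Suc k))) \<Longrightarrow> d k (d (Suc k) x) = \<zero>\<^bsub>C k\<^esub>"
    using assms by (auto simp: chain_complex_def)
  show Z: "submodule (cycles C d k) R (C k)"
  proof (cases k)
    case 0
    interpret right_module R "C 0" by (rule C)
    show ?thesis unfolding 0 cycles_simps by (rule submoduleI[OF C]) auto
  next
    case (Suc j)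
    show ?thesis unfolding Suc cycles_simps by (rule submodule_kernel[OF C C d])
  qed
  have "d k x \<in> cycles C d k" if "x \<in> carrier (C (Suc k))" for x
    using that mod_hom_closed[OF d that] dd by (cases k) (auto simp: cycles_simps)
  then have "d k \<in> mod_hom R (C (Suc k)) (C k\<lparr>carrier := cycles C d k\<rparr>)"
    using d[of k] by (auto simp: mod_hom_def)
  then show "quotient_module R (C k\<lparr>carrier := cycles C d k\<rparr>) (d k ` carrier (C (Suc k)))"
    by (intro quotient_module.intro quotient_module_axioms.intro right_module_submodule[OF C Z]
        submodule_image[OF right_module_submodule[OF C Z] C])
qed

lemma chain_map_cycles:
  assumes "chain_complex R C d" "chain_complex R C' d'" "chain_map R C d C' d' \<phi>" "x \<in> cycles C d k"
  shows "\<phi> k x \<in> cycles C' d' k"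
proof -
  have C: "\<And>k. right_module R (C k)" "\<And>k. right_module R (C' k)"
    and \<phi>: "\<And>k. \<phi> k \<in> mod_hom R (C k) (C' k)"
      "\<And>k x. x \<in> carrier (C (Suc k)) \<Longrightarrow> d' k (\<phi> (Suc k) x) = \<phi> k (d k x)"
    using assms(1-3) by (auto simp: chain_complex_def chain_map_def)
  show ?thesis
    using assms(4) mod_hom_zero[OF C \<phi>(1)] mod_hom_closed[OF \<phi>(1)]
    by (cases k) (auto simp: cycles_simps \<phi>(2))
qed

text \<open>A homotopy enters through its effect on cycles of degree \<open>k\<close>, where one of
  its two terms vanishes: going forth and back changes a cycle by a boundary. \<open>h'\<close>
  gives surjectivity, \<open>h\<close> injectivity.\<close>

lemma homology_iso:
  assumes C: "chain_complex R C d" "chain_complex R C' d'"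
    and \<phi>: "chain_map R C d C' d' \<phi>" and \<psi>: "chain_map R C' d' C d \<psi>"
    and h: "\<And>z. z \<in> cycles C d k \<Longrightarrow> \<exists>w\<in>carrier (C (Suc k)). \<psi> k (\<phi> k z) = z \<oplus>\<^bsub>C k\<^esub> d k w"
    and h': "\<And>z. z \<in> cycles C' d' k \<Longrightarrow> \<exists>w\<in>carrier (C' (Suc k)). \<phi> k (\<psi> k z) = z \<oplus>\<^bsub>C' k\<^esub> d' k w"
  shows "mod_iso R (homology C d k) (homology C' d' k)"
proof -
  let ?Z = "C k\<lparr>carrier := cycles C d k\<rparr>" and ?B = "d k ` carrier (C (Suc k))"
  let ?Z' = "C' k\<lparr>carrier := cycles C' d' k\<rparr>" and ?B' = "d' k ` carrier (C' (Suc k))"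
  interpret Q: quotient_module R ?Z ?B by (rule quotient_module_homology[OF C(1)])
  interpret Q': quotient_module R ?Z' ?B' by (rule quotient_module_homology[OF C(2)])
  have Z: "\<phi> k x \<in> cycles C' d' k" if "x \<in> cycles C d k" for x
    using chain_map_cycles[OF C \<phi> that] .
  have Z': "\<psi> k x \<in> cycles C d k" if "x \<in> cycles C' d' k" for x
    using chain_map_cycles[OF C(2,1) \<psi> that] .
  have \<phi>h: "\<And>k. \<phi> k \<in> mod_hom R (C k) (C' k)" "\<And>x. x \<in> carrier (C (Suc k)) \<Longrightarrow> \<phi> k (d k x) = d' k (\<phi> (Suc k) x)"
    and \<psi>h: "\<And>k. \<psi> k \<in> mod_hom R (C' k) (C k)" "\<And>x. x \<in> carrier (C' (Suc k)) \<Longrightarrow> \<psi> k (d' k x) = d k (\<psi> (Suc k) x)"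
    using \<phi> \<psi> by (auto simp: chain_map_def)
  have "\<phi> k \<in> mod_hom R ?Z ?Z'"
    using \<phi>h(1)[of k] Z submodule_subset[OF submodule_cycles[OF C(1), of k]] by (auto simp: mod_hom_def subset_iff)
  then have g: "(\<lambda>x. Q'.proj (\<phi> k x)) \<in> mod_hom R ?Z Q'.Q"
    by (rule mod_hom_comp[OF _ Q'.proj_hom])
  have "mod_iso R Q.Q Q'.Q"
  proof (rule Q.quotient_iso[OF Q'.right_module_Q g])
    show "carrier Q'.Q \<subseteq> (\<lambda>x. Q'.proj (\<phi> k x)) ` carrier ?Z"
    proof
      fix Y assume "Y \<in> carrier Q'.Q"
      then obtain y where y: "y \<in> carrier ?Z'" "Y = Q'.proj y" by (auto simp: Q'.carrier_Q)
      \<comment> \<open>The class of \<open>y\<close> comes from \<psi> y, because \<phi> (\<psi> y)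
        differs from \<open>y\<close> by a boundary.\<close>
      obtain w where w: "w \<in> carrier (C' (Suc k))" "\<phi> k (\<psi> k y) = y \<oplus>\<^bsub>?Z'\<^esub> d' k w"
        using h'[of y] y by auto
      have B: "d' k w \<in> ?B'" using w by blast
      then have "d' k w \<in> carrier ?Z'" using submodule_subset[OF Q'.submodule] by blast
      then have "\<phi> k (\<psi> k y) \<ominus>\<^bsub>?Z'\<^esub> y = d' k w"
        using y(1) w(2) Q'.M.a_closed[of "d' k w" y] Q'.M.add.m_comm[of y] Q'.M.add.inv_solve_right'[of "d' k w" "\<phi> k (\<psi> k y)" y]
        by (simp add: a_minus_def Z Z')
      then have "Q'.proj (\<phi> k (\<psi> k y)) = Y"
        unfolding y(2) using B Q'.proj_eq_iff[of "\<phi> k (\<psi> k y)" y] y(1) by (simp add: Z Z')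
      then show "Y \<in> (\<lambda>x. Q'.proj (\<phi> k x)) ` carrier ?Z"
        using Z' y(1) by (intro image_eqI[of _ _ "\<psi> k y"]) auto
    qed
  next
    fix x assume x: "x \<in> carrier ?Z"
    have "x \<in> ?B" if *: "\<phi> k x \<in> ?B'"
    proof -
      \<comment> \<open>From \<phi> x = d' w' follows \<psi> (\<phi> x) = d (\<psi> w'); comparison
        with \<psi> (\<phi> x) = x + d w exhibits \<open>x\<close> as a boundary.\<close>
      obtain w' where w': "w' \<in> carrier (C' (Suc k))" "\<phi> k x = d' k w'" using * by blast
      obtain w where w: "w \<in> carrier (C (Suc k))" "\<psi> k (\<phi> k x) = x \<oplus>\<^bsub>?Z\<^esub> d k w"
        using h[of x] x by auto
      have B: "d k w \<in> ?B" "d k (\<psi> (Suc k) w') \<in> ?B" using w w' mod_hom_closed[OF \<psi>h(1)] by auto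
      then have "d k w \<in> carrier ?Z" "d k (\<psi> (Suc k) w') \<in> carrier ?Z"
        using submodule_subset[OF Q.submodule] by blast+
      then have "x = d k (\<psi> (Suc k) w') \<oplus>\<^bsub>?Z\<^esub> \<ominus>\<^bsub>?Z\<^esub> (d k w)"
        using w w' x Q.M.add.inv_solve_right[of x "d k (\<psi> (Suc k) w')" "d k w"] \<psi>h(2)[of w'] by simp
      then show ?thesis
        using submodule_add[OF Q.submodule B(2) submodule_uminus[OF Q.submodule B(1)]] by simp
    qed
    moreover have "\<phi> k x \<in> ?B'" if "x \<in> ?B"
      using that \<phi>h mod_hom_closed[OF \<phi>h(1)] by auto
    ultimately show "Q'.proj (\<phi> k x) = \<zero>\<^bsub>Q'.Q\<^esub> \<longleftrightarrow> x \<in> ?B"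
      using Q'.proj_eq_zero_iff[of "\<phi> k x"] Z x by auto
  qed
  then show ?thesis by (simp add: homology_def)
qed


section \<open>Comparison of projective resolutions\<close>

text \<open>On a free module a lift is obtained by choosing preimages of the basis elements, and
  \<open>P\<close> inherits it as a retract. Instead of surjectivity of \<open>g\<close> the
  inclusion of images is assumed, because a differential of a resolution hits just the
  cycles.\<close>

lemma projective_lift:
  fixes P :: "('a, 'p) module"
  assumes P: "projective A P" and N: "right_module A N" and L: "right_module A L"
    and f: "f \<in> mod_hom A P L" and g: "g \<in> mod_hom A N L" and sub: "f ` carrier P \<subseteq> g ` carrier N"
  shows "\<exists>h\<in>mod_hom A P N. \<forall>x\<in>carrier P. g (h x) = f x"
proof -
  interpret N: right_module A N by fact
  obtain X :: "'p set" and i r where i: "i \<in> mod_hom A P (free_module A X)" and r: "r \<in> mod_hom A (free_module A X) P"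
    and ri: "\<And>x. x \<in> carrier P \<Longrightarrow> r (i x) = x"
    using P unfolding projective_def by blast
  have "\<exists>y\<in>carrier N. g y = f (r (basis_elt A x))" if "x \<in> X" for x
  proof -
    have "r (basis_elt A x) \<in> carrier P"
      using that by (intro mod_hom_closed[OF r]) (simp add: free_module_simps N.A.basis_elt_fin_supp)
    then show ?thesis using sub by (metis image_iff subset_iff)
  qed
  then obtain c where c: "\<And>x. x \<in> X \<Longrightarrow> c x \<in> carrier N \<and> g (c x) = f (r (basis_elt A x))"
    by metis
  then have cX: "c \<in> X \<rightarrow> carrier N" by blast
  note l = lin_hom[OF N cX]
  have "g (lin N \<zero>\<^bsub>A\<^esub> c u) = f (r u)" if "u \<in> fin_supp A X" for u
    by (rule free_module_hom_eq[OF L mod_hom_comp[OF l g] mod_hom_comp[OF r f] _ that])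
      (simp only: N.lin_basis_elt[OF cX] c)
  then have "g (lin N \<zero>\<^bsub>A\<^esub> c (i x)) = f x" if "x \<in> carrier P" for x
    using that mod_hom_closed[OF i that] by (simp add: free_module_simps ri)
  then show ?thesis by (intro bexI[OF _ mod_hom_comp[OF i l]]) simp
qed

text \<open>Unlike \<open>cycles\<close>, degree 0 has the kernel of the augmentation. So exactness
  of the augmented complex is a single equation for all \<open>k\<close>, the last part of
  \<open>projective_resolutionD\<close>.\<close>

definition aug_cycles where
  "aug_cycles M P d aug k = (case k of 0 \<Rightarrow> {x \<in> carrier (P 0). aug x = \<zero>\<^bsub>M\<^esub>}
     | Suc j \<Rightarrow> {x \<in> carrier (P (Suc j)). d j x = \<zero>\<^bsub>P j\<^esub>})"

lemma projective_resolutionD: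
  assumes "projective_resolution A M P d aug"
  shows "projective A (P k)" "right_module A (P k)" "d k \<in> mod_hom A (P (Suc k)) (P k)"
    "aug \<in> mod_hom A (P 0) M" "aug ` carrier (P 0) = carrier M"
    "d k ` carrier (P (Suc k)) = aug_cycles M P d aug k"
proof -
  show "projective A (P k)" using assms by (simp add: projective_resolution_def)
  then show "right_module A (P k)" by (rule projective_right_module)
  show "d k ` carrier (P (Suc k)) = aug_cycles M P d aug k"
    using assms by (cases k) (simp_all add: projective_resolution_def aug_cycles_def)
qed (use assms in \<open>simp_all add: projective_resolution_def\<close>)

lemma projective_resolution_chain_complex:
  assumes "projective_resolution A M P d aug"
  shows "chain_complex A P d"
proof -
  note r = projective_resolutionD[OF assms]
  have "d k (d (Suc k) x) = \<zero>\<^bsub>P k\<^esub>" if "x \<in> carrier (P (Suc (Suc k)))" for k x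
  proof -
    have "d (Suc k) x \<in> aug_cycles M P d aug (Suc k)" using r(6)[of "Suc k"] that by blast
    then show ?thesis by (simp add: aug_cycles_def)
  qed
  then show ?thesis using r by (simp add: chain_complex_def)
qed

text \<open>Comparison theorem, by recursive lifting. The invariant \<open>good\<close> records that
  cycles go to cycles, which by exactness of the target is what the next lift requires; in degree 0
  this follows from compatibility with the augmentations.\<close>

lemma chain_map_exists:
  fixes P :: "nat \<Rightarrow> ('a, 'p) module" and P' :: "nat \<Rightarrow> ('a, 'q) module"
  assumes P: "projective_resolution A M P d aug" and P': "projective_resolution A M P' d' aug'"
    and M: "right_module A M"
  shows "\<exists>\<phi>. chain_map A P d P' d' \<phi> \<and> (\<forall>x\<in>carrier (P 0). aug' (\<phi> 0 x) = aug x)"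
proof -
  note r = projective_resolutionD[OF P] and r' = projective_resolutionD[OF P']
  define good where "good k f \<longleftrightarrow> f \<in> mod_hom A (P k) (P' k) \<and>
    f ` aug_cycles M P d aug k \<subseteq> aug_cycles M P' d' aug' k \<and>
    (k = 0 \<longrightarrow> (\<forall>x\<in>carrier (P 0). aug' (f x) = aug x))" for k f
  have "\<exists>\<phi>. \<forall>k. good k (\<phi> k) \<and> (\<forall>x\<in>carrier (P (Suc k)). d' k (\<phi> (Suc k) x) = \<phi> k (d k x))"
  proof (rule dependent_nat_choice)
    obtain f where f: "f \<in> mod_hom A (P 0) (P' 0)" "\<And>x. x \<in> carrier (P 0) \<Longrightarrow> aug' (f x) = aug x"
      using projective_lift[OF r(1) r'(2) M r(4) r'(4)] r(5) r'(5) by blast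
    then show "\<exists>f. good 0 f"
      by (intro exI[of _ f]) (auto simp: good_def aug_cycles_def mod_hom_closed)
  next
    fix f k assume f: "good k f"
    then have fh: "f \<in> mod_hom A (P k) (P' k)"
      and fc: "f ` aug_cycles M P d aug k \<subseteq> aug_cycles M P' d' aug' k" by (auto simp: good_def)
    have "(\<lambda>x. f (d k x)) ` carrier (P (Suc k)) \<subseteq> d' k ` carrier (P' (Suc k))"
      using fc r(6)[of k] r'(6)[of k] by blast
    then obtain g where g: "g \<in> mod_hom A (P (Suc k)) (P' (Suc k))"
        "\<And>x. x \<in> carrier (P (Suc k)) \<Longrightarrow> d' k (g x) = f (d k x)"
      using projective_lift[OF r(1) r'(2) r'(2) mod_hom_comp[OF r(3) fh] r'(3)] by blast
    moreover have "g ` aug_cycles M P d aug (Suc k) \<subseteq> aug_cycles M P' d' aug' (Suc k)"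
      using g mod_hom_zero[OF r(2) r'(2) fh] by (auto simp: aug_cycles_def mod_hom_closed)
    ultimately show "\<exists>g. good (Suc k) g \<and> (\<forall>x\<in>carrier (P (Suc k)). d' k (g x) = f (d k x))"
      by (auto simp: good_def)
  qed
  then obtain \<phi> where "\<forall>k. good k (\<phi> k) \<and> (\<forall>x\<in>carrier (P (Suc k)). d' k (\<phi> (Suc k) x) = \<phi> k (d k x))" ..
  then have "\<And>k. \<phi> k \<in> mod_hom A (P k) (P' k)" "\<And>x. x \<in> carrier (P 0) \<Longrightarrow> aug' (\<phi> 0 x) = aug x"
    "\<And>k x. x \<in> carrier (P (Suc k)) \<Longrightarrow> d' k (\<phi> (Suc k) x) = \<phi> k (d k x)"
    unfolding good_def by blast+
  then show ?thesis unfolding chain_map_def by blast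
qed

text \<open>The recursion chooses \<open>s\<close> in degree \<open>k\<close> without access to
  degree \<open>k - 1\<close>, so \<open>good\<close> cannot state the homotopy equation. It records
  instead what this equation says on cycles, where the term through \<open>d\<close> vanishes, and
  this is enough for the next lift.\<close>

lemma null_homotopy_exists:
  fixes P :: "nat \<Rightarrow> ('a, 'p) module" and P' :: "nat \<Rightarrow> ('a, 'q) module"
  assumes P: "projective_resolution A M P d aug" and P': "projective_resolution A M P' d' aug'"
    and \<chi>: "chain_map A P d P' d' \<chi>" and aug0: "\<And>x. x \<in> carrier (P 0) \<Longrightarrow> aug' (\<chi> 0 x) = \<zero>\<^bsub>M\<^esub>"
  shows "\<exists>s. (\<forall>k. s k \<in> mod_hom A (P k) (P' (Suc k))) \<and>
    (\<forall>x\<in>carrier (P 0). d' 0 (s 0 x) = \<chi> 0 x) \<and>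
    (\<forall>k. \<forall>x\<in>carrier (P (Suc k)). d' (Suc k) (s (Suc k) x) = \<chi> (Suc k) x \<ominus>\<^bsub>P' (Suc k)\<^esub> s k (d k x))"
proof -
  note r = projective_resolutionD[OF P] and r' = projective_resolutionD[OF P']
  have \<chi>h: "\<And>k. \<chi> k \<in> mod_hom A (P k) (P' k)"
    and \<chi>d: "\<And>k x. x \<in> carrier (P (Suc k)) \<Longrightarrow> d' k (\<chi> (Suc k) x) = \<chi> k (d k x)"
    using \<chi> by (auto simp: chain_map_def)
  define good where "good k s \<longleftrightarrow> s \<in> mod_hom A (P k) (P' (Suc k)) \<and>
    (\<forall>x\<in>aug_cycles M P d aug k. d' k (s x) = \<chi> k x) \<and>
    (k = 0 \<longrightarrow> (\<forall>x\<in>carrier (P 0). d' 0 (s x) = \<chi> 0 x))" for k s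
  have "\<exists>s. \<forall>k. good k (s k) \<and>
    (\<forall>x\<in>carrier (P (Suc k)). d' (Suc k) (s (Suc k) x) = \<chi> (Suc k) x \<ominus>\<^bsub>P' (Suc k)\<^esub> s k (d k x))"
  proof (rule dependent_nat_choice)
    have "\<chi> 0 ` carrier (P 0) \<subseteq> d' 0 ` carrier (P' (Suc 0))"
      unfolding r'(6) using aug0 by (auto simp: aug_cycles_def mod_hom_closed[OF \<chi>h])
    then obtain s where s: "s \<in> mod_hom A (P 0) (P' (Suc 0))" "\<And>x. x \<in> carrier (P 0) \<Longrightarrow> d' 0 (s x) = \<chi> 0 x"
      using projective_lift[OF r(1)[of 0] r'(2)[of "Suc 0"] r'(2)[of 0] \<chi>h r'(3)] by blast
    then show "\<exists>s. good 0 s" by (intro exI[of _ s]) (auto simp: good_def aug_cycles_def)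
  next
    fix s k assume s: "good k s"
    then have sh: "s \<in> mod_hom A (P k) (P' (Suc k))"
      and sd: "\<And>x. x \<in> aug_cycles M P d aug k \<Longrightarrow> d' k (s x) = \<chi> k x" by (auto simp: good_def)
    interpret Pk': right_module A "P' k" by (rule r'(2))
    interpret PSk': right_module A "P' (Suc k)" by (rule r'(2))
    define f where "f x = \<chi> (Suc k) x \<ominus>\<^bsub>P' (Suc k)\<^esub> s (d k x)" for x
    have f: "f \<in> mod_hom A (P (Suc k)) (P' (Suc k))"
      unfolding f_def by (rule mod_hom_diff[OF r'(2) \<chi>h mod_hom_comp[OF r(3) sh]])
    have "f x \<in> aug_cycles M P' d' aug' (Suc k)" if x: "x \<in> carrier (P (Suc k))" for x
    proof -
      have dx: "d k x \<in> carrier (P k)" "d k x \<in> aug_cycles M P d aug k"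
        using mod_hom_closed[OF r(3) x] x r(6)[of k] by auto
      \<comment> \<open>As \<open>d k x\<close> is a cycle, the invariant turns
        \<open>d' k (s (d k x))\<close> into \<open>\<chi> k (d k x)\<close>, and the two terms
        cancel.\<close>
      have "d' k (f x) = \<chi> k (d k x) \<ominus>\<^bsub>P' k\<^esub> \<chi> k (d k x)"
        unfolding f_def
        by (simp add: mod_hom_minus[OF r'(2) r'(2) r'(3)] mod_hom_closed[OF \<chi>h x] mod_hom_closed[OF sh dx(1)]
            \<chi>d[OF x] sd[OF dx(2)])
      then show ?thesis
        using mod_hom_closed[OF f x] mod_hom_closed[OF \<chi>h dx(1)] by (simp add: aug_cycles_def Pk'.diff_eq_zero_iff)
    qed
    then have "f ` carrier (P (Suc k)) \<subseteq> d' (Suc k) ` carrier (P' (Suc (Suc k)))"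
      using r'(6)[of "Suc k"] by blast
    then obtain t where t: "t \<in> mod_hom A (P (Suc k)) (P' (Suc (Suc k)))"
        "\<And>x. x \<in> carrier (P (Suc k)) \<Longrightarrow> d' (Suc k) (t x) = f x"
      using projective_lift[OF r(1) r'(2) r'(2) f r'(3)] by blast
    moreover have "f x = \<chi> (Suc k) x" if "x \<in> aug_cycles M P d aug (Suc k)" for x
    proof -
      have x: "x \<in> carrier (P (Suc k))" "d k x = \<zero>\<^bsub>P k\<^esub>" using that by (auto simp: aug_cycles_def)
      have "\<ominus>\<^bsub>P' (Suc k)\<^esub> \<zero>\<^bsub>P' (Suc k)\<^esub> = \<zero>\<^bsub>P' (Suc k)\<^esub>" by (rule PSk'.M.minus_equality) simp_all
      then show ?thesis
        unfolding f_def x(2) mod_hom_zero[OF r(2) r'(2) sh]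
        using mod_hom_closed[OF \<chi>h x(1)] by (simp only: a_minus_def PSk'.M.r_zero)
    qed
    ultimately have "good (Suc k) t" by (auto simp: good_def aug_cycles_def)
    then show "\<exists>t. good (Suc k) t \<and>
      (\<forall>x\<in>carrier (P (Suc k)). d' (Suc k) (t x) = \<chi> (Suc k) x \<ominus>\<^bsub>P' (Suc k)\<^esub> s (d k x))"
      using t by (auto simp: f_def)
  qed
  then obtain s where "\<forall>k. good k (s k) \<and>
    (\<forall>x\<in>carrier (P (Suc k)). d' (Suc k) (s (Suc k) x) = \<chi> (Suc k) x \<ominus>\<^bsub>P' (Suc k)\<^esub> s k (d k x))" ..
  then have "\<And>k. s k \<in> mod_hom A (P k) (P' (Suc k))" "\<And>x. x \<in> carrier (P 0) \<Longrightarrow> d' 0 (s 0 x) = \<chi> 0 x"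
    "\<And>k x. x \<in> carrier (P (Suc k)) \<Longrightarrow> d' (Suc k) (s (Suc k) x) = \<chi> (Suc k) x \<ominus>\<^bsub>P' (Suc k)\<^esub> s k (d k x)"
    unfolding good_def by blast+
  then show ?thesis by blast
qed

lemma (in abelian_group) diff_eq_imp:
  assumes "x \<in> carrier G" "y \<in> carrier G" "z \<in> carrier G" "x \<ominus> y = z"
  shows "x = y \<oplus> z"
  using assms by (metis add.inv_solve_right' a_comm minus_eq)

text \<open>The difference of \<chi> and the identity vanishes under the augmentation, so it is
  null-homotopic. The result is stated with sums because these are what
  \<open>tensor_map_plus\<close> carries through the tensor product.\<close>

lemma homotopic_id:
  fixes P :: "nat \<Rightarrow> ('a, 'p) module"
  assumes P: "projective_resolution A M P d aug" and M: "right_module A M"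
    and \<chi>: "chain_map A P d P d \<chi>" and aug: "\<And>x. x \<in> carrier (P 0) \<Longrightarrow> aug (\<chi> 0 x) = aug x"
  shows "\<exists>s. (\<forall>k. s k \<in> mod_hom A (P k) (P (Suc k))) \<and>
    (\<forall>x\<in>carrier (P 0). \<chi> 0 x = x \<oplus>\<^bsub>P 0\<^esub> d 0 (s 0 x)) \<and>
    (\<forall>k. \<forall>x\<in>carrier (P (Suc k)). \<chi> (Suc k) x =
      x \<oplus>\<^bsub>P (Suc k)\<^esub> (d (Suc k) (s (Suc k) x) \<oplus>\<^bsub>P (Suc k)\<^esub> s k (d k x)))"
proof -
  note r = projective_resolutionD[OF P]
  interpret M: right_module A M by fact
  have \<chi>h: "\<And>k. \<chi> k \<in> mod_hom A (P k) (P k)"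
    and \<chi>d: "\<And>k x. x \<in> carrier (P (Suc k)) \<Longrightarrow> d k (\<chi> (Suc k) x) = \<chi> k (d k x)"
    using \<chi> by (auto simp: chain_map_def)
  define \<delta> where "\<delta> k x = \<chi> k x \<ominus>\<^bsub>P k\<^esub> x" for k x
  have \<delta>h: "\<delta> k \<in> mod_hom A (P k) (P k)" for k
    unfolding \<delta>_def by (rule mod_hom_diff[OF r(2) \<chi>h mod_hom_id[OF r(2)]])
  have "chain_map A P d P d \<delta>"
    unfolding chain_map_def
  proof (intro conjI allI ballI)
    fix k x assume x: "x \<in> carrier (P (Suc k))"
    show "d k (\<delta> (Suc k) x) = \<delta> k (d k x)"
      by (simp add: \<delta>_def mod_hom_minus[OF r(2) r(2) r(3)] mod_hom_closed[OF \<chi>h x] x \<chi>d)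
  qed (rule \<delta>h)
  moreover have "aug (\<delta> 0 x) = \<zero>\<^bsub>M\<^esub>" if x: "x \<in> carrier (P 0)" for x
    unfolding \<delta>_def
    by (simp add: mod_hom_minus[OF r(2) M r(4)] mod_hom_closed[OF \<chi>h x] x aug M.diff_eq_zero_iff mod_hom_closed[OF r(4) x])
  ultimately obtain s where s: "\<And>k. s k \<in> mod_hom A (P k) (P (Suc k))"
      "\<And>x. x \<in> carrier (P 0) \<Longrightarrow> d 0 (s 0 x) = \<delta> 0 x"
      "\<And>k x. x \<in> carrier (P (Suc k)) \<Longrightarrow> d (Suc k) (s (Suc k) x) = \<delta> (Suc k) x \<ominus>\<^bsub>P (Suc k)\<^esub> s k (d k x)"
    using null_homotopy_exists[OF P P, of \<delta>] by blast
  have \<delta>: "\<chi> k x = x \<oplus>\<^bsub>P k\<^esub> \<delta> k x" if "x \<in> carrier (P k)" for k x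
  proof -
    interpret Pk: right_module A "P k" by (rule r(2))
    show ?thesis
      using that mod_hom_closed[OF \<chi>h that] mod_hom_closed[OF \<delta>h that]
      by (intro Pk.M.diff_eq_imp) (auto simp: \<delta>_def)
  qed
  have "\<delta> (Suc k) x = d (Suc k) (s (Suc k) x) \<oplus>\<^bsub>P (Suc k)\<^esub> s k (d k x)" if x: "x \<in> carrier (P (Suc k))" for k x
  proof -
    interpret Pk: right_module A "P (Suc k)" by (rule r(2))
    have c: "s k (d k x) \<in> carrier (P (Suc k))" "d (Suc k) (s (Suc k) x) \<in> carrier (P (Suc k))"
      using mod_hom_closed[OF s(1) mod_hom_closed[OF r(3) x]] mod_hom_closed[OF r(3) mod_hom_closed[OF s(1) x]] by auto
    have "\<delta> (Suc k) x = s k (d k x) \<oplus>\<^bsub>P (Suc k)\<^esub> d (Suc k) (s (Suc k) x)"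
      using mod_hom_closed[OF \<delta>h x] c s(3)[OF x] by (intro Pk.M.diff_eq_imp) auto
    then show ?thesis using c by (simp add: Pk.M.a_comm)
  qed
  then show ?thesis using s \<delta> by (intro exI[of _ s]) simp
qed

section \<open>Chain maps and homotopies after tensoring; independence of the resolution\<close>

context tensor_functor
begin

lemma tensor_chain_complex:
  assumes "chain_complex A P d"
  shows "chain_complex R (\<lambda>i. T (P i)) (\<lambda>i. tmap (P i) (d i))"
proof -
  have P: "\<And>k. right_module A (P k)" and d: "\<And>k. d k \<in> mod_hom A (P (Suc k)) (P k)"
    and dd: "\<And>k x. x \<in> carrier (P (Suc (Suc k))) \<Longrightarrow> d k (d (Suc k) x) = \<zero>\<^bsub>P k\<^esub>"
    using assms by (auto simp: chain_complex_def)
  have "tmap (P k) (d k) (tmap (P (Suc k)) (d (Suc k)) X) = \<zero>\<^bsub>T (P k)\<^esub>" if X: "X \<in> carrier (T (P (Suc (Suc k))))" for k X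
    using tensor_map_cong[OF P P mod_hom_comp[OF d d] dd X]
    by (simp add: tensor_map_comp[OF P P P d d X] tensor_map_zero[OF P P X])
  then show ?thesis using right_module_T[OF P] tensor_map_hom[OF P P d] by (simp add: chain_complex_def)
qed

lemma tensor_chain_map:
  assumes "chain_complex A P d" "chain_complex A P' d'" "chain_map A P d P' d' \<phi>"
  shows "chain_map R (\<lambda>i. T (P i)) (\<lambda>i. tmap (P i) (d i)) (\<lambda>i. T (P' i)) (\<lambda>i. tmap (P' i) (d' i))
    (\<lambda>i. tmap (P' i) (\<phi> i))"
proof -
  have P: "\<And>k. right_module A (P k)" and d: "\<And>k. d k \<in> mod_hom A (P (Suc k)) (P k)"
    and P': "\<And>k. right_module A (P' k)" and d': "\<And>k. d' k \<in> mod_hom A (P' (Suc k)) (P' k)"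
    and \<phi>: "\<And>k. \<phi> k \<in> mod_hom A (P k) (P' k)"
    and eq: "\<And>k x. x \<in> carrier (P (Suc k)) \<Longrightarrow> d' k (\<phi> (Suc k) x) = \<phi> k (d k x)"
    using assms by (auto simp: chain_complex_def chain_map_def)
  have "tmap (P' k) (d' k) (tmap (P' (Suc k)) (\<phi> (Suc k)) X) = tmap (P' k) (\<phi> k) (tmap (P k) (d k) X)"
    if X: "X \<in> carrier (T (P (Suc k)))" for k X
    using tensor_map_cong[OF P P' mod_hom_comp[OF \<phi> d'] eq X]
    by (simp add: tensor_map_comp[OF P P' P' \<phi> d' X] tensor_map_comp[OF P P P' d \<phi> X])
  then show ?thesis using tensor_map_hom[OF P P' \<phi>] by (simp add: chain_map_def)
qed

text \<open>The witness is the tensored homotopy applied to \<open>z\<close>. Its other term factors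
  through the differential of \<open>z\<close>, which is zero for a cycle.\<close>

lemma tensor_homotopic_id:
  assumes P: "projective_resolution A M P d aug" and M: "right_module A M"
    and \<chi>: "chain_map A P d P d \<chi>" and aug: "\<And>x. x \<in> carrier (P 0) \<Longrightarrow> aug (\<chi> 0 x) = aug x"
    and z: "z \<in> cycles (\<lambda>i. T (P i)) (\<lambda>i. tmap (P i) (d i)) k"
  shows "\<exists>w\<in>carrier (T (P (Suc k))). tmap (P k) (\<chi> k) z = z \<oplus>\<^bsub>T (P k)\<^esub> tmap (P k) (d k) w"
proof -
  note r = projective_resolutionD[OF P]
  have \<chi>h: "\<And>k. \<chi> k \<in> mod_hom A (P k) (P k)" using \<chi> by (simp add: chain_map_def)
  obtain s where s: "\<And>k. s k \<in> mod_hom A (P k) (P (Suc k))"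
    "\<And>x. x \<in> carrier (P 0) \<Longrightarrow> \<chi> 0 x = x \<oplus>\<^bsub>P 0\<^esub> d 0 (s 0 x)"
    "\<And>k x. x \<in> carrier (P (Suc k)) \<Longrightarrow> \<chi> (Suc k) x =
      x \<oplus>\<^bsub>P (Suc k)\<^esub> (d (Suc k) (s (Suc k) x) \<oplus>\<^bsub>P (Suc k)\<^esub> s k (d k x))"
    using homotopic_id[OF P M \<chi> aug] by blast
  note i = mod_hom_id[OF r(2)] and ds = mod_hom_comp[OF s(1) r(3)] and sd = mod_hom_comp[OF r(3) s(1)]
  have zc: "z \<in> carrier (T (P k))" using z by (cases k) (auto simp: cycles_simps)
  have w: "tmap (P (Suc k)) (s k) z \<in> carrier (T (P (Suc k)))"
    by (rule mod_hom_closed[OF tensor_map_hom[OF r(2) r(2) s(1)] zc])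
  have "tmap (P k) (\<chi> k) z = z \<oplus>\<^bsub>T (P k)\<^esub> tmap (P k) (d k) (tmap (P (Suc k)) (s k) z)"
  proof (cases k)
    case 0
    note zc = zc[unfolded 0]
    have "tmap (P 0) (\<chi> 0) z = tmap (P 0) (\<lambda>x. x \<oplus>\<^bsub>P 0\<^esub> d 0 (s 0 x)) z"
      by (rule tensor_map_cong[OF r(2) r(2) \<chi>h s(2) zc])
    then show ?thesis
      by (simp add: 0 tensor_map_plus[OF r(2) r(2) i ds zc] tensor_map_id[OF r(2) zc] tensor_map_comp[OF r(2) r(2) r(2) s(1) r(3) zc])
  next
    case (Suc j)
    note zc = zc[unfolded Suc] and w = w[unfolded Suc]
    interpret TP: right_module R "T (P (Suc j))" by (rule right_module_T[OF r(2)])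
    have zd: "tmap (P j) (d j) z = \<zero>\<^bsub>T (P j)\<^esub>" using z by (simp add: Suc cycles_simps)
    have "tmap (P (Suc j)) (\<lambda>x. s j (d j x)) z = tmap (P (Suc j)) (s j) (tmap (P j) (d j) z)"
      by (rule tensor_map_comp[OF r(2) r(2) r(2) r(3) s(1) zc, symmetric])
    also have "\<dots> = \<zero>\<^bsub>T (P (Suc j))\<^esub>"
      unfolding zd by (rule mod_hom_zero[OF right_module_T[OF r(2)] right_module_T[OF r(2)] tensor_map_hom[OF r(2) r(2) s(1)]])
    finally have 0: "tmap (P (Suc j)) (\<lambda>x. s j (d j x)) z = \<zero>\<^bsub>T (P (Suc j))\<^esub>" .
    have "tmap (P (Suc j)) (\<chi> (Suc j)) z = tmap (P (Suc j)) (\<lambda>x. x \<oplus>\<^bsub>P (Suc j)\<^esub>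
        (d (Suc j) (s (Suc j) x) \<oplus>\<^bsub>P (Suc j)\<^esub> s j (d j x))) z"
      by (rule tensor_map_cong[OF r(2) r(2) \<chi>h s(3) zc])
    then show ?thesis
      using mod_hom_closed[OF tensor_map_hom[OF r(2) r(2) r(3)] w]
      by (simp add: Suc tensor_map_plus[OF r(2) r(2) i mod_hom_plus[OF r(2) ds sd] zc] tensor_map_plus[OF r(2) r(2) ds sd zc]
          tensor_map_id[OF r(2) zc] tensor_map_comp[OF r(2) r(2) r(2) s(1) r(3) zc] 0)
  qed
  then show ?thesis using w by blast
qed

text \<open>Comparison maps in both directions compose to self-maps over the augmentation, which are
  homotopic to the identity. Resolutions of two types are allowed since \<open>Tor\<close> chooses
  its own type for each algebra.\<close>

theorem tensor_homology_iso:
  fixes P :: "nat \<Rightarrow> ('a, 'p) module" and P' :: "nat \<Rightarrow> ('a, 'q) module"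
  assumes P: "projective_resolution A M P d aug" and P': "projective_resolution A M P' d' aug'"
    and M: "right_module A M"
  shows "mod_iso R (homology (\<lambda>i. T (P i)) (\<lambda>i. tmap (P i) (d i)) k)
    (homology (\<lambda>i. T (P' i)) (\<lambda>i. tmap (P' i) (d' i)) k)"
proof -
  note c = projective_resolution_chain_complex[OF P] and c' = projective_resolution_chain_complex[OF P']
  note r = projective_resolutionD[OF P] and r' = projective_resolutionD[OF P']
  obtain \<phi> where \<phi>: "chain_map A P d P' d' \<phi>" "\<And>x. x \<in> carrier (P 0) \<Longrightarrow> aug' (\<phi> 0 x) = aug x"
    using chain_map_exists[OF P P' M] by blast
  obtain \<psi> where \<psi>: "chain_map A P' d' P d \<psi>" "\<And>x. x \<in> carrier (P' 0) \<Longrightarrow> aug (\<psi> 0 x) = aug' x"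
    using chain_map_exists[OF P' P M] by blast
  have \<phi>h: "\<And>k. \<phi> k \<in> mod_hom A (P k) (P' k)" and \<psi>h: "\<And>k. \<psi> k \<in> mod_hom A (P' k) (P k)"
    using \<phi> \<psi> by (auto simp: chain_map_def)
  have \<psi>\<phi>: "chain_map A P d P d (\<lambda>k x. \<psi> k (\<phi> k x))" and \<phi>\<psi>: "chain_map A P' d' P' d' (\<lambda>k x. \<phi> k (\<psi> k x))"
    using \<phi>(1) \<psi>(1) mod_hom_comp[OF \<phi>h \<psi>h] mod_hom_comp[OF \<psi>h \<phi>h]
    by (simp_all add: chain_map_def mod_hom_closed[OF \<phi>h] mod_hom_closed[OF \<psi>h])
  have cyc: "z \<in> carrier (T (P k))" if "z \<in> cycles (\<lambda>i. T (P i)) (\<lambda>i. tmap (P i) (d i)) k" for z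
    using that by (cases k) (auto simp: cycles_simps)
  have cyc': "z \<in> carrier (T (P' k))" if "z \<in> cycles (\<lambda>i. T (P' i)) (\<lambda>i. tmap (P' i) (d' i)) k" for z
    using that by (cases k) (auto simp: cycles_simps)
  show ?thesis
  proof (rule homology_iso[OF tensor_chain_complex[OF c] tensor_chain_complex[OF c']
        tensor_chain_map[OF c c' \<phi>(1)] tensor_chain_map[OF c' c \<psi>(1)]])
    fix z assume z: "z \<in> cycles (\<lambda>i. T (P i)) (\<lambda>i. tmap (P i) (d i)) k"
    show "\<exists>w\<in>carrier (T (P (Suc k))). tmap (P k) (\<psi> k) (tmap (P' k) (\<phi> k) z) =
        z \<oplus>\<^bsub>T (P k)\<^esub> tmap (P k) (d k) w"
      unfolding tensor_map_comp[OF r(2) r'(2) r(2) \<phi>h \<psi>h cyc[OF z]]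
      by (rule tensor_homotopic_id[OF P M \<psi>\<phi> _ z]) (simp add: \<phi>(2) \<psi>(2) mod_hom_closed[OF \<phi>h])
  next
    fix z assume z: "z \<in> cycles (\<lambda>i. T (P' i)) (\<lambda>i. tmap (P' i) (d' i)) k"
    show "\<exists>w\<in>carrier (T (P' (Suc k))). tmap (P' k) (\<phi> k) (tmap (P k) (\<psi> k) z) =
        z \<oplus>\<^bsub>T (P' k)\<^esub> tmap (P' k) (d' k) w"
      unfolding tensor_map_comp[OF r'(2) r(2) r'(2) \<psi>h \<phi>h cyc'[OF z]]
      by (rule tensor_homotopic_id[OF P' M \<phi>\<psi> _ z]) (simp add: \<phi>(2) \<psi>(2) mod_hom_closed[OF \<psi>h])
  qed
qed

end


section \<open>Restriction of scalars along a split surjection\<close>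

text \<open>The right \<open>A\<close>-linear section \<open>s\<close> makes \<open>B\<close> projective as a right \<open>A\<close>-module.\<close>

locale split_ring_hom = A: ring A + B: ring B
  for A :: "('a, 'c) ring_scheme" and B :: "('b, 'd) ring_scheme" +
  fixes \<pi> :: "'a \<Rightarrow> 'b" and s :: "'b \<Rightarrow> 'a"
  assumes ring_hom: "\<pi> \<in> ring_hom A B"
    and s_closed: "b \<in> carrier B \<Longrightarrow> s b \<in> carrier A"
    and s_add: "\<lbrakk>b \<in> carrier B; b' \<in> carrier B\<rbrakk> \<Longrightarrow> s (b \<oplus>\<^bsub>B\<^esub> b') = s b \<oplus>\<^bsub>A\<^esub> s b'"
    and s_linear: "\<lbrakk>b \<in> carrier B; a \<in> carrier A\<rbrakk> \<Longrightarrow> s (b \<otimes>\<^bsub>B\<^esub> \<pi> a) = s b \<otimes>\<^bsub>A\<^esub> a"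
    and hom_section: "b \<in> carrier B \<Longrightarrow> \<pi> (s b) = b"

text \<open>Carrier and type are kept, so differentials and augmentations of a resolution over
  \<open>B\<close> serve over \<open>A\<close> as the same functions.\<close>

definition restrict_scalars :: "('a \<Rightarrow> 'b) \<Rightarrow> ('b, 'm) module \<Rightarrow> ('a, 'm) module" where
  "restrict_scalars \<pi> M = \<lparr>carrier = carrier M, monoid.mult = undefined, one = undefined,
     zero = \<zero>\<^bsub>M\<^esub>, add = (\<oplus>\<^bsub>M\<^esub>), smult = (\<lambda>a x. \<pi> a \<odot>\<^bsub>M\<^esub> x)\<rparr>"

lemma restrict_scalars_simps [simp]:
  "carrier (restrict_scalars \<pi> M) = carrier M" "\<zero>\<^bsub>restrict_scalars \<pi> M\<^esub> = \<zero>\<^bsub>M\<^esub>"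
  "x \<oplus>\<^bsub>restrict_scalars \<pi> M\<^esub> y = x \<oplus>\<^bsub>M\<^esub> y" "a \<odot>\<^bsub>restrict_scalars \<pi> M\<^esub> x = \<pi> a \<odot>\<^bsub>M\<^esub> x"
  by (simp_all add: restrict_scalars_def)

context split_ring_hom
begin

lemmas hom_closed = ring_hom_closed[OF ring_hom] and hom_mult = ring_hom_mult[OF ring_hom]
  and hom_add = ring_hom_add[OF ring_hom] and hom_one = ring_hom_one[OF ring_hom]

lemma hom_zero: "\<pi> \<zero>\<^bsub>A\<^esub> = \<zero>\<^bsub>B\<^esub>"
proof -
  have "\<pi> \<zero>\<^bsub>A\<^esub> \<oplus>\<^bsub>B\<^esub> \<pi> \<zero>\<^bsub>A\<^esub> = \<pi> \<zero>\<^bsub>A\<^esub>" using hom_add[of "\<zero>\<^bsub>A\<^esub>" "\<zero>\<^bsub>A\<^esub>"] by simp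
  then show ?thesis using hom_closed[of "\<zero>\<^bsub>A\<^esub>"] by (metis A.zero_closed B.add.l_cancel_one')
qed

lemma s_zero: "s \<zero>\<^bsub>B\<^esub> = \<zero>\<^bsub>A\<^esub>"
proof -
  have "s \<zero>\<^bsub>B\<^esub> \<oplus>\<^bsub>A\<^esub> s \<zero>\<^bsub>B\<^esub> = s \<zero>\<^bsub>B\<^esub>" using s_add[of "\<zero>\<^bsub>B\<^esub>" "\<zero>\<^bsub>B\<^esub>"] by simp
  then show ?thesis using s_closed[of "\<zero>\<^bsub>B\<^esub>"] by (metis B.zero_closed A.add.l_cancel_one')
qed

lemma right_module_restrict:
  assumes "right_module B M"
  shows "right_module A (restrict_scalars \<pi> M)"
proof -
  interpret right_module B M by fact
  show ?thesis
  proof (rule right_moduleI[OF A.ring_axioms])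
    show "abelian_group (restrict_scalars \<pi> M)"
      by (rule abelian_groupI) (auto simp: M.add.m_ac intro: M.l_neg bexI[of _ "\<ominus>\<^bsub>M\<^esub> _"])
  qed (simp_all add: hom_closed hom_add hom_mult hom_one smult_l_distr smult_r_distr smult_assoc)
qed

lemma mod_hom_restrict:
  assumes "f \<in> mod_hom B M N"
  shows "f \<in> mod_hom A (restrict_scalars \<pi> M) (restrict_scalars \<pi> N)"
  by (rule mod_homI) (simp_all add: mod_homD[OF assms] hom_closed)

lemma fin_supp_hom: "u \<in> fin_supp A X \<Longrightarrow> (\<lambda>x. \<pi> (u x)) \<in> fin_supp B X"
proof -
  have "{x. \<pi> (u x) \<noteq> \<zero>\<^bsub>B\<^esub>} \<subseteq> {x. u x \<noteq> \<zero>\<^bsub>A\<^esub>}" using hom_zero by auto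
  then show "u \<in> fin_supp A X \<Longrightarrow> ?thesis"
    by (auto simp: fin_supp_def hom_closed hom_zero intro: finite_subset)
qed

lemma fin_supp_section: "u \<in> fin_supp B X \<Longrightarrow> (\<lambda>x. s (u x)) \<in> fin_supp A X"
proof -
  have "{x. s (u x) \<noteq> \<zero>\<^bsub>A\<^esub>} \<subseteq> {x. u x \<noteq> \<zero>\<^bsub>B\<^esub>}" using s_zero by auto
  then show "u \<in> fin_supp B X \<Longrightarrow> ?thesis"
    by (auto simp: fin_supp_def s_closed s_zero intro: finite_subset)
qed

text \<open>Applying \<open>s\<close> and \<pi> to coordinates makes the free
  \<open>B\<close>-module on \<open>X\<close> a retract of the free \<open>A\<close>-module on the
  same \<open>X\<close>; this is composed with the retraction that \<open>P\<close> comes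
  with.\<close>

lemma projective_restrict:
  fixes P :: "('b, 'p) module"
  assumes "projective B P"
  shows "projective A (restrict_scalars \<pi> P)"
proof -
  obtain X :: "'p set" and i r where i: "i \<in> mod_hom B P (free_module B X)"
    and r: "r \<in> mod_hom B (free_module B X) P" and ri: "\<And>x. x \<in> carrier P \<Longrightarrow> r (i x) = x"
    using assms unfolding projective_def by blast
  have iX: "i x \<in> fin_supp B X" if "x \<in> carrier P" for x
    using mod_hom_closed[OF i that] by (simp add: free_module_simps)
  have i': "(\<lambda>x y. s (i x y)) \<in> mod_hom A (restrict_scalars \<pi> P) (free_module A X)"
    by (rule mod_homI)
      (simp_all add: free_module_simps fin_supp_section iX mod_hom_add[OF i] mod_hom_smult[OF i] hom_closed
        s_add s_linear B.fin_supp_closed[OF iX])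
  have r': "(\<lambda>u. r (\<lambda>x. \<pi> (u x))) \<in> mod_hom A (free_module A X) (restrict_scalars \<pi> P)"
    by (rule mod_homI)
      (simp_all add: free_module_simps fin_supp_hom mod_homD(1)[OF r] hom_add hom_mult hom_closed
        A.fin_supp_closed[where X = X] flip: mod_hom_add[OF r] mod_hom_smult[OF r])
  have "r (\<lambda>y. \<pi> (s (i x y))) = x" if "x \<in> carrier P" for x
    by (simp add: hom_section B.fin_supp_closed[OF iX[OF that]] ri[OF that])
  then have "\<forall>x\<in>carrier (restrict_scalars \<pi> P). r (\<lambda>y. \<pi> (s (i x y))) = x" by simp
  then show ?thesis
    unfolding projective_def
    by (intro conjI right_module_restrict[OF projective_right_module[OF assms]] exI[of _ X] bexI[OF _ i'] bexI[OF _ r'])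
qed

text \<open>\<open>M'\<close> agrees with the restriction of \<open>M\<close> on carriers instead of
  being the same record, because the actions on the two trivial modules are compared just for
  elements of the algebra.\<close>

lemma projective_resolution_restrict:
  assumes "projective_resolution B M P d aug"
    and M': "carrier M' = carrier M" "\<zero>\<^bsub>M'\<^esub> = \<zero>\<^bsub>M\<^esub>"
      "\<And>x y. \<lbrakk>x \<in> carrier M; y \<in> carrier M\<rbrakk> \<Longrightarrow> x \<oplus>\<^bsub>M'\<^esub> y = x \<oplus>\<^bsub>M\<^esub> y"
      "\<And>a x. \<lbrakk>a \<in> carrier A; x \<in> carrier M\<rbrakk> \<Longrightarrow> a \<odot>\<^bsub>M'\<^esub> x = \<pi> a \<odot>\<^bsub>M\<^esub> x"
  shows "projective_resolution A M' (\<lambda>k. restrict_scalars \<pi> (P k)) d aug"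
proof -
  have aug: "aug \<in> mod_hom B (P 0) M" using assms(1) by (simp add: projective_resolution_def)
  have "aug \<in> mod_hom A (restrict_scalars \<pi> (P 0)) M'"
    by (rule mod_homI) (simp_all add: M' mod_homD[OF aug] hom_closed)
  then show ?thesis
    using assms(1)
    by (auto simp: projective_resolution_def M'(1,2) intro: projective_restrict mod_hom_restrict)
qed

end

section \<open>Tensor products and Tor under restriction of scalars\<close>

text \<open>Every element of \<open>B\<close> has the form \<open>\<pi> (s a)\<close>, so balancing
  over \<open>A\<close> and over \<open>B\<close> yields the same relations. Equality of the
  generating sets makes the tensor products equal as records.\<close>

lemma tensor_gen_rels_restrict:
  fixes R :: "('r, 'c) ring_scheme" and A :: "('r, 'a, 'd) module_scheme" and B :: "('r, 'b, 'e) module_scheme"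
  assumes "split_ring_hom A B \<pi> s"
    and scalar: "\<And>r. r \<in> carrier R \<Longrightarrow> r \<odot>\<^bsub>A\<^esub> \<one>\<^bsub>A\<^esub> \<in> carrier A \<and> \<pi> (r \<odot>\<^bsub>A\<^esub> \<one>\<^bsub>A\<^esub>) = r \<odot>\<^bsub>B\<^esub> \<one>\<^bsub>B\<^esub>"
    and N': "carrier N' = carrier N" "\<And>x y. \<lbrakk>x \<in> carrier N; y \<in> carrier N\<rbrakk> \<Longrightarrow> x \<oplus>\<^bsub>N'\<^esub> y = x \<oplus>\<^bsub>N\<^esub> y"
      "\<And>a x. \<lbrakk>a \<in> carrier A; x \<in> carrier N\<rbrakk> \<Longrightarrow> a \<odot>\<^bsub>N'\<^esub> x = \<pi> a \<odot>\<^bsub>N\<^esub> x"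
  shows "tensor_gen_rels R A (restrict_scalars \<pi> M) N' = tensor_gen_rels R B M N"
proof -
  interpret split_ring_hom A B \<pi> s by fact
  \<comment> \<open>This and the next two facts compare the families of relations with the relation
    abstracted to \<open>f\<close>, so that the free module does not appear in the set
    comprehensions.\<close>
  have add: "{f p (m \<oplus>\<^bsub>N'\<^esub> n) m n | p m n. p \<in> carrier M \<and> m \<in> carrier N \<and> n \<in> carrier N} =
      {f p (m \<oplus>\<^bsub>N\<^esub> n) m n | p m n. p \<in> carrier M \<and> m \<in> carrier N \<and> n \<in> carrier N}"
    for f :: "_ \<Rightarrow> _ \<Rightarrow> _ \<Rightarrow> _ \<Rightarrow> 'y"
    by (intro Collect_cong ex_cong1) (auto simp: N'(2))
  have balanced: "{f (\<pi> a \<odot>\<^bsub>M\<^esub> p) p (a \<odot>\<^bsub>N'\<^esub> n) n | p a n. p \<in> carrier M \<and> a \<in> carrier A \<and> n \<in> carrier N} =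
      {f (a \<odot>\<^bsub>M\<^esub> p) p (a \<odot>\<^bsub>N\<^esub> n) n | p a n. p \<in> carrier M \<and> a \<in> carrier B \<and> n \<in> carrier N}"
    (is "?L = ?R") for f :: "_ \<Rightarrow> _ \<Rightarrow> _ \<Rightarrow> _ \<Rightarrow> 'y"
  proof
    show "?L \<subseteq> ?R" using hom_closed by (auto simp: N'(3)) blast
    show "?R \<subseteq> ?L"
    proof
      fix y assume "y \<in> ?R"
      then obtain p a n where y: "y = f (a \<odot>\<^bsub>M\<^esub> p) p (a \<odot>\<^bsub>N\<^esub> n) n"
        and c: "p \<in> carrier M" "a \<in> carrier B" "n \<in> carrier N" by blast
      then have "y = f (\<pi> (s a) \<odot>\<^bsub>M\<^esub> p) p (s a \<odot>\<^bsub>N'\<^esub> n) n"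
        by (simp add: N'(3) s_closed hom_section)
      then show "y \<in> ?L" using c s_closed by blast
    qed
  qed
  have scal: "{f (\<pi> (r \<odot>\<^bsub>A\<^esub> \<one>\<^bsub>A\<^esub>) \<odot>\<^bsub>M\<^esub> p) r p n | p r n. p \<in> carrier M \<and> r \<in> carrier R \<and> n \<in> carrier N} =
      {f ((r \<odot>\<^bsub>B\<^esub> \<one>\<^bsub>B\<^esub>) \<odot>\<^bsub>M\<^esub> p) r p n | p r n. p \<in> carrier M \<and> r \<in> carrier R \<and> n \<in> carrier N}"
    for f :: "_ \<Rightarrow> _ \<Rightarrow> _ \<Rightarrow> _ \<Rightarrow> 'y"
    by (intro Collect_cong ex_cong1) (auto simp: scalar)
  let ?F = "free_module R (carrier M \<times> carrier N)" and ?b = "basis_elt R"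
  show ?thesis
    unfolding tensor_gen_rels_def Let_def restrict_scalars_simps N'(1)
    by (intro arg_cong2[of _ _ _ _ "(\<union>)"] refl
        add[of "\<lambda>p y m n. ?b (p, y) \<ominus>\<^bsub>?F\<^esub> (?b (p, m) \<oplus>\<^bsub>?F\<^esub> ?b (p, n))"]
        balanced[of "\<lambda>q p y n. ?b (q, n) \<ominus>\<^bsub>?F\<^esub> ?b (p, y)"]
        scal[of "\<lambda>q r p n. ?b (q, n) \<ominus>\<^bsub>?F\<^esub> r \<odot>\<^bsub>?F\<^esub> ?b (p, n)"])
qed

text \<open>Over \<open>A\<close>, the module \<open>M'\<close> has two resolutions: the chosen one
  and the restriction of the one chosen for \<open>M\<close> over \<open>B\<close>. The latter
  gives, after tensoring, literally the complex that defines Tor over \<open>B\<close>.\<close>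

theorem Tor_iso_split_ring_hom:
  fixes R :: "('r, 'c) ring_scheme" and A :: "('r, 'a, 'd) module_scheme" and B :: "('r, 'b, 'e) module_scheme"
    and M :: "('b, 'm) module" and M' :: "('a, 'm) module"
  assumes "cring R" and split: "split_ring_hom A B \<pi> s"
    and scalar: "\<And>r. r \<in> carrier R \<Longrightarrow> r \<odot>\<^bsub>A\<^esub> \<one>\<^bsub>A\<^esub> \<in> carrier A \<and> \<pi> (r \<odot>\<^bsub>A\<^esub> \<one>\<^bsub>A\<^esub>) = r \<odot>\<^bsub>B\<^esub> \<one>\<^bsub>B\<^esub>"
    and M: "right_module B M" and M': "right_module A M'"
      "carrier M' = carrier M" "\<zero>\<^bsub>M'\<^esub> = \<zero>\<^bsub>M\<^esub>"
      "\<And>x y. \<lbrakk>x \<in> carrier M; y \<in> carrier M\<rbrakk> \<Longrightarrow> x \<oplus>\<^bsub>M'\<^esub> y = x \<oplus>\<^bsub>M\<^esub> y"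
      "\<And>a x. \<lbrakk>a \<in> carrier A; x \<in> carrier M\<rbrakk> \<Longrightarrow> a \<odot>\<^bsub>M'\<^esub> x = \<pi> a \<odot>\<^bsub>M\<^esub> x"
    and N': "left_module A N'"
      "carrier N' = carrier N" "\<And>x y. \<lbrakk>x \<in> carrier N; y \<in> carrier N\<rbrakk> \<Longrightarrow> x \<oplus>\<^bsub>N'\<^esub> y = x \<oplus>\<^bsub>N\<^esub> y"
      "\<And>a x. \<lbrakk>a \<in> carrier A; x \<in> carrier N\<rbrakk> \<Longrightarrow> a \<odot>\<^bsub>N'\<^esub> x = \<pi> a \<odot>\<^bsub>N\<^esub> x"
  shows "mod_iso R (Tor R A M' N' k) (Tor R B M N k)"
proof -
  interpret split_ring_hom A B \<pi> s by fact
  interpret R: cring R by fact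
  interpret N': left_module A N' by fact
  interpret tensor_functor R A N'
    using scalar by unfold_locales simp
  obtain P d aug where P: "chosen_resolution A M' = (P, d)" "projective_resolution A M' P d aug"
    using projective_resolution_exists[OF M'(1)] by (metis prod.collapse)
  obtain Q e aug' where Q: "chosen_resolution B M = (Q, e)" "projective_resolution B M Q e aug'"
    using projective_resolution_exists[OF M] by (metis prod.collapse)
  note gen = tensor_gen_rels_restrict[OF split scalar N'(2-4)]
  have rels: "tensor_rels R A (restrict_scalars \<pi> L) N' = tensor_rels R B L N" for L :: "('b, 'l) module"
    by (simp add: tensor_rels_def gen N'(2))
  have prod: "tensor_product R A (restrict_scalars \<pi> L) N' = tensor_product R B L N" for L :: "('b, 'l) module"
    by (simp add: tensor_product_def rels N'(2))
  have map: "tensor_map R A (restrict_scalars \<pi> L) N' f = tensor_map R B L N f" for L :: "('b, 'l) module" and f :: "'k \<Rightarrow> 'l"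
    by (simp add: tensor_map_def rels N'(2) fun_eq_iff)
  show ?thesis
    using tensor_homology_iso[OF P(2) projective_resolution_restrict[OF Q(2) M'(2-5)] M'(1), of k]
    by (simp add: Tor_def P(1) Q(1) prod map)
qed


section \<open>Permutation diagrams\<close>

declare One_nat_def [simp del]

text \<open>With the edges \<open>(p i, i)\<close>, composition of diagrams corresponds to \<open>p \<circ> q\<close>.\<close>

definition perm_diagram :: "nat \<Rightarrow> (nat \<Rightarrow> nat) \<Rightarrow> (nat \<times> nat) set" where
  "perm_diagram n p = (\<lambda>i. (p i, i)) ` {1..n}"

lemma perm_diagram_rook:
  assumes p: "p permutes {1..n}"
  shows "perm_diagram n p \<in> rook_diagrams n" "Domain (perm_diagram n p) = {1..n}" "Range (perm_diagram n p) = {1..n}"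
proof -
  have sub: "perm_diagram n p \<subseteq> {1..n} \<times> {1..n}"
    using permutes_in_image[OF p] by (auto simp: perm_diagram_def simp del: atLeastAtMost_iff)
  moreover have "single_valued (perm_diagram n p)" "single_valued ((perm_diagram n p)\<inverse>)"
    using permutes_inj[OF p] by (auto simp: perm_diagram_def single_valued_def inj_eq)
  ultimately show x: "perm_diagram n p \<in> rook_diagrams n" by (simp add: rook_diagrams_def)
  show R: "Range (perm_diagram n p) = {1..n}" by (auto simp: perm_diagram_def)
  then show "Domain (perm_diagram n p) = {1..n}" using rook_perfect[OF x] by simp
qed

lemma inj_perm_diagram: "inj_on (perm_diagram n) {p. p permutes {1..n}}"
proof (rule inj_onI)
  fix p q assume p: "p \<in> {p. p permutes {1..n}}" and q: "q \<in> {p. p permutes {1..n}}"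
    and eq: "perm_diagram n p = perm_diagram n q"
  show "p = q"
  proof
    fix i
    show "p i = q i"
    proof (cases "i \<in> {1..n}")
      case True
      then have "(p i, i) \<in> perm_diagram n p" by (auto simp: perm_diagram_def)
      then have "(p i, i) \<in> perm_diagram n q" by (simp only: eq)
      then show ?thesis by (auto simp: perm_diagram_def)
    qed (use p q in \<open>simp add: permutes_not_in del: atLeastAtMost_iff\<close>)
  qed
qed

text \<open>By \<open>rook_perfect\<close> every right node has an edge as well, so its left
  neighbour defines \<open>p\<close> on all of \<open>{1..n}\<close>; elsewhere \<open>p\<close> is
  the identity, as \<open>permutes\<close> demands.\<close>

lemma perfect_rook_perm_diagram:
  assumes x: "x \<in> rook_diagrams n" and "Domain x = {1..n}"
  shows "\<exists>p. p permutes {1..n} \<and> perm_diagram n p = x"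
proof -
  have sub: "x \<subseteq> {1..n} \<times> {1..n}" and sv: "single_valued x" "single_valued (x\<inverse>)"
    using x by (auto simp: rook_diagrams_def)
  have R: "Range x = {1..n}" using rook_perfect[OF x] assms(2) by simp
  define p where "p i = (if i \<in> {1..n} then THE j. (j, i) \<in> x else i)" for i
  have px: "(j, i) \<in> x \<longleftrightarrow> i \<in> {1..n} \<and> p i = j" for i j
  proof
    assume j: "(j, i) \<in> x"
    then have "(THE j. (j, i) \<in> x) = j" using sv(2) by (intro the_equality) (auto simp: single_valued_def)
    then show "i \<in> {1..n} \<and> p i = j" using j sub by (auto simp: p_def)
  next
    assume i: "i \<in> {1..n} \<and> p i = j"
    then obtain j' where j': "(j', i) \<in> x" using R by blast
    then have "(THE j. (j, i) \<in> x) = j'" using sv(2) by (intro the_equality) (auto simp: single_valued_def)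
    then have "p i = j'" using i unfolding p_def by metis
    then show "(j, i) \<in> x" using i j' by simp
  qed
  have "inj_on p {1..n}" using px sv(1) by (auto simp: inj_on_def single_valued_def)
  moreover have "p ` {1..n} \<subseteq> {1..n}" using px sub by blast
  ultimately have "bij_betw p {1..n} {1..n}"
    by (simp add: bij_betw_def endo_inj_surj)
  then have "p permutes {1..n}" by (rule bij_imp_permutes) (simp only: p_def if_False)
  moreover have "perm_diagram n p = x" using px by (auto simp: perm_diagram_def)
  ultimately show ?thesis by blast
qed

lemma perm_diagram_comp:
  assumes "q permutes {1..n}"
  shows "perm_diagram n p O perm_diagram n q = perm_diagram n (p \<circ> q)"
  using permutes_in_image[OF assms] by (force simp: perm_diagram_def relcomp_unfold simp del: atLeastAtMost_iff)

lemma perm_diagram_id: "perm_diagram n id = Id_on {1..n}"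
  by (auto simp: perm_diagram_def)

text \<open>Composition cannot create edges at the left nodes of \<open>x\<close> or at the right
  nodes of \<open>y\<close>. Read contrapositively, diagrams with a missing edge span an ideal, the
  kernel of the quotient map.\<close>

lemma perfect_comp:
  assumes x: "x \<in> rook_diagrams n" and y: "y \<in> rook_diagrams n" and D: "Domain (x O y) = {1..n}"
  shows "Domain x = {1..n}" "Domain y = {1..n}"
proof -
  have "Domain x \<subseteq> {1..n}" "Range y \<subseteq> {1..n}" using x y by (auto simp: rook_diagrams_def)
  moreover have "Range (x O y) = {1..n}" using rook_perfect[OF rook_O[OF x y]] D by simp
  ultimately show "Domain x = {1..n}" "Domain y = {1..n}"
    using D rook_perfect[OF y] by blast+
qed

lemma finite_rook_diagrams: "finite (rook_diagrams n)"
  by (rule finite_subset[of _ "Pow ({1..n} \<times> {1..n})"]) (auto simp: rook_diagrams_def)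

lemma fin_supp_finite: "finite X \<Longrightarrow> f \<in> fin_supp R X \<longleftrightarrow> (\<forall>x\<in>X. f x \<in> carrier R) \<and> (\<forall>x. x \<notin> X \<longrightarrow> f x = \<zero>\<^bsub>R\<^esub>)"
  by (auto simp: fin_supp_def intro: finite_subset[of _ X])


section \<open>The quotient map from the rook algebra to the group algebra\<close>

definition rook_proj :: "('r, 'c) ring_scheme \<Rightarrow> nat \<Rightarrow> ((nat \<times> nat) set \<Rightarrow> 'r) \<Rightarrow> (nat \<Rightarrow> nat) \<Rightarrow> 'r" where
  "rook_proj R n a = (\<lambda>p. if p permutes {1..n} then a (perm_diagram n p) else \<zero>\<^bsub>R\<^esub>)"

text \<open>The linear section that sends a permutation to its diagram. In general it does not
  respect the right action of the rook algebra, which is why a factor \<open>f\<close> is put in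
  front of it later.\<close>

definition rook_lift :: "('r, 'c) ring_scheme \<Rightarrow> nat \<Rightarrow> ((nat \<Rightarrow> nat) \<Rightarrow> 'r) \<Rightarrow> (nat \<times> nat) set \<Rightarrow> 'r" where
  "rook_lift R n b = (\<lambda>x. if x \<in> perm_diagram n ` {p. p permutes {1..n}}
     then b (inv_into {p. p permutes {1..n}} (perm_diagram n) x) else \<zero>\<^bsub>R\<^esub>)"

context
  fixes R :: "('r, 'c) ring_scheme" (structure) and n :: nat and \<epsilon> :: 'r
  assumes R: "cring R" and \<epsilon>: "\<epsilon> \<in> Units R"
begin

interpretation cring R by (rule R)

lemma \<epsilon>_closed: "\<epsilon> \<in> carrier R" by (rule Units_closed[OF \<epsilon>])

interpretation rook: based_algebra R "rook_diagrams n" "\<lambda>x y. \<epsilon> [^] isolated_middle n x y" rook_comp "Id_on {1..n}"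
  "\<lambda>x. if Domain x = {1..n} \<and> Range x = {1..n} then \<one> else \<zero>"
  by (rule rook_based[OF R \<epsilon>_closed])

interpretation grp: based_algebra R "carrier (sym_group n)" "\<lambda>_ _. \<one>" "(\<otimes>\<^bsub>sym_group n\<^esub>)" "\<one>\<^bsub>sym_group n\<^esub>" "\<lambda>_. \<one>"
  by (rule group_based[OF R sym_group_is_group])

abbreviation "X \<equiv> rook_diagrams n"
abbreviation "S \<equiv> carrier (sym_group n)"
abbreviation "bas \<equiv> basis_elt R"
abbreviation "\<pi> \<equiv> rook_proj R n"
abbreviation "lift \<equiv> rook_lift R n"

lemma rook_algebra_eq: "rook_algebra R n \<epsilon> = rook.A"
  by (simp add: rook_algebra_def rook.A_def)

lemma group_algebra_eq: "group_algebra R (sym_group n) = grp.A"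
  by (simp add: group_algebra_def grp.A_def)

lemma group_algebra_one: "\<one>\<^bsub>grp.A\<^esub> = bas id"
  by (subst grp.A_simps(3)) (simp only: sym_group_one)

lemma finite_S: "finite S"
  using finite_permutations[of "{1..n}"] by (simp add: sym_group_def)

lemma rook_proj_closed: "a \<in> fin_supp R X \<Longrightarrow> \<pi> a \<in> fin_supp R S"
  using perm_diagram_rook[of _ n] fin_supp_closed[of a X]
  by (simp add: fin_supp_finite[OF finite_S] rook_proj_def sym_group_carrier)

lemma rook_lift_closed: "b \<in> fin_supp R S \<Longrightarrow> lift b \<in> fin_supp R X"
  using perm_diagram_rook[of _ n] fin_supp_closed[of b S]
  by (auto simp: fin_supp_finite[OF finite_rook_diagrams] rook_lift_def)

lemma rook_proj_lift: "b \<in> fin_supp R S \<Longrightarrow> \<pi> (lift b) = b"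
  by (auto simp: rook_proj_def rook_lift_def fun_eq_iff fin_supp_def sym_group_carrier inv_into_f_f[OF inj_perm_diagram])

lemma rook_lift_proj: "lift (\<pi> a) = (\<lambda>x. if x \<in> perm_diagram n ` {p. p permutes {1..n}} then a x else \<zero>)"
  by (auto simp: rook_proj_def rook_lift_def fun_eq_iff inv_into_f_f[OF inj_perm_diagram])

lemma rook_proj_linear:
  assumes "r \<in> carrier R"
  shows "\<pi> (\<lambda>y. g y \<oplus> r \<otimes> h y) = (\<lambda>p. \<pi> g p \<oplus> r \<otimes> \<pi> h p)"
  using assms by (auto simp: rook_proj_def fun_eq_iff)

lemma rook_proj_smult: "r \<in> carrier R \<Longrightarrow> \<pi> (\<lambda>y. r \<otimes> h y) = (\<lambda>p. r \<otimes> \<pi> h p)"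
  by (auto simp: rook_proj_def fun_eq_iff)

lemma rook_proj_zero: "\<pi> (\<lambda>_. \<zero>) = (\<lambda>_. \<zero>)"
  by (auto simp: rook_proj_def fun_eq_iff)

lemma rook_proj_bas_perm:
  assumes "p permutes {1..n}"
  shows "\<pi> (bas (perm_diagram n p)) = bas p"
proof
  fix q
  show "\<pi> (bas (perm_diagram n p)) q = bas p q"
    using assms by (cases "q = p") (auto simp: rook_proj_def basis_elt_def inj_on_eq_iff[OF inj_perm_diagram])
qed

lemma rook_proj_bas_imperfect: "Domain x \<noteq> {1..n} \<Longrightarrow> \<pi> (bas x) = (\<lambda>_. \<zero>)"
  using perm_diagram_rook(2) by (auto simp: rook_proj_def basis_elt_def fun_eq_iff)

lemma isolated_middle_perfect: "\<lbrakk>x \<in> X; Domain x = {1..n}\<rbrakk> \<Longrightarrow> isolated_middle n x y = 0"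
  using rook_perfect[of x n] by (simp add: isolated_eq)

text \<open>If no edge is missing, then no middle node is isolated and the weight is 1. Otherwise
  the product lacks an edge too, and both sides vanish.\<close>

lemma rook_proj_mult_bas:
  assumes x: "x \<in> X" and y: "y \<in> X"
  shows "\<pi> (bas x \<otimes>\<^bsub>rook.A\<^esub> bas y) = \<pi> (bas x) \<otimes>\<^bsub>grp.A\<^esub> \<pi> (bas y)"
proof -
  have eq: "\<pi> (bas x \<otimes>\<^bsub>rook.A\<^esub> bas y) = (\<lambda>p. \<epsilon> [^] isolated_middle n x y \<otimes> \<pi> (bas (x O y)) p)"
    using \<epsilon>_closed by (simp add: rook.bas_mult[OF x y] rook_proj_smult rook_comp_eq[OF x y])
  show ?thesis
  proof (cases "Domain x = {1..n} \<and> Domain y = {1..n}")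
    case True
    then obtain p q where p: "p permutes {1..n}" "perm_diagram n p = x"
      and q: "q permutes {1..n}" "perm_diagram n q = y"
      using perfect_rook_perm_diagram x y by metis
    have "\<pi> (bas (x O y)) = bas (p \<circ> q)"
      using rook_proj_bas_perm[OF permutes_compose[OF q(1) p(1)]] perm_diagram_comp[OF q(1)] p q by metis
    moreover have "\<pi> (bas x) = bas p" "\<pi> (bas y) = bas q" using rook_proj_bas_perm p q by blast+
    moreover have "bas p \<otimes>\<^bsub>grp.A\<^esub> bas q = (\<lambda>z. \<one> \<otimes> bas (p \<circ> q) z)"
      using p q grp.bas_mult[of p q] by (simp add: sym_group_carrier sym_group_mult)
    ultimately show ?thesis using True x by (simp add: eq isolated_middle_perfect)
  next
    case False
    then have "\<pi> (bas (x O y)) = (\<lambda>_. \<zero>)"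
      using perfect_comp[OF x y] by (intro rook_proj_bas_imperfect) blast
    then have "\<pi> (bas x \<otimes>\<^bsub>rook.A\<^esub> bas y) = (\<lambda>_. \<zero>)" using \<epsilon>_closed by (simp add: eq)
    moreover have "\<pi> (bas x) \<otimes>\<^bsub>grp.A\<^esub> \<pi> (bas y) = (\<lambda>_. \<zero>)"
      using False rook_proj_bas_imperfect[of x] rook_proj_bas_imperfect[of y]
        rook_proj_closed[OF rook.bas_in[OF x]] rook_proj_closed[OF rook.bas_in[OF y]]
      by (cases "Domain x = {1..n}") simp_all
    ultimately show ?thesis by simp
  qed
qed

lemma rook_proj_mult:
  assumes f: "f \<in> fin_supp R X" and g: "g \<in> fin_supp R X"
  shows "\<pi> (f \<otimes>\<^bsub>rook.A\<^esub> g) = \<pi> f \<otimes>\<^bsub>grp.A\<^esub> \<pi> g"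
proof -
  have 1: "\<pi> (bas x \<otimes>\<^bsub>rook.A\<^esub> g) = \<pi> (bas x) \<otimes>\<^bsub>grp.A\<^esub> \<pi> g" if x: "x \<in> X" for x
    using g
  proof (induction g rule: rook.induct_fs)
    case (add y r g)
    then show ?case
      using x by (simp add: rook.fs rook.r_distr' rook.smult_r rook_proj_linear rook_proj_mult_bas
        rook_proj_closed grp.fs grp.r_distr' grp.smult_r)
  qed (simp add: x rook.fs rook_proj_zero rook_proj_closed)
  show ?thesis
    using f
  proof (induction f rule: rook.induct_fs)
    case (add x r f)
    then show ?case
      using g by (simp add: rook.fs rook.l_distr' rook.smult_l rook_proj_linear 1
        rook_proj_closed grp.fs grp.l_distr' grp.smult_l)
  qed (simp add: g rook_proj_zero rook_proj_closed)
qed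

text \<open>\<open>chi\<close> is the scalar by which an element acts on the trivial module, so this
  makes the trivial rook module a restriction along \<pi>.\<close>

lemma rook_proj_chi: "f \<in> fin_supp R X \<Longrightarrow> rook.chi f = grp.chi (\<pi> f)"
proof (induction f rule: rook.induct_fs)
  case zero
  show ?case by (simp add: rook.chi_zero grp.chi_zero rook_proj_zero)
next
  case (add x r f)
  have "rook.chi (bas x) = grp.chi (\<pi> (bas x))"
  proof (cases "Domain x = {1..n}")
    case True
    then obtain p where p: "p permutes {1..n}" "perm_diagram n p = x"
      using perfect_rook_perm_diagram[OF add(1)] by blast
    then have "\<pi> (bas x) = bas p" using rook_proj_bas_perm by blast
    then show ?thesis
      using True rook_perfect[OF add(1)] p(1) grp.chi_bas[of p]
      by (simp add: rook.chi_bas[OF add(1)] sym_group_carrier)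
  next
    case False
    then show ?thesis by (simp add: rook.chi_bas[OF add(1)] rook_proj_bas_imperfect grp.chi_zero)
  qed
  then show ?case
    using add by (simp add: rook.fs grp.fs rook.chi_add rook.chi_smult grp.chi_add grp.chi_smult
      rook_proj_linear rook_proj_closed)
qed

text \<open>
  Left multiplication by \<open>1 - \<epsilon>\<inverse> e\<close>, where \<open>e\<close> is the identity diagram without the edge at \<open>i\<close>, kills
  the diagrams without an edge at the left node \<open>i\<close>, and does not destroy missing edges. So the product of
  these elements is sent to \<open>1\<close> in the group algebra and annihilates the kernel from the left.
\<close>

lemma rook_annihilator_exists:
  "k \<le> n \<Longrightarrow> \<exists>f\<in>fin_supp R X. \<pi> f = bas id \<and>
    (\<forall>x\<in>X. (\<exists>i\<in>{1..k}. i \<notin> Domain x) \<longrightarrow> f \<otimes>\<^bsub>rook.A\<^esub> bas x = (\<lambda>_. \<zero>))"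
proof (induction k)
  case 0
  have "\<pi> (bas (Id_on {1..n})) = bas id"
    using rook_proj_bas_perm[OF permutes_id] by (simp only: perm_diagram_id)
  then have "\<pi> (bas (Id_on {1..n})) = bas id \<and>
      (\<forall>x\<in>X. (\<exists>i\<in>{1..0}. i \<notin> Domain x) \<longrightarrow> bas (Id_on {1..n}) \<otimes>\<^bsub>rook.A\<^esub> bas x = (\<lambda>_. \<zero>))"
    by simp
  then show ?case using rook.bas_in[OF rook.e_closed] by blast
next
  case (Suc k)
  obtain f where f: "f \<in> fin_supp R X" "\<pi> f = bas id"
    and fk: "\<And>x i. \<lbrakk>x \<in> X; i \<in> {1..k}; i \<notin> Domain x\<rbrakk> \<Longrightarrow> f \<otimes>\<^bsub>rook.A\<^esub> bas x = (\<lambda>_. \<zero>)"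
    using Suc.IH[OF Suc_leD[OF Suc.prems]] by blast
  define e where "e = Id_on ({1..n} - {Suc k})"
  have "Suc k \<in> {1..n}" "Domain e = {1..n} - {Suc k}" using Suc.prems by (simp_all add: e_def Domain_Id_on)
  then have "Domain e \<noteq> {1..n}" by blast
  moreover have "e \<in> X" by (auto simp: e_def rook_diagrams_def single_valued_def)
  ultimately have e: "e \<in> X" "Domain e \<noteq> {1..n}" by simp_all
  \<comment> \<open>If \<open>x\<close> has no edge at \<open>Suc k\<close>, one isolated middle
    node contributes a factor \<epsilon>, which \<open>c\<close> reduces to -1.\<close>
  define c where "c = \<ominus> (inv \<epsilon>)"
  have c: "c \<in> carrier R" "c \<otimes> \<epsilon> = \<ominus> \<one>" 
    using Units_inv_closed[OF \<epsilon>] \<epsilon>_closed Units_l_inv[OF \<epsilon>] by (simp_all add: c_def l_minus)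
  define u where "u = (\<lambda>y. bas (Id_on {1..n}) y \<oplus> c \<otimes> bas e y)"
  have u: "u \<in> fin_supp R X" unfolding u_def using c e by (simp add: rook.fs rook.e_closed)
  have ux: "u \<otimes>\<^bsub>rook.A\<^esub> bas x = (\<lambda>y. bas x y \<oplus> c \<otimes> (\<epsilon> [^] isolated_middle n e x \<otimes> bas (e O x) y))"
    if x: "x \<in> X" for x
    using x c e \<epsilon>_closed unfolding u_def
    by (simp add: rook.fs rook.e_closed rook.l_distr' rook.smult_l rook.bas_mult rook.unit rook_comp_eq[OF e(1) x]
        fin_supp_closed[OF rook.bas_in[OF x]])
  have "\<pi> (f \<otimes>\<^bsub>rook.A\<^esub> u) = bas id"
  proof -
    have "\<pi> u = (\<lambda>p. bas id p \<oplus> c \<otimes> \<zero>)"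
      unfolding u_def using c rook_proj_bas_perm[OF permutes_id]
      by (simp add: rook_proj_linear perm_diagram_id rook_proj_bas_imperfect[OF e(2)])
    also have "\<dots> = bas id"
      using c grp.bas_in[of id] by (auto simp: basis_elt_def)
    finally have "\<pi> u = bas id" .
    then have "\<pi> (f \<otimes>\<^bsub>rook.A\<^esub> u) = \<one>\<^bsub>grp.A\<^esub> \<otimes>\<^bsub>grp.A\<^esub> \<one>\<^bsub>grp.A\<^esub>"
      by (simp add: rook_proj_mult f u group_algebra_one)
    also have "\<dots> = bas id"
      using ring.ring_simprules(12)[OF grp.ring_A ring.ring_simprules(6)[OF grp.ring_A]]
      by (simp add: group_algebra_one)
    finally show ?thesis .
  qed
  moreover have "(f \<otimes>\<^bsub>rook.A\<^esub> u) \<otimes>\<^bsub>rook.A\<^esub> bas x = (\<lambda>_. \<zero>)" if x: "x \<in> X" and i: "i \<in> {1..Suc k}" "i \<notin> Domain x" for x i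
  proof -
    have ex: "e O x \<in> X" by (rule rook_O[OF e(1) x])
    \<comment> \<open>The new factor stands on the right and so acts on \<open>x\<close> first;
      \<open>f\<close> then meets a combination of \<open>x\<close> and
      \<open>e O x\<close>.\<close>
    have eq: "(f \<otimes>\<^bsub>rook.A\<^esub> u) \<otimes>\<^bsub>rook.A\<^esub> bas x = f \<otimes>\<^bsub>rook.A\<^esub> (u \<otimes>\<^bsub>rook.A\<^esub> bas x)"
      using f u x by (simp add: rook.mult_assoc rook.fs)
    show ?thesis
    proof (cases "Suc k \<in> Domain x")
      case False
      have sub: "x \<subseteq> {1..n} \<times> {1..n}" using x by (simp add: rook_diagrams_def)
      have "(a, b) \<in> e O x" if ab: "(a, b) \<in> x" for a b
      proof -
        have "a \<in> {1..n} - {Suc k}" using ab sub False by blast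
        then have "(a, a) \<in> e" unfolding e_def by (rule Id_onI)
        then show ?thesis using ab by blast
      qed
      then have "x \<subseteq> e O x" by (rule subrelI)
      moreover have "e O x \<subseteq> x" by (auto simp: e_def)
      ultimately have "e O x = x" by (rule equalityI[rotated])
      \<comment> \<open>Neither \<open>e\<close> nor \<open>x\<close> has an edge at the middle node
        \<open>Suc k\<close>, while every other middle node has an edge of \<open>e\<close>.\<close>
      moreover have "{j \<in> {1..n}. j \<notin> Range e \<and> j \<notin> Domain x} = {Suc k}"
        using False Suc.prems by (auto simp: e_def)
      then have "\<epsilon> [^] isolated_middle n e x = \<epsilon>"
        using \<epsilon>_closed by (simp add: isolated_eq One_nat_def)
      ultimately have "u \<otimes>\<^bsub>rook.A\<^esub> bas x = (\<lambda>y. bas x y \<oplus> (c \<otimes> \<epsilon>) \<otimes> bas x y)"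
        using c(1) \<epsilon>_closed by (simp add: ux[OF x] m_assoc fin_supp_closed[OF rook.bas_in[OF x]])
      also have "\<dots> = (\<lambda>_. \<zero>)"
        by (simp add: c(2) l_minus fin_supp_closed[OF rook.bas_in[OF x]] r_neg)
      finally show ?thesis by (simp add: eq f)
    next
      case True
      \<comment> \<open>As \<open>i\<close> is not \<open>Suc k\<close>, both \<open>x\<close> and
        \<open>e O x\<close> lack an edge at some node up to \<open>k\<close>, and \<open>f\<close>
        annihilates both.\<close>
      then have i: "i \<in> {1..k}" "i \<notin> Domain x" using i by (auto simp: le_Suc_eq)
      moreover have "i \<notin> Domain (e O x)" using i by (auto simp: e_def)
      ultimately show ?thesis
        using c(1) \<epsilon>_closed f x ex fk[OF x i] fk[OF ex i(1)]
        by (simp add: eq ux[OF x] rook.fs rook.r_distr' rook.smult_r)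
    qed
  qed
  ultimately show ?case
    using rook.mult_fin_supp[OF f(1) u] by blast
qed

text \<open>Because \<open>f\<close> annihilates the kernel of \<pi>, the map \<open>s\<close>
  satisfies \<open>s (\<pi> a) = f a\<close>; and left multiplication by \<open>f\<close> commutes
  with the right action.\<close>

lemma split_ring_hom_rook_group:
  "\<exists>s. split_ring_hom (rook_algebra R n \<epsilon>) (group_algebra R (sym_group n)) \<pi> s"
proof -
  obtain f where f: "f \<in> fin_supp R X" "\<pi> f = bas id"
    and f0: "\<And>x i. \<lbrakk>x \<in> X; i \<in> {1..n}; i \<notin> Domain x\<rbrakk> \<Longrightarrow> f \<otimes>\<^bsub>rook.A\<^esub> bas x = (\<lambda>_. \<zero>)"
    using rook_annihilator_exists[OF le_refl] by blast
  define s where "s b = f \<otimes>\<^bsub>rook.A\<^esub> lift b" for b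
  \<comment> \<open>\<open>lift (\<pi> a)\<close> is \<open>a\<close> without its diagrams that miss
    an edge, and these are killed by \<open>f\<close>.\<close>
  have s\<pi>: "s (\<pi> a) = f \<otimes>\<^bsub>rook.A\<^esub> a" if "a \<in> fin_supp R X" for a
    unfolding s_def using that
  proof (induction rule: rook.induct_fs)
    case zero
    show ?case by (simp add: rook_lift_proj)
  next
    case (add x r g)
    let ?P = "perm_diagram n ` {p. p permutes {1..n}}"
    have "f \<otimes>\<^bsub>rook.A\<^esub> lift (\<pi> (bas x)) = f \<otimes>\<^bsub>rook.A\<^esub> bas x"
    proof (cases "x \<in> ?P")
      case True
      then have "lift (\<pi> (bas x)) = bas x" by (auto simp: rook_lift_proj basis_elt_def fun_eq_iff)
      then show ?thesis by simp
    next
      case False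
      then have z: "lift (\<pi> (bas x)) = (\<lambda>_. \<zero>)" by (auto simp: rook_lift_proj basis_elt_def fun_eq_iff)
      have "Domain x \<noteq> {1..n}" using False perfect_rook_perm_diagram[OF add(1)] by blast
      moreover have "Domain x \<subseteq> {1..n}" using add(1) by (auto simp: rook_diagrams_def)
      ultimately obtain i where "i \<in> {1..n}" "i \<notin> Domain x" by blast
      then show ?thesis using f0[OF add(1)] by (simp add: z f)
    qed
    moreover have "lift (\<pi> (\<lambda>y. g y \<oplus> r \<otimes> bas x y)) = (\<lambda>y. lift (\<pi> g) y \<oplus> r \<otimes> lift (\<pi> (bas x)) y)"
      using add by (auto simp: rook_lift_proj fun_eq_iff)
    moreover have "lift (\<pi> g) \<in> fin_supp R X" "lift (\<pi> (bas x)) \<in> fin_supp R X"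
      using add by (simp_all add: rook_lift_closed rook_proj_closed rook.bas_in)
    ultimately show ?case
      using add f by (simp add: rook.fs rook.r_distr' rook.smult_r)
  qed
  have "split_ring_hom rook.A grp.A \<pi> s"
  proof (intro split_ring_hom.intro split_ring_hom_axioms.intro rook.ring_A grp.ring_A)
    have "\<pi> (\<lambda>x. g x \<oplus> h x) = (\<lambda>p. \<pi> g p \<oplus> \<pi> h p)" for g h
      by (auto simp: rook_proj_def fun_eq_iff)
    moreover have "\<pi> (bas (Id_on {1..n})) = bas id"
      using rook_proj_bas_perm[OF permutes_id] by (simp only: perm_diagram_id)
    ultimately show "\<pi> \<in> ring_hom rook.A grp.A"
      by (intro ring_hom_memI; unfold rook.A_simps grp.A_simps)
        (simp_all add: rook_proj_closed rook_proj_mult sym_group_one)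
    have lift_add: "lift (\<lambda>x. b x \<oplus> b' x) = (\<lambda>x. lift b x \<oplus> lift b' x)" for b b'
      by (auto simp: rook_lift_def fun_eq_iff)
    fix b assume "b \<in> carrier grp.A"
    then have b: "b \<in> fin_supp R S" by (simp add: grp.A_simps)
    then show "s b \<in> carrier rook.A" using f by (simp add: s_def rook.A_simps rook.fs rook_lift_closed)
    have "\<pi> (s b) = \<one>\<^bsub>grp.A\<^esub> \<otimes>\<^bsub>grp.A\<^esub> b"
      using f b by (simp add: s_def rook_proj_mult rook_lift_closed rook_proj_lift group_algebra_one)
    then show "\<pi> (s b) = b"
      using ring.ring_simprules(12)[OF grp.ring_A, of b] b by (simp add: grp.A_simps)
    { fix b' assume "b' \<in> carrier grp.A"
      then have b': "b' \<in> fin_supp R S" by (simp add: grp.A_simps)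
      show "s (b \<oplus>\<^bsub>grp.A\<^esub> b') = s b \<oplus>\<^bsub>rook.A\<^esub> s b'"
        using f b b' by (simp add: s_def grp.A_simps rook.A_simps lift_add rook.r_distr' rook_lift_closed) }
    fix a assume "a \<in> carrier rook.A"
    then have a: "a \<in> fin_supp R X" by (simp add: rook.A_simps)
    \<comment> \<open>Writing \<open>b\<close> as \<open>\<pi> (lift b)\<close> turns the product in
      the group algebra into the image of one in the rook algebra.\<close>
    have "s (b \<otimes>\<^bsub>grp.A\<^esub> \<pi> a) = s (\<pi> (lift b \<otimes>\<^bsub>rook.A\<^esub> a))"
      using a b by (simp add: rook_proj_mult rook_lift_closed rook_proj_lift)
    also have "\<dots> = f \<otimes>\<^bsub>rook.A\<^esub> (lift b \<otimes>\<^bsub>rook.A\<^esub> a)"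
      using a b by (intro s\<pi>) (simp add: rook.fs rook_lift_closed)
    also have "\<dots> = s b \<otimes>\<^bsub>rook.A\<^esub> a"
      using a b f by (simp add: s_def rook_lift_closed rook.mult_assoc)
    finally show "s (b \<otimes>\<^bsub>grp.A\<^esub> \<pi> a) = s b \<otimes>\<^bsub>rook.A\<^esub> a" .
  qed
  then show ?thesis unfolding rook_algebra_eq group_algebra_eq by blast
qed

lemma trivial_rook_module_restrict:
  assumes "a \<in> carrier (rook_algebra R n \<epsilon>)"
  shows "a \<odot>\<^bsub>trivial_rook_module R n\<^esub> r = \<pi> a \<odot>\<^bsub>trivial_group_module R\<^esub> r"
  using assms rook_proj_chi[of a]
  by (simp add: trivial_rook_module_def trivial_group_module_def rook.char_smult grp.char_smult
      rook_algebra_eq rook.A_simps)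

lemma rook_proj_scalar:
  assumes "r \<in> carrier R"
  shows "r \<odot>\<^bsub>rook_algebra R n \<epsilon>\<^esub> \<one>\<^bsub>rook_algebra R n \<epsilon>\<^esub> \<in> carrier (rook_algebra R n \<epsilon>) \<and>
    \<pi> (r \<odot>\<^bsub>rook_algebra R n \<epsilon>\<^esub> \<one>\<^bsub>rook_algebra R n \<epsilon>\<^esub>) =
      r \<odot>\<^bsub>group_algebra R (sym_group n)\<^esub> \<one>\<^bsub>group_algebra R (sym_group n)\<^esub>"
  using assms rook_proj_bas_perm[OF permutes_id]
  unfolding rook_algebra_eq group_algebra_eq rook.A_simps grp.A_simps
  by (simp add: rook.fs rook.e_closed rook_proj_smult perm_diagram_id sym_group_one)

end

theorem theorem5p4:
  fixes R :: "('r, 'c) ring_scheme" and n :: nat and \<epsilon> :: 'r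
  assumes "cring R" and "\<epsilon> \<in> Units R"
  shows "\<forall>k. mod_iso R
    (Tor R (rook_algebra R n \<epsilon>) (trivial_rook_module R n) (trivial_rook_module R n) k)
    (Tor R (group_algebra R (sym_group n)) (trivial_group_module R) (trivial_group_module R) k)"
proof
  fix k
  interpret cring R by fact
  obtain s where s: "split_ring_hom (rook_algebra R n \<epsilon>) (group_algebra R (sym_group n)) (rook_proj R n) s"
    using split_ring_hom_rook_group[OF assms] by blast
  have c: "carrier (trivial_rook_module R n) = carrier (trivial_group_module R)"
    "\<zero>\<^bsub>trivial_rook_module R n\<^esub> = \<zero>\<^bsub>trivial_group_module R\<^esub>"
    "x \<oplus>\<^bsub>trivial_rook_module R n\<^esub> y = x \<oplus>\<^bsub>trivial_group_module R\<^esub> y" for x y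
    by (simp_all add: trivial_rook_module_def trivial_group_module_def char_module_def)
  show "mod_iso R
    (Tor R (rook_algebra R n \<epsilon>) (trivial_rook_module R n) (trivial_rook_module R n) k)
    (Tor R (group_algebra R (sym_group n)) (trivial_group_module R) (trivial_group_module R) k)"
    by (rule Tor_iso_split_ring_hom[OF assms(1) s rook_proj_scalar[OF assms]
          trivial_group_modules(1)[OF assms(1)] trivial_rook_modules(1)[OF assms(1) Units_closed[OF assms(2)]]
          c trivial_rook_module_restrict[OF assms]
          trivial_rook_modules(2)[OF assms(1) Units_closed[OF assms(2)]]
          c(1,3) trivial_rook_module_restrict[OF assms]])
qed

end
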